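(* Let $L,M>0$. There exists $\bar\kappa>0$ depending only on $L,M$ such that for every $\kappa_0\in(0,\bar\kappa]$ there is a tuning constant $c_{\mathsf{srs},1}>0$ depending only on $L,M,\kappa_0$ for which the following holds. Let $\gamma>0$ and $\delta\in(0,1)$. Then there exist $C_\delta>0$ and an integer $N_0$, both depending only on $L,M,\kappa_0,\delta,\gamma$, such that for all $N=2n\ge N_0$, all $p\ge2$ with $p\ge\gamma n$ and all $1\le s\le p$ with $s\log(ep/s)/N\le\kappa_0$, if the $\xi_i$ are $L$-subGaussian and the $X_{ij}$ are $M$-subGaussian, then: (a) the estimator $\hat\Lambda_D^{HD}$ satisfies $$\sup_{\sigma>0}\sup_{\boldsymbol\theta\in B_0(s)}\mathbf P_{\boldsymbol\theta,\sigma}\Big(\big|\hat\Lambda_D^{HD}-\|\boldsymbol\theta\|_2\big|>C_\delta\sigma\frac{p^{1/4}}{\sqrt N}\Big)\le\delta;$$ (b) the estimator $\hat Q_D^{HD}$ satisfies $$\sup_{\sigma>0}\sup_{\boldsymbol\theta\in B_0(s)}\mathbf P_{\boldsymbol\theta,\sigma}\Big(\big|\hat Q_D^{HD}-\|\boldsymbol\theta\|_2^2\big|>C_\delta\Big(\sigma^2\frac{\sqrt p}N+\sigma\frac{\|\boldsymbol\theta\|_2}{\sqrt N}\Big)\Big)\le\delta;$$ (c) the minimax scaling satisfies $q^*_{\boldsymbol\theta}\le\min\big(C_\delta(\sigma^2\frac{\sqrt p}N+\sigma\frac{\|\boldsymbol\theta\|_2}{\sqrt N}),\|\boldsymbol\theta\|_2^2\big)$,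 i.e. $$\inf_{\hat T}\sup_{\sigma>0}\sup_{\boldsymbol\theta\in B_0(s)}\mathbf P_{\boldsymbol\theta,\sigma}\Big(\big|\hat T-\|\boldsymbol\theta\|_2^2\big|>\min\Big(C_\delta\Big(\sigma^2\frac{\sqrt p}N+\sigma\frac{\|\boldsymbol\theta\|_2}{\sqrt N}\Big),\|\boldsymbol\theta\|_2^2\Big)\Big)\le\delta;$$ (d) for every $\kappa>0$, $q^*_{s,\kappa}\le\min\big(C_\delta(\sigma^2\frac{\sqrt p}N+\sigma\frac{\kappa}{\sqrt N}),\kappa^2\big)$, i.e. $$\inf_{\hat T}\sup_{\sigma>0}\ \sup_{\boldsymbol\theta\in B_0(s),\,\|\boldsymbol\theta\|_2\le\kappa}\mathbf P_{\boldsymbol\theta,\sigma}\Big(\big|\hat T-\|\boldsymbol\theta\|_2^2\big|>\min\Big(C_\delta\Big(\sigma^2\frac{\sqrt p}N+\sigma\frac{\kappa}{\sqrt N}\Big),\kappa^2\Big)\Big)\le\delta.$$ Here $\inf_{\hat T}$ is the infimum over all estimators.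
   Context: Model: one observes $(\mathbb X,\mathbf Y)$ with $\mathbf Y=\mathbb X\boldsymbol\theta+\sigma\boldsymbol\xi$, where $\mathbb X=(X_{ij})$ is a random $N\times p$ matrix, $\boldsymbol\theta\in\mathbb R^p$, $\boldsymbol\xi=(\xi_1,\dots,\xi_N)\in\mathbb R^N$ is random noise and $\sigma>0$. The $N(p+1)$ random variables $X_{ij},\xi_i$ are jointly independent, with zero mean and variance $1$. $\mathbf P_{\boldsymbol\theta,\sigma}$ is the law of $(\mathbb X,\mathbf Y)$. $B_0(s)$ is the set of vectors in $\mathbb R^p$ with at most $s$ nonzero components. A random variable $Z$ is $L$-subGaussian if $\mathbf E\exp(tZ)\le\exp(L^2t^2/2)$ for all $t\in\mathbb R$. An estimator is a measurable function of $(\mathbb X,\mathbf Y)$ (not depending on $\boldsymbol\theta,\sigma$; it may depend on $p,N,s,\kappa,\delta$ and the constants). The sample is split (by rows) into two disjoint subsamples $(\mathbb X_1,\mathbf Y_1),(\mathbb X_2,\mathbf Y_2)$, each of size $n$. The Square-Root Slope estimator is $$\hat{\boldsymbol\theta}_{\mathsf{srs}}\in\arg\min_{\mathbf t\in\mathbb R^p}\Big\{\tfrac1{\sqrt n}\|\mathbf Y_1-\mathbb X_1\mathbf t\|_2+\|\mathbf t\|_*\Big\},\quad\|\mathbf t\|_*=\sum_{i=1}^p\lambda_i|t|_{(p-i+1)},\quad\lambda_j=c_{\mathsf{srs},1}\sqrt{\frac{\log(2p/j)}n},$$ where $|t|_{(1)}\le\dots\le|t|_{(p)}$ are the order statistics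 of $|t_1|,\dots,|t_p|$. For an estimator $\hat{\boldsymbol\theta}=(\hat\theta_1,\dots,\hat\theta_p)$ based on $(\mathbb X_1,\mathbf Y_1)$ define $$a_j(\hat{\boldsymbol\theta})=\hat\theta_j^2+\frac{2\hat\theta_j}{n}\mathbf X_{2,j}^T(\mathbf Y_2-\mathbb X_2\hat{\boldsymbol\theta})+\frac1{n(n-1)}\sum_{k\ne l}X_{2,kj}X_{2,lj}\big(Y_{2,k}-\mathbf X_2^k\hat{\boldsymbol\theta}\big)\big(Y_{2,l}-\mathbf X_2^l\hat{\boldsymbol\theta}\big),$$ where $\mathbf X_{2,j}$, $\mathbf X_2^k$ and $X_{2,kj}$ are the $j$th column, the $k$th row and the $(k,j)$ entry of $\mathbb X_2$, and $Y_{2,k}$ is the $k$th entry of $\mathbf Y_2$. Set $\hat Q_D^{HD}=\sum_{j=1}^pa_j(\hat{\boldsymbol\theta}_{\mathsf{srs}})$ and $\hat\Lambda_D^{HD}=|\hat Q_D^{HD}|^{1/2}$. The minimax scaling $q^*_{\boldsymbol\theta}$ (depending on $\boldsymbol\theta$ only through $\|\boldsymbol\theta\|_2$ and $\|\boldsymbol\theta\|_0$) is understood as in (c), and $q^*_{s,\kappa}=\max\{q^*_{\boldsymbol\theta}:\|\boldsymbol\theta\|_0\le s,\|\boldsymbol\theta\|_2\le\kappa\}$ is the corresponding rate on $B_0(s)\cap\{\|\boldsymbol\theta\|_2\le\kappa\}$, understood as in (d). *)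

theory Defs
  imports "HOL-Probability.Probability"
begin

(* A sample (x, y): design entries x (i, j) with row i and column j, and responses y i.
   Rows are indexed by a finite set R, columns by {..<p}; vectors of R^p are extensional
   functions on {..<p}. *)
type_synonym sample = "(nat \<times> nat \<Rightarrow> real) \<times> (nat \<Rightarrow> real)"

definition vec_space :: "nat \<Rightarrow> (nat \<Rightarrow> real) measure" where
  "vec_space p = (\<Pi>\<^sub>M j\<in>{..<p}. borel)"

definition sample_space :: "nat set \<Rightarrow> nat \<Rightarrow> sample measure" where
  "sample_space R p = (\<Pi>\<^sub>M ij\<in>R \<times> {..<p}. borel) \<Otimes>\<^sub>M (\<Pi>\<^sub>M i\<in>R. borel)"

definition subsample :: "nat set \<Rightarrow> nat \<Rightarrow> sample \<Rightarrow> sample" where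
  "subsample R p = (\<lambda>(x, y). (restrict x (R \<times> {..<p}), restrict y R))"

definition l2_norm :: "nat \<Rightarrow> (nat \<Rightarrow> real) \<Rightarrow> real" where
  "l2_norm p \<theta> = L2_set \<theta> {..<p}"

definition sparse_vecs :: "nat \<Rightarrow> nat \<Rightarrow> (nat \<Rightarrow> real) set" where
  "sparse_vecs p s = {\<theta> \<in> space (vec_space p). card {j \<in> {..<p}. \<theta> j \<noteq> 0} \<le> s}"


definition subgaussian :: "'a measure \<Rightarrow> real \<Rightarrow> ('a \<Rightarrow> real) \<Rightarrow> bool" where
  "subgaussian D L Z \<longleftrightarrow>
     (\<forall>t. integrable D (\<lambda>\<omega>. exp (t * Z \<omega>)) \<and> (\<integral>\<omega>. exp (t * Z \<omega>) \<partial>D) \<le> exp (L\<^sup>2 * t\<^sup>2 / 2))"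

primrec coord :: "(nat \<times> nat) + nat \<Rightarrow> sample \<Rightarrow> real" where
  "coord (Inl ij) w = fst w ij"
| "coord (Inr i) w = snd w i"

(* D is the joint law of the design X and the noise \<xi>. The marginal laws need not be equal.
   Working with the law, instead of with random variables on an unspecified probability space,
   lets constants be chosen before D without depending on the type of the sample points.
   The variance condition entails square integrability, as non-integrable functions have
   integral 0. *)
definition design_noise_law :: "nat \<Rightarrow> nat \<Rightarrow> sample measure \<Rightarrow> bool" where
  "design_noise_law N p D \<longleftrightarrow>
     prob_space D \<and> sets D = sets (sample_space {..<N} p) \<and>
     prob_space.indep_vars D (\<lambda>_. borel) coord (({..<N} \<times> {..<p}) <+> {..<N}) \<and>
     (\<forall>k \<in> ({..<N} \<times> {..<p}) <+> {..<N}.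
        integrable D (coord k) \<and> (\<integral>w. coord k w \<partial>D) = 0 \<and>
        (\<integral>w. (coord k w - (\<integral>v. coord k v \<partial>D))\<^sup>2 \<partial>D) = 1)"

(* The law of (X, X \<theta> + \<sigma> \<xi>) when (X, \<xi>) has law D. *)
definition obs_law ::
    "nat \<Rightarrow> nat \<Rightarrow> sample measure \<Rightarrow> (nat \<Rightarrow> real) \<Rightarrow> real \<Rightarrow> sample measure" where
  "obs_law N p D \<theta> \<sigma> = distr D (sample_space {..<N} p)
     (\<lambda>(x, e). (x, \<lambda>i\<in>{..<N}. (\<Sum>j<p. x (i, j) * \<theta> j) + \<sigma> * e i))"

definition obs_prob ::
    "nat \<Rightarrow> nat \<Rightarrow> sample measure \<Rightarrow> (nat \<Rightarrow> real) \<Rightarrow> real \<Rightarrow> (sample \<Rightarrow> bool) \<Rightarrow> ennreal" where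
  "obs_prob N p D \<theta> \<sigma> E =
     emeasure (obs_law N p D \<theta> \<sigma>) {d \<in> space (obs_law N p D \<theta> \<sigma>). E d}"

definition estimators :: "nat \<Rightarrow> nat \<Rightarrow> (sample \<Rightarrow> real) set" where
  "estimators N p = borel_measurable (sample_space {..<N} p)"


(* k-th smallest of the absolute values of the entries, 1 \<le> k \<le> p *)
definition abs_order_stat :: "nat \<Rightarrow> (nat \<Rightarrow> real) \<Rightarrow> nat \<Rightarrow> real" where
  "abs_order_stat p t k = sort (map (\<lambda>j. \<bar>t j\<bar>) [0..<p]) ! (k - 1)"

definition slope_weight :: "real \<Rightarrow> nat \<Rightarrow> nat \<Rightarrow> nat \<Rightarrow> real" where
  "slope_weight c n p j = c * sqrt (ln (2 * real p / real j) / real n)"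

definition slope_norm :: "real \<Rightarrow> nat \<Rightarrow> nat \<Rightarrow> (nat \<Rightarrow> real) \<Rightarrow> real" where
  "slope_norm c n p t = (\<Sum>i=1..p. slope_weight c n p i * abs_order_stat p t (p - i + 1))"

definition residual :: "nat \<Rightarrow> (nat \<Rightarrow> real) \<Rightarrow> sample \<Rightarrow> nat \<Rightarrow> real" where
  "residual p t = (\<lambda>(x, y) i. y i - (\<Sum>j<p. x (i, j) * t j))"

definition srs_objective :: "real \<Rightarrow> nat set \<Rightarrow> nat \<Rightarrow> sample \<Rightarrow> (nat \<Rightarrow> real) \<Rightarrow> real" where
  "srs_objective c R p d t =
     1 / sqrt (real (card R)) * L2_set (residual p t d) R + slope_norm c (card R) p t"

(* Minimisers need not be unique: a square-root Slope estimator is any measurable selection. *)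
definition srs_estimator :: "real \<Rightarrow> nat set \<Rightarrow> nat \<Rightarrow> (sample \<Rightarrow> nat \<Rightarrow> real) \<Rightarrow> bool" where
  "srs_estimator c R p th \<longleftrightarrow>
     th \<in> sample_space R p \<rightarrow>\<^sub>M vec_space p \<and>
     (\<forall>d \<in> space (sample_space R p).
        is_arg_min (srs_objective c R p d) (\<lambda>t. t \<in> space (vec_space p)) (th d))"


(* a_j evaluated at the vector t, with (X_2, Y_2) = d having rows R *)
definition a_stat :: "nat set \<Rightarrow> nat \<Rightarrow> sample \<Rightarrow> (nat \<Rightarrow> real) \<Rightarrow> nat \<Rightarrow> real" where
  "a_stat R p d t j = (t j)\<^sup>2
     + 2 * t j / real (card R) * (\<Sum>k\<in>R. fst d (k, j) * residual p t d k)
     + 1 / (real (card R) * (real (card R) - 1)) *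
       (\<Sum>(k, l) \<in> {(k, l) \<in> R \<times> R. k \<noteq> l}.
          fst d (k, j) * fst d (l, j) * residual p t d k * residual p t d l)"

definition Q_HD ::
    "nat set \<Rightarrow> nat set \<Rightarrow> nat \<Rightarrow> (sample \<Rightarrow> nat \<Rightarrow> real) \<Rightarrow> sample \<Rightarrow> real" where
  "Q_HD R\<^sub>1 R\<^sub>2 p th d =
     (\<Sum>j<p. a_stat R\<^sub>2 p (subsample R\<^sub>2 p d) (th (subsample R\<^sub>1 p d)) j)"

definition Lambda_HD ::
    "nat set \<Rightarrow> nat set \<Rightarrow> nat \<Rightarrow> (sample \<Rightarrow> nat \<Rightarrow> real) \<Rightarrow> sample \<Rightarrow> real" where
  "Lambda_HD R\<^sub>1 R\<^sub>2 p th d = sqrt \<bar>Q_HD R\<^sub>1 R\<^sub>2 p th d\<bar>"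

end

theory Submission
  imports Defs "HOL-Combinatorics.List_Permutation"
begin

text \<open>
The first-stage error only has to be of the order of the noise level, which removes the noise from
the analysis of square-root Slope: comparing the objective at the minimiser and at the true vector
and using the triangle inequality, everything reduces to a lower bound for \<open>\<parallel>X u\<parallel>\<close>, uniformly
in \<open>u\<close>, by \<open>\<surd>n (\<parallel>u\<parallel>/4 - b \<parallel>u\<parallel>\<^sub>*)\<close> with a Slope norm. For that bound, \<open>u\<close> is rounded towards 0
to a lattice with step \<open>\<tau>\<close>. The lattice points are few enough for a union bound over the lower
tails of \<open>\<parallel>X z\<parallel>\<close>. The rounding error has coordinates at most \<open>\<tau>\<close>, and its image is tested
against a net of the unit ball of \<open>\<real>\<^sup>n\<close>: for a fixed direction \<open>v\<close>, the largest coordinates of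
\<open>X\<^sup>T v\<close> are controlled by the exponential moment of \<open>\<Sum>\<^sub>j max 0 (g\<^sub>j\<^sup>2/(4K\<^sup>2) - l)\<close>, and Abel
summation against the sorted \<open>|u|\<close> turns the partial sums into the Slope norm.

Conditionally on the first subsample, the statistic is unbiased; its deviation is a linear term in
\<open>\<theta>\<close> plus a degenerate U-statistic, and Chebyshev's inequality gives (b), which implies (a). For
(c), the statistic built on a sparse least squares estimator is set to 0 below a threshold
proportional to the residual variance on the second subsample; (d) follows by monotonicity.
\<close>

section \<open>Sorted weights and the Slope norm\<close>

text \<open>For square-root Slope, the Slope norm of the first-stage error never has to be bounded:
  it enters once through the penalty and once, with opposite sign, through the lower bound on the
  design, and \<open>c = sqrt 2 * slope_base K\<close> makes the two cancel. What remains is a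
  multiple of the noise norm, for which Markov's inequality is enough. The lower bound turns on the
  largest \<open>k\<close> with \<open>k * log_rank p k\<close> at most \<open>c1 * n\<close>. Up to
  this sparsity few enough lattice points suffice; beyond it \<open>n\<close> is paid for by the
  Slope weights. The target of (c) is at most the squared norm of \<theta>, so at \<theta> = 0 the
  estimate has to be exactly 0. As \<sigma> is unknown, the threshold must come from the data, and
  the residual variance is within constant factors of \<sigma>^2 just because the first-stage error
  is of order \<sigma>. Parts (a) and (b) concern an arbitrary measurable selection of minimisers,
  whereas (c) and (d) call for an explicit estimator. Sparse least squares is therefore built as a
  limit over rational sparse vectors, with measurability visible from the construction.\<close>

lemma abel_sum_le:
  fixes a c :: "nat \<Rightarrow> real"
  assumes anti: "\<And>i j. 1 \<le> i \<Longrightarrow> i \<le> j \<Longrightarrow> j \<le> p \<Longrightarrow> a j \<le> a i"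
    and nonneg: "\<And>i. 1 \<le> i \<Longrightarrow> i \<le> p \<Longrightarrow> 0 \<le> a i"
    and partial: "\<And>i. 1 \<le> i \<Longrightarrow> i \<le> p \<Longrightarrow> (\<Sum>l=1..i. c l) \<le> P"
    and "p \<ge> 1"
  shows "(\<Sum>i=1..p. a i * c i) \<le> a 1 * P"
proof -
  define S where "S i = (\<Sum>l=1..i. c l)" for i
  \<comment> \<open>The last partial sum stays exact in the induction claim, so that only the
    decrements \<open>a m - a (Suc m)\<close> meet the bound \<open>P\<close>; nonnegativity of
    \<open>a\<close> is spent once, at \<open>m = p\<close>.\<close>
  have "(\<Sum>i=1..m. a i * c i) \<le> (a 1 - a m) * P + a m * S m" if "1 \<le> m" "m \<le> p" for m
    using that
  proof (induction m)
    case 0 then show ?case by simp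
  next
    case (Suc m)
    show ?case
    proof (cases "m = 0")
      case True then show ?thesis by (simp add: S_def)
    next
      case False
      then have IH: "(\<Sum>i=1..m. a i * c i) \<le> (a 1 - a m) * P + a m * S m" using Suc by simp
      have "(\<Sum>i=1..Suc m. a i * c i) \<le> (a 1 - a m) * P + a m * S m + a (Suc m) * c (Suc m)"
        using IH by simp
      also have "\<dots> = (a 1 - a m) * P + (a m - a (Suc m)) * S m + a (Suc m) * S (Suc m)"
        by (simp add: S_def algebra_simps)
      also have "\<dots> \<le> (a 1 - a m) * P + (a m - a (Suc m)) * P + a (Suc m) * S (Suc m)"
        using mult_left_mono[of "S m" P "a m - a (Suc m)"] anti[of m "Suc m"] partial[of m] Suc.prems False
        by (simp add: S_def)
      finally show ?thesis by (simp add: algebra_simps)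
    qed
  qed
  from this[of p] have "(\<Sum>i=1..p. a i * c i) \<le> (a 1 - a p) * P + a p * S p" using \<open>p \<ge> 1\<close> by simp
  also have "\<dots> \<le> (a 1 - a p) * P + a p * P"
    using mult_left_mono[of "S p" P "a p"] nonneg[of p] partial[of p] \<open>p \<ge> 1\<close> by (simp add: S_def)
  finally show ?thesis by (simp add: algebra_simps)
qed

text \<open>Rank 1 belongs to the largest absolute value, and ties may be broken in any way. Written
  as a sum over coordinates with rank weights, Slope norms of different vectors can be compared
  coordinate by coordinate, which order statistics do not allow.\<close>

definition ranking :: "nat \<Rightarrow> (nat \<Rightarrow> real) \<Rightarrow> (nat \<Rightarrow> nat) \<Rightarrow> bool" where
  "ranking p u r \<longleftrightarrow> bij_betw r {..<p} {1..p} \<and>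
     (\<forall>i<p. \<forall>j<p. r i \<le> r j \<longrightarrow> \<bar>u j\<bar> \<le> \<bar>u i\<bar>)"

lemma slope_norm_ranking_ex:
  obtains r where "ranking p u r"
    "\<And>c n. slope_norm c n p u = (\<Sum>j<p. slope_weight c n p (r j) * \<bar>u j\<bar>)"
proof -
  define L where "L = sort (map (\<lambda>j. \<bar>u j\<bar>) [0..<p])"
  have "mset L = mset (map (\<lambda>j. \<bar>u j\<bar>) [0..<p])" by (simp add: L_def)
  then obtain f where f: "bij_betw f {..<length L} {..<length (map (\<lambda>j. \<bar>u j\<bar>) [0..<p])}"
    "\<forall>i<length L. L ! i = map (\<lambda>j. \<bar>u j\<bar>) [0..<p] ! f i"
    using permutation_Ex_bij by blast
  have lenL: "length L = p" by (simp add: L_def)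
  have bf: "bij_betw f {..<p} {..<p}" using f(1) lenL by simp
  have Lf: "L ! i = \<bar>u (f i)\<bar>" if "i < p" for i
    using f(2) lenL that bij_betwE[OF bf] by simp
  define g where "g = inv_into {..<p} f"
  have bg: "bij_betw g {..<p} {..<p}" unfolding g_def by (rule bij_betw_inv_into[OF bf])
  have fg: "f (g j) = j" if "j < p" for j
    using that bf by (simp add: g_def bij_betw_inv_into_right)
  have glt: "g j < p" if "j < p" for j using bij_betwE[OF bg] that by auto
  have Lg: "L ! (g j) = \<bar>u j\<bar>" if "j < p" for j using Lf[OF glt[OF that]] fg[OF that] by simp
  \<comment> \<open>\<open>g j\<close> is a position counted from 0 in increasing order,
    \<open>r j\<close> a rank counted from 1 in decreasing order. Rank \<open>i\<close> meets the
    order statistic \<open>p - i + 1\<close>, which \<open>abs_order_stat\<close> reads at list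
    index \<open>p - i\<close>.\<close>
  define r where "r j = p - g j" for j
  have b2: "bij_betw (\<lambda>i. p - i) {..<p} {1..p}"
    by (rule bij_betw_byWitness[where f' = "\<lambda>i. p - i"]) auto
  have br: "bij_betw r {..<p} {1..p}"
    using bij_betw_trans[OF bg b2] unfolding r_def comp_def .
  have srt: "sorted L" by (simp add: L_def)
  have rk: "ranking p u r" unfolding ranking_def
  proof (intro conjI allI impI br)
    fix i j assume ij: "i < p" "j < p" "r i \<le> r j"
    have "g j \<le> g i" using ij glt[of i] glt[of j] by (simp add: r_def)
    then have "L ! g j \<le> L ! g i" using srt sorted_nth_mono glt[OF ij(1)] lenL by metis
    then show "\<bar>u j\<bar> \<le> \<bar>u i\<bar>" using Lg ij by simp
  qed
  have "slope_norm c n p u = (\<Sum>j<p. slope_weight c n p (r j) * \<bar>u j\<bar>)" for c n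
  proof -
    have "slope_norm c n p u = (\<Sum>i\<in>{1..p}. slope_weight c n p i * L ! (p - i))"
      unfolding slope_norm_def abs_order_stat_def L_def by simp
    also have "\<dots> = (\<Sum>j<p. slope_weight c n p (r j) * L ! (p - r j))"
      by (rule sum.reindex_bij_betw[OF br, symmetric])
    also have "\<dots> = (\<Sum>j<p. slope_weight c n p (r j) * \<bar>u j\<bar>)"
      using glt Lg by (intro sum.cong refl) (simp add: r_def less_imp_le)
    finally show ?thesis .
  qed
  with rk show ?thesis using that by blast
qed

lemma ranking_scale:
  "ranking p u r \<Longrightarrow> ranking p (\<lambda>j. a * u j) r"
  by (auto simp: ranking_def abs_mult intro: mult_left_mono)

lemma ranking_inv:
  assumes "ranking p u r"
  obtains q where "bij_betw q {1..p} {..<p}" "\<And>i. i \<in> {1..p} \<Longrightarrow> r (q i) = i"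
    "\<And>j. j < p \<Longrightarrow> q (r j) = j"
    "\<And>i j. 1 \<le> i \<Longrightarrow> i \<le> j \<Longrightarrow> j \<le> p \<Longrightarrow> \<bar>u (q j)\<bar> \<le> \<bar>u (q i)\<bar>"
proof -
  have br: "bij_betw r {..<p} {1..p}" using assms by (simp add: ranking_def)
  define q where "q = inv_into {..<p} r"
  have bq: "bij_betw q {1..p} {..<p}" unfolding q_def by (rule bij_betw_inv_into[OF br])
  have rq: "r (q i) = i" if "i \<in> {1..p}" for i
    using that br by (simp add: q_def bij_betw_inv_into_right)
  have qr: "q (r j) = j" if "j < p" for j
    using that br by (simp add: q_def bij_betw_inv_into_left)
  have "\<bar>u (q j)\<bar> \<le> \<bar>u (q i)\<bar>" if "1 \<le> i" "i \<le> j" "j \<le> p" for i j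
    using assms rq[of i] rq[of j] that bij_betwE[OF bq] unfolding ranking_def by auto
  then show ?thesis using that bq rq qr by blast
qed

lemma sum_le_top_sum:
  fixes x :: "nat \<Rightarrow> real"
  assumes "finite S" "finite T" "card S = card T" "\<And>i j. i \<in> S \<Longrightarrow> i \<notin> T \<Longrightarrow> j \<in> T \<Longrightarrow> x i \<le> x j"
  shows "sum x S \<le> sum x T"
proof -
  have c: "card (S - T) = card (T - S)"
    using assms(1-3) by (metis Int_commute card_Diff_subset_Int finite_Int)
  have "sum x (S - T) \<le> sum x (T - S)"
  proof (cases "T - S = {}")
    case True
    then have "S - T = {}" using c assms by (metis card_0_eq finite_Diff)
    then show ?thesis using True by simp
  next
    case False
    \<comment> \<open>The common part of the two sets cancels. On the rest, this minimum separates
      the values on \<open>S - T\<close> from those on \<open>T - S\<close>, and both differences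
      have the same size.\<close>
    define m where "m = Min (x ` (T - S))"
    have m1: "m \<le> x j" if "j \<in> T - S" for j unfolding m_def using that assms(2) by simp
    have "m \<in> x ` (T - S)" unfolding m_def using False assms(2) by (intro Min_in) auto
    then have m2: "x i \<le> m" if "i \<in> S - T" for i using that assms(4) by auto
    have "sum x (S - T) \<le> real (card (S - T)) * m" using m2 by (intro sum_bounded_above) auto
    also have "\<dots> \<le> sum x (T - S)" unfolding c using m1 by (intro sum_bounded_below) auto
    finally show ?thesis .
  qed
  moreover have "sum x S = sum x (S - T) + sum x (S \<inter> T)"
    using assms(1) by (metis sum.Int_Diff add.commute)
  moreover have "sum x T = sum x (T - S) + sum x (S \<inter> T)"
    using assms(2) by (metis sum.Int_Diff add.commute Int_commute)
  ultimately show ?thesis by simp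
qed

text \<open>Abel summation against the decreasing weights reduces the inequality to partial sums,
  where it says that no \<open>i\<close> entries have a larger sum than the \<open>i\<close> largest
  ones.\<close>

lemma rearrangement_le:
  fixes lam :: "nat \<Rightarrow> real"
  assumes rk: "ranking p x r" and b: "bij_betw r' {..<p} {1..p}"
    and anti: "\<And>i j. 1 \<le> i \<Longrightarrow> i \<le> j \<Longrightarrow> j \<le> p \<Longrightarrow> lam j \<le> lam i"
    and nonneg: "\<And>i. 1 \<le> i \<Longrightarrow> i \<le> p \<Longrightarrow> 0 \<le> lam i"
  shows "(\<Sum>j<p. lam (r' j) * \<bar>x j\<bar>) \<le> (\<Sum>j<p. lam (r j) * \<bar>x j\<bar>)"
proof (cases "p \<ge> 1")
  case True
  obtain q where q: "bij_betw q {1..p} {..<p}" "\<And>i. i \<in> {1..p} \<Longrightarrow> r (q i) = i"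
    "\<And>j. j < p \<Longrightarrow> q (r j) = j"
    "\<And>i j. 1 \<le> i \<Longrightarrow> i \<le> j \<Longrightarrow> j \<le> p \<Longrightarrow> \<bar>x (q j)\<bar> \<le> \<bar>x (q i)\<bar>"
    using ranking_inv[OF rk] by blast
  define q' where "q' = inv_into {..<p} r'"
  have bq': "bij_betw q' {1..p} {..<p}" unfolding q'_def by (rule bij_betw_inv_into[OF b])
  have r'q': "r' (q' i) = i" if "i \<in> {1..p}" for i
    using that b by (simp add: q'_def bij_betw_inv_into_right)
  have "(\<Sum>i=1..p. lam i * (\<bar>x (q' i)\<bar> - \<bar>x (q i)\<bar>)) \<le> lam 1 * 0"
  proof (rule abel_sum_le[OF anti nonneg _ True])
    fix i assume i: "1 \<le> i" "i \<le> p"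
    have i1: "inj_on q' {1..i}" "inj_on q {1..i}"
      using bq' q(1) i by (auto simp: bij_betw_def intro: inj_on_subset)
    have "(\<Sum>j\<in>q' ` {1..i}. \<bar>x j\<bar>) \<le> (\<Sum>j\<in>q ` {1..i}. \<bar>x j\<bar>)"
    proof (rule sum_le_top_sum)
      show "card (q' ` {1..i}) = card (q ` {1..i})" using i1 by (simp add: card_image)
      fix j k assume jk: "j \<in> q' ` {1..i}" "j \<notin> q ` {1..i}" "k \<in> q ` {1..i}"
      from jk(1) have jp: "j < p" using bij_betwE[OF bq'] i by auto
      have rj: "r j \<in> {1..p}" using rk jp by (auto simp: ranking_def bij_betw_def)
      have "r j > i"
      proof (rule ccontr)
        assume "\<not> r j > i"
        then have "q (r j) \<in> q ` {1..i}" using rj by auto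
        then show False using jk(2) q(3)[OF jp] by simp
      qed
      from jk(3) obtain l where l: "k = q l" "1 \<le> l" "l \<le> i" by auto
      have "\<bar>x (q (r j))\<bar> \<le> \<bar>x (q l)\<bar>" using q(4)[of l "r j"] l \<open>r j > i\<close> rj by auto
      then show "\<bar>x j\<bar> \<le> \<bar>x k\<bar>" using q(3)[OF jp] l by simp
    qed auto
    then show "(\<Sum>l=1..i. \<bar>x (q' l)\<bar> - \<bar>x (q l)\<bar>) \<le> 0"
      using i1 by (simp add: sum.reindex sum_subtractf)
  qed auto
  then have "(\<Sum>i\<in>{1..p}. lam i * \<bar>x (q' i)\<bar>) \<le> (\<Sum>i\<in>{1..p}. lam i * \<bar>x (q i)\<bar>)"
    by (simp add: algebra_simps sum_subtractf)
  moreover have "(\<Sum>i\<in>{1..p}. lam i * \<bar>x (q i)\<bar>) = (\<Sum>j<p. lam (r j) * \<bar>x j\<bar>)"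
    using q(2) by (subst sum.reindex_bij_betw[OF q(1), symmetric]) (auto intro!: sum.cong)
  moreover have "(\<Sum>i\<in>{1..p}. lam i * \<bar>x (q' i)\<bar>) = (\<Sum>j<p. lam (r' j) * \<bar>x j\<bar>)"
    using r'q' by (subst sum.reindex_bij_betw[OF bq', symmetric]) (auto intro!: sum.cong)
  ultimately show ?thesis by simp
next
  case False
  then have "p = 0" by simp
  then show ?thesis by simp
qed

lemma sum_mult_le_L2:
  fixes f g :: "'b \<Rightarrow> real"
  shows "(\<Sum>i\<in>A. f i * g i) \<le> L2_set f A * L2_set g A"
  using order_trans[OF sum_mono[of A "\<lambda>i. f i * g i" "\<lambda>i. \<bar>f i\<bar> * \<bar>g i\<bar>"] L2_set_mult_ineq]
  by (auto simp: abs_mult[symmetric])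

text \<open>By rearrangement, the left side is at least the sum with any other assignment of ranks,
  in particular one that gives the first ranks to the support of \<open>t\<close>. On the support
  the triangle inequality costs one term in \<open>u\<close>; completing the tail of the sorted
  \<open>u\<close> to its full norm costs another. Each has at most \<open>s\<close> summands and is
  bounded by Cauchy-Schwarz, whence the factor 2.\<close>

lemma sorted_penalty_decomposition:
  fixes lam :: "nat \<Rightarrow> real"
  assumes rt: "ranking p t rt" and ru: "ranking p u ru" and rtu: "ranking p (\<lambda>j. t j + u j) rtu"
    and anti: "\<And>i j. 1 \<le> i \<Longrightarrow> i \<le> j \<Longrightarrow> j \<le> p \<Longrightarrow> lam j \<le> lam i"
    and nonneg: "\<And>i. 1 \<le> i \<Longrightarrow> i \<le> p \<Longrightarrow> 0 \<le> lam i"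
    and sparse: "card {j \<in> {..<p}. t j \<noteq> 0} \<le> s" and "s \<le> p"
  shows "(\<Sum>j<p. lam (rtu j) * \<bar>t j + u j\<bar>) \<ge>
     (\<Sum>j<p. lam (rt j) * \<bar>t j\<bar>) + (\<Sum>j<p. lam (ru j) * \<bar>u j\<bar>)
      - 2 * (L2_set lam {1..s} * L2_set u {..<p})"
proof -
  define S where "S = {j \<in> {..<p}. t j \<noteq> 0}"
  have Sp: "S \<subseteq> {..<p}" "finite S" by (auto simp: S_def)
  \<comment> \<open>Each block keeps its given order. An index of the support thus ranks no later
    than under \<open>rt\<close>, so its weight can only grow; any other index ranks no earlier than
    under \<open>ru\<close>, so its \<open>|u|\<close> is at least the sorted entry at the new
    rank.\<close>
  define r where "r j = (if j \<in> S then card {i \<in> S. rt i \<le> rt j}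
       else card S + card {i \<in> {..<p} - S. ru i \<le> ru j})" for j
  have bt: "bij_betw rt {..<p} {1..p}" and bu: "bij_betw ru {..<p} {1..p}"
    using rt ru by (auto simp: ranking_def)
  have injt: "inj_on rt {..<p}" and inju: "inj_on ru {..<p}" using bt bu by (auto simp: bij_betw_def)
  have rtp: "rt j \<in> {1..p}" "ru j \<in> {1..p}" if "j < p" for j
    using bij_betwE[OF bt] bij_betwE[OF bu] that by auto
  have strict: "card {i \<in> A. f i \<le> f a} < card {i \<in> A. f i \<le> f b}"
    if "finite A" "a \<in> A" "b \<in> A" "f a < f b" for A :: "nat set" and f :: "nat \<Rightarrow> nat" and a b
  proof (rule psubset_card_mono)
    have "b \<in> {i \<in> A. f i \<le> f b}" "b \<notin> {i \<in> A. f i \<le> f a}" using that by auto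
    then show "{i \<in> A. f i \<le> f a} \<subset> {i \<in> A. f i \<le> f b}" using that by fastforce
  qed (use that in auto)
  have rS: "r j \<in> {1..card S}" if "j \<in> S" for j
  proof -
    have "card {i \<in> S. rt i \<le> rt j} \<le> card S" using Sp by (intro card_mono) auto
    moreover have "card {i \<in> S. rt i \<le> rt j} > 0" using Sp that by (subst card_gt_0_iff) auto
    ultimately show ?thesis using that by (auto simp: r_def)
  qed
  have cc: "card ({..<p} - S) = p - card S" using Sp by (simp add: card_Diff_subset)
  have cSp: "card S \<le> p" using card_mono[of "{..<p}" S] Sp by simp
  have rSc: "r j \<in> {card S + 1..p}" if "j \<in> {..<p} - S" for j
  proof -
    have "card {i \<in> {..<p} - S. ru i \<le> ru j} \<le> card ({..<p} - S)" by (intro card_mono) auto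
    moreover have "card {i \<in> {..<p} - S. ru i \<le> ru j} > 0"
      using that by (subst card_gt_0_iff) auto
    ultimately show ?thesis using that cc cSp by (auto simp: r_def)
  qed
  have inj: "inj_on r {..<p}"
  proof (rule inj_onI)
    fix a b assume ab: "a \<in> {..<p}" "b \<in> {..<p}" "r a = r b"
    consider "a \<in> S" "b \<in> S" | "a \<in> S" "b \<notin> S" | "a \<notin> S" "b \<in> S" | "a \<notin> S" "b \<notin> S" by blast
    then show "a = b"
    proof cases
      case 1
      then have "\<not> rt a < rt b" "\<not> rt b < rt a" using ab strict[of S] Sp
        by (auto simp: r_def dest: strict)
      then show ?thesis using injt ab by (auto simp: inj_on_def)
    next
      case 2 then show ?thesis using rS[of a] rSc[of b] ab by auto
    next
      case 3 then show ?thesis using rS[of b] rSc[of a] ab by auto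
    next
      case 4
      then have "\<not> ru a < ru b" "\<not> ru b < ru a" 
        using ab strict[of "{..<p} - S" a b ru] strict[of "{..<p} - S" b a ru]
        by (auto simp: r_def)
      then show ?thesis using inju ab by (auto simp: inj_on_def)
    qed
  qed
  have "r ` {..<p} \<subseteq> {1..p}" using rS rSc cSp by fastforce
  then have br: "bij_betw r {..<p} {1..p}"
    using inj by (simp add: bij_betw_def card_image card_subset_eq)
  have imS: "r ` S = {1..card S}"
    using rS inj Sp by (intro card_subset_eq) (auto simp: card_image inj_on_subset)
  have imSc: "r ` ({..<p} - S) = {card S + 1..p}"
    using rSc inj cc by (intro card_subset_eq) (auto simp: card_image inj_on_subset[OF inj])
  have le1: "r j \<le> rt j" if "j \<in> S" for j
  proof -
    have "card {i \<in> S. rt i \<le> rt j} = card (rt ` {i \<in> S. rt i \<le> rt j})"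
      using Sp by (intro card_image[symmetric] inj_on_subset[OF injt]) auto
    also have "\<dots> \<le> card {1..rt j}" using Sp rtp by (intro card_mono) auto
    finally show ?thesis using that by (simp add: r_def)
  qed
  have le2: "ru j \<le> r j" if "j \<in> {..<p} - S" for j
  proof -
    have "{1..ru j} \<subseteq> ru ` {i \<in> {..<p}. ru i \<le> ru j}"
    proof
      fix i assume i: "i \<in> {1..ru j}"
      then have "i \<in> {1..p}" using rtp(2)[of j] that by auto
      then obtain k where "k \<in> {..<p}" "ru k = i" using bu by (metis bij_betw_imp_surj_on imageE)
      then show "i \<in> ru ` {i \<in> {..<p}. ru i \<le> ru j}" using i by auto
    qed
    then have "card {1..ru j} \<le> card (ru ` {i \<in> {..<p}. ru i \<le> ru j})" by (intro card_mono) auto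
    also have "\<dots> \<le> card {i \<in> {..<p}. ru i \<le> ru j}" by (intro card_image_le) auto
    also have "\<dots> \<le> card (S \<union> {i \<in> {..<p} - S. ru i \<le> ru j})"
      using Sp by (intro card_mono) auto
    also have "\<dots> \<le> card S + card {i \<in> {..<p} - S. ru i \<le> ru j}" by (rule card_Un_le)
    finally show ?thesis using that by (simp add: r_def)
  qed
  obtain q where q: "bij_betw q {1..p} {..<p}" "\<And>i. i \<in> {1..p} \<Longrightarrow> ru (q i) = i"
    "\<And>j. j < p \<Longrightarrow> q (ru j) = j"
    "\<And>i j. 1 \<le> i \<Longrightarrow> i \<le> j \<Longrightarrow> j \<le> p \<Longrightarrow> \<bar>u (q j)\<bar> \<le> \<bar>u (q i)\<bar>"
    using ranking_inv[OF ru] by blast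
  let ?c = "card S"
  have lamr: "lam (r j) \<ge> 0" if "j < p" for j using bij_betwE[OF br] that by (intro nonneg) auto
  have split: "(\<Sum>j<p. f j) = (\<Sum>j\<in>S. f j) + (\<Sum>j\<in>{..<p} - S. f j)" for f :: "nat \<Rightarrow> real"
    using Sp by (metis sum.subset_diff add.commute finite_lessThan)
  have mono_c: "L2_set lam {1..?c} \<le> L2_set lam {1..s}"
    using sparse unfolding L2_set_def S_def[symmetric] by (intro real_sqrt_le_mono sum_mono2) auto
  have L2sub: "L2_set f A \<le> L2_set f B" if "A \<subseteq> B" "finite B" for f :: "nat \<Rightarrow> real" and A B
    using that unfolding L2_set_def by (intro real_sqrt_le_mono sum_mono2) auto
  have L2re: "L2_set (\<lambda>i. f (g i)) A = L2_set f (g ` A)" if "inj_on g A" for f :: "nat \<Rightarrow> real" and g :: "nat \<Rightarrow> nat" and A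
    unfolding L2_set_def using that by (simp add: sum.reindex)
  have L2abs: "L2_set (\<lambda>i. \<bar>f i\<bar>) A = L2_set f A" for f :: "nat \<Rightarrow> real" and A
    by (simp add: L2_set_def)
  have X1: "(\<Sum>j\<in>S. lam (r j) * \<bar>u j\<bar>) \<le> L2_set lam {1..s} * L2_set u {..<p}"
  proof -
    have "(\<Sum>j\<in>S. lam (r j) * \<bar>u j\<bar>) \<le> L2_set (\<lambda>j. lam (r j)) S * L2_set (\<lambda>j. \<bar>u j\<bar>) S"
      by (rule sum_mult_le_L2)
    also have "L2_set (\<lambda>j. lam (r j)) S = L2_set lam {1..?c}"
      using L2re[of r S lam] inj Sp imS by (simp add: inj_on_subset)
    also have "L2_set (\<lambda>j. \<bar>u j\<bar>) S \<le> L2_set u {..<p}" unfolding L2abs using Sp by (intro L2sub) auto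
    finally show ?thesis using mono_c
      by (smt (verit) L2_set_nonneg mult_left_mono mult_right_mono)
  qed
  have X2: "(\<Sum>i\<in>{1..?c}. lam i * \<bar>u (q i)\<bar>) \<le> L2_set lam {1..s} * L2_set u {..<p}"
  proof -
    have iq: "inj_on q {1..?c}" "q ` {1..?c} \<subseteq> {..<p}"
      using q(1) cSp by (auto simp: bij_betw_def intro: inj_on_subset)
    have "(\<Sum>i\<in>{1..?c}. lam i * \<bar>u (q i)\<bar>) \<le> L2_set lam {1..?c} * L2_set (\<lambda>i. \<bar>u (q i)\<bar>) {1..?c}"
      by (rule sum_mult_le_L2)
    also have "L2_set (\<lambda>i. \<bar>u (q i)\<bar>) {1..?c} = L2_set u (q ` {1..?c})"
      using L2re[of q "{1..?c}" u] iq L2abs[of "\<lambda>i. u (q i)"] by simp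
    also have "\<dots> \<le> L2_set u {..<p}" using iq by (intro L2sub) auto
    finally show ?thesis using mono_c
      by (smt (verit) L2_set_nonneg mult_left_mono mult_right_mono)
  qed
  have X3: "(\<Sum>j\<in>{..<p} - S. lam (r j) * \<bar>u j\<bar>) \<ge> (\<Sum>i\<in>{?c + 1..p}. lam i * \<bar>u (q i)\<bar>)"
  proof -
    have "(\<Sum>i\<in>{?c + 1..p}. lam i * \<bar>u (q i)\<bar>) = (\<Sum>j\<in>{..<p} - S. lam (r j) * \<bar>u (q (r j))\<bar>)"
      unfolding imSc[symmetric] by (subst sum.reindex) (auto intro: inj_on_subset[OF inj])
    also have "\<dots> \<le> (\<Sum>j\<in>{..<p} - S. lam (r j) * \<bar>u j\<bar>)"
    proof (intro sum_mono mult_left_mono)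
      fix j assume j: "j \<in> {..<p} - S"
      show "\<bar>u (q (r j))\<bar> \<le> \<bar>u j\<bar>"
        using q(4)[of "ru j" "r j"] le2[OF j] rtp(2)[of j] rSc[OF j] j q(3)[of j] by auto
      show "0 \<le> lam (r j)" using lamr j by auto
    qed
    finally show ?thesis .
  qed
  have X4: "(\<Sum>j<p. lam (ru j) * \<bar>u j\<bar>) = (\<Sum>i\<in>{1..?c}. lam i * \<bar>u (q i)\<bar>) + (\<Sum>i\<in>{?c + 1..p}. lam i * \<bar>u (q i)\<bar>)"
  proof -
    have "(\<Sum>j<p. lam (ru j) * \<bar>u j\<bar>) = (\<Sum>i\<in>{1..p}. lam i * \<bar>u (q i)\<bar>)"
      using q(2) by (subst sum.reindex_bij_betw[OF q(1), symmetric]) (auto intro!: sum.cong)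
    also have "{1..p} = {1..?c} \<union> {?c + 1..p}" using cSp by auto
    finally show ?thesis by (simp add: sum.union_disjoint)
  qed
  have X5: "(\<Sum>j<p. lam (rt j) * \<bar>t j\<bar>) \<le> (\<Sum>j\<in>S. lam (r j) * \<bar>t j\<bar>)"
  proof -
    have "(\<Sum>j\<in>{..<p} - S. lam (rt j) * \<bar>t j\<bar>) = 0"
      by (intro sum.neutral) (auto simp: S_def)
    then have "(\<Sum>j<p. lam (rt j) * \<bar>t j\<bar>) = (\<Sum>j\<in>S. lam (rt j) * \<bar>t j\<bar>)" using split by simp
    also have "\<dots> \<le> (\<Sum>j\<in>S. lam (r j) * \<bar>t j\<bar>)"
      using le1 rtp(1) rS Sp by (intro sum_mono mult_right_mono anti) fastforce+
    finally show ?thesis .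
  qed
  have "(\<Sum>j\<in>S. lam (r j) * \<bar>t j\<bar>) - (\<Sum>j\<in>S. lam (r j) * \<bar>u j\<bar>) + (\<Sum>j\<in>{..<p} - S. lam (r j) * \<bar>u j\<bar>)
     \<le> (\<Sum>j\<in>S. lam (r j) * \<bar>t j + u j\<bar>) + (\<Sum>j\<in>{..<p} - S. lam (r j) * \<bar>t j + u j\<bar>)"
  proof (rule add_mono)
    show "(\<Sum>j\<in>S. lam (r j) * \<bar>t j\<bar>) - (\<Sum>j\<in>S. lam (r j) * \<bar>u j\<bar>) \<le> (\<Sum>j\<in>S. lam (r j) * \<bar>t j + u j\<bar>)"
      unfolding sum_subtractf[symmetric] right_diff_distrib[symmetric]
      using Sp lamr by (intro sum_mono mult_left_mono) auto
    show "(\<Sum>j\<in>{..<p} - S. lam (r j) * \<bar>u j\<bar>) \<le> (\<Sum>j\<in>{..<p} - S. lam (r j) * \<bar>t j + u j\<bar>)"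
      by (intro sum_mono) (auto simp: S_def)
  qed
  also have "\<dots> = (\<Sum>j<p. lam (r j) * \<bar>t j + u j\<bar>)" using split by simp
  also have "\<dots> \<le> (\<Sum>j<p. lam (rtu j) * \<bar>t j + u j\<bar>)"
    by (rule rearrangement_le[OF rtu br anti nonneg])
  finally show ?thesis using X1 X2 X3 X4 X5 by linarith
qed

section \<open>The weights log(ep/i) and their sums\<close>

definition log_rank :: "nat \<Rightarrow> nat \<Rightarrow> real" where
  "log_rank p i = 1 + ln (real p / real i)"

lemma log_rank_ge_1: "1 \<le> i \<Longrightarrow> i \<le> p \<Longrightarrow> 1 \<le> log_rank p i"
  by (simp add: log_rank_def)

lemma log_rank_antimono: "1 \<le> i \<Longrightarrow> i \<le> j \<Longrightarrow> j \<le> p \<Longrightarrow> log_rank p j \<le> log_rank p i"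
  by (simp add: log_rank_def frac_le)

text \<open>The inequality ln x <= x - 1 at x = j/i. The product i log(ep/i) is the order of the
  logarithm of the number of supports of size \<open>i\<close>; its monotonicity makes the sparsity
  levels that a given sample size can afford an initial segment.\<close>

lemma mult_log_rank_mono:
  assumes "1 \<le> i" "i \<le> j" "j \<le> p"
  shows "real i * log_rank p i \<le> real j * log_rank p j"
proof -
  have "ln (real p / real i) = ln (real p / real j) + ln (real j / real i)"
    using assms by (subst ln_mult_pos[symmetric]) auto
  also have "\<dots> \<le> ln (real p / real j) + (real j / real i - 1)"
    using assms ln_le_minus_one[of "real j / real i"] by simp
  finally have "real i * log_rank p i \<le> real i * (1 + (ln (real p / real j) + (real j / real i - 1)))"
    unfolding log_rank_def by (intro mult_left_mono) auto
  also have "\<dots> = real j + real i * ln (real p / real j)"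
    using assms by (simp add: field_simps)
  also have "\<dots> \<le> real j + real j * ln (real p / real j)"
    using assms by (intro add_left_mono mult_right_mono) auto
  finally show ?thesis by (simp add: log_rank_def algebra_simps)
qed

lemma mult_sqrt_log_rank_le_sum:
  assumes "i \<le> p"
  shows "real i * sqrt (log_rank p i) \<le> (\<Sum>l=1..i. sqrt (log_rank p l))"
proof -
  have "of_nat (card {1..i}) * sqrt (log_rank p i) \<le> (\<Sum>l\<in>{1..i}. sqrt (log_rank p l))"
    using assms by (intro sum_bounded_below) (auto intro!: log_rank_antimono)
  then show ?thesis by simp
qed

text \<open>The left side is ln (s^s / s!), so this is the lower bound (s/e)^s for the factorial.
  Passing from \<open>s\<close> to \<open>s + 1\<close> adds s ln (1 + 1/s), which is at most
  1.\<close>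

lemma sum_ln_le: "1 \<le> s \<Longrightarrow> (\<Sum>i=1..s. ln (real s / real i)) \<le> real s"
proof (induction s)
  case (Suc s)
  show ?case
  proof (cases "s = 0")
    case False
    have "(\<Sum>i=1..Suc s. ln (real (Suc s) / real i)) = (\<Sum>i=1..s. ln (real (Suc s) / real i))"
      by (simp add: sum.atLeast_Suc_atMost_Suc_shift)
    also have "\<dots> = (\<Sum>i=1..s. ln (real s / real i) + ln (real (Suc s) / real s))"
    proof (intro sum.cong refl)
      fix i assume "i \<in> {1..s}"
      then show "ln (real (Suc s) / real i) = ln (real s / real i) + ln (real (Suc s) / real s)"
        by (subst ln_mult_pos[symmetric]) auto
    qed
    also have "\<dots> = (\<Sum>i=1..s. ln (real s / real i)) + real s * ln (real (Suc s) / real s)"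
      by (simp add: sum.distrib)
    also have "\<dots> \<le> real s + real s * (real (Suc s) / real s - 1)"
      using Suc False ln_le_minus_one[of "real (Suc s) / real s"]
      by (intro add_mono mult_left_mono) auto
    also have "\<dots> = real (Suc s)" using False by (simp add: field_simps)
    finally show ?thesis .
  qed simp
qed simp

lemma sum_ln_weights_le:
  assumes "1 \<le> s" "s \<le> p"
  shows "(\<Sum>i=1..s. ln (2 * real p / real i)) \<le> 2 * (real s * log_rank p s)"
proof -
  have "(\<Sum>i=1..s. ln (2 * real p / real i)) = (\<Sum>i=1..s. ln (real s / real i) + ln (2 * real p / real s))"
  proof (intro sum.cong refl)
    fix i assume "i \<in> {1..s}"
    then show "ln (2 * real p / real i) = ln (real s / real i) + ln (2 * real p / real s)"
      using assms by (subst ln_mult_pos[symmetric]) auto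
  qed
  also have "\<dots> = (\<Sum>i=1..s. ln (real s / real i)) + real s * ln (2 * real p / real s)"
    by (simp add: sum.distrib)
  also have "ln (2 * real p / real s) = ln 2 + ln (real p / real s)"
    using assms by (subst ln_mult_pos[symmetric]) auto
  also have "(\<Sum>i=1..s. ln (real s / real i)) + real s * (ln 2 + ln (real p / real s))
      \<le> real s + real s * (1 + 2 * ln (real p / real s))"
    using sum_ln_le[OF assms(1)] ln2_le_25_over_36 assms
    by (intro add_mono mult_left_mono) (auto simp: less_imp_le intro!: add_mono)
  also have "\<dots> = 2 * (real s * log_rank p s)" by (simp add: log_rank_def algebra_simps)
  finally show ?thesis .
qed

text \<open>Source of the factor \<open>sqrt 2\<close> in the tuning constant: the lower bound on
  the design carries ln(ep/i), the Slope weights carry ln(2p/i), and ln 2 >= 1/2 makes twice the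
  latter large enough.\<close>

lemma log_rank_le_ln:
  assumes "1 \<le> i" "i \<le> p"
  shows "log_rank p i \<le> 2 * ln (2 * real p / real i)"
proof -
  have "ln (2 * real p / real i) = ln 2 + ln (real p / real i)"
    using assms by (subst ln_mult_pos[symmetric]) auto
  moreover have "ln (real p / real i) \<ge> 0" using assms by simp
  moreover have "ln 2 \<ge> (1/2::real)" using ln2_ge_two_thirds by linarith
  ultimately show ?thesis unfolding log_rank_def by linarith
qed

lemma slope_weight_nonneg: "0 \<le> c \<Longrightarrow> 1 \<le> i \<Longrightarrow> i \<le> p \<Longrightarrow> 0 \<le> slope_weight c n p i"
  by (simp add: slope_weight_def)

lemma slope_weight_antimono:
  "0 \<le> c \<Longrightarrow> 1 \<le> i \<Longrightarrow> i \<le> j \<Longrightarrow> j \<le> p \<Longrightarrow> slope_weight c n p j \<le> slope_weight c n p i"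
  unfolding slope_weight_def
  by (intro mult_left_mono real_sqrt_le_mono divide_right_mono) (auto simp: frac_le)

lemma slope_weight_L2_le:
  assumes "0 \<le> c" "1 \<le> s" "s \<le> p"
  shows "L2_set (slope_weight c n p) {1..s} \<le> c * sqrt (2 * (real s * log_rank p s) / real n)"
proof -
  have "(\<Sum>i=1..s. (slope_weight c n p i)\<^sup>2) = (\<Sum>i=1..s. c\<^sup>2 / real n * ln (2 * real p / real i))"
    using assms by (intro sum.cong refl) (auto simp: slope_weight_def power_mult_distrib)
  also have "\<dots> = c\<^sup>2 / real n * (\<Sum>i=1..s. ln (2 * real p / real i))"
    by (simp add: sum_distrib_left)
  also have "\<dots> \<le> c\<^sup>2 / real n * (2 * (real s * log_rank p s))"
    using assms by (intro mult_left_mono sum_ln_weights_le) auto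
  finally have "L2_set (slope_weight c n p) {1..s} \<le> sqrt (c\<^sup>2 * (2 * (real s * log_rank p s) / real n))"
    unfolding L2_set_def by (simp add: algebra_simps)
  also have "\<dots> = c * sqrt (2 * (real s * log_rank p s) / real n)"
    using assms by (simp add: real_sqrt_mult real_sqrt_divide)
  finally show ?thesis .
qed

text \<open>The part \<open>w\<close> of \<open>u\<close> left over by rounding is at most \<open>\<tau>\<close> in each
  coordinate, and the large entries of \<open>g\<close> are controlled only through their partial sums.\<close>

lemma truncated_sum_le:
  assumes rk: "ranking p u r" and "p \<ge> 1" and "P \<ge> 0" "Q \<ge> 0" "\<tau> \<ge> 0"
    and w: "\<And>j. j < p \<Longrightarrow> \<bar>w j\<bar> \<le> \<bar>u j\<bar>" "\<And>j. j < p \<Longrightarrow> \<bar>w j\<bar> \<le> \<tau>"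
    and g: "\<And>S. S \<subseteq> {..<p} \<Longrightarrow> S \<noteq> {} \<Longrightarrow>
              (\<Sum>j\<in>S. \<bar>g j\<bar>) \<le> P + Q * (real (card S) * sqrt (log_rank p (card S)))"
  shows "(\<Sum>j<p. \<bar>w j\<bar> * \<bar>g j\<bar>) \<le> \<tau> * P + Q * (\<Sum>j<p. sqrt (log_rank p (r j)) * \<bar>u j\<bar>)"
proof -
  obtain q where q: "bij_betw q {1..p} {..<p}" "\<And>i. i \<in> {1..p} \<Longrightarrow> r (q i) = i"
    "\<And>j. j < p \<Longrightarrow> q (r j) = j"
    "\<And>i j. 1 \<le> i \<Longrightarrow> i \<le> j \<Longrightarrow> j \<le> p \<Longrightarrow> \<bar>u (q j)\<bar> \<le> \<bar>u (q i)\<bar>"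
    using ranking_inv[OF rk] by blast
  have qp: "q i < p" if "i \<in> {1..p}" for i using bij_betwE[OF q(1)] that by auto
  \<comment> \<open>Unlike \<open>w\<close> itself, this envelope decreases along the ranking of
    \<open>u\<close>, and it still dominates \<open>|w|\<close>. Its first value is at most \<tau>,
    which becomes the factor of \<open>P\<close>.\<close>
  define a where "a i = min \<bar>u (q i)\<bar> \<tau>" for i
  \<comment> \<open>Subtracting the weights turns the growing bound on partial sums into the
    constant that Abel summation asks for.\<close>
  have "(\<Sum>i=1..p. a i * (\<bar>g (q i)\<bar> - Q * sqrt (log_rank p i))) \<le> a 1 * P"
  proof (rule abel_sum_le[OF _ _ _ \<open>p \<ge> 1\<close>])
    fix i j assume "1 \<le> i" "i \<le> j" "j \<le> p"
    then show "a j \<le> a i" using q(4)[of i j] by (auto simp: a_def)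
  next
    fix i assume "1 \<le> i" "i \<le> p"
    then show "0 \<le> a i" using \<open>\<tau> \<ge> 0\<close> by (simp add: a_def)
  next
    fix i assume i: "1 \<le> i" "i \<le> p"
    have iq: "inj_on q {1..i}" using q(1) i by (auto simp: bij_betw_def intro: inj_on_subset)
    have "(\<Sum>j\<in>q ` {1..i}. \<bar>g j\<bar>) \<le> P + Q * (real (card (q ` {1..i})) * sqrt (log_rank p (card (q ` {1..i}))))"
      using i qp by (intro g) auto
    also have "\<dots> \<le> P + Q * (\<Sum>l=1..i. sqrt (log_rank p l))"
      using mult_sqrt_log_rank_le_sum[of i p] i iq \<open>Q \<ge> 0\<close> by (simp add: card_image mult_left_mono)
    finally show "(\<Sum>l=1..i. \<bar>g (q l)\<bar> - Q * sqrt (log_rank p l)) \<le> P"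
      using iq by (simp add: sum.reindex sum_subtractf sum_distrib_left)
  qed
  also have "\<dots> \<le> \<tau> * P" using \<open>P \<ge> 0\<close> by (intro mult_right_mono) (auto simp: a_def)
  finally have *: "(\<Sum>i=1..p. a i * \<bar>g (q i)\<bar>) \<le> \<tau> * P + Q * (\<Sum>i=1..p. a i * sqrt (log_rank p i))"
    by (simp add: algebra_simps sum_subtractf sum_distrib_left)
  have "(\<Sum>j<p. \<bar>w j\<bar> * \<bar>g j\<bar>) = (\<Sum>i=1..p. \<bar>w (q i)\<bar> * \<bar>g (q i)\<bar>)"
    by (rule sum.reindex_bij_betw[OF q(1), symmetric])
  also have "\<dots> \<le> (\<Sum>i=1..p. a i * \<bar>g (q i)\<bar>)"
    using w qp by (intro sum_mono mult_right_mono) (auto simp: a_def)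
  also note *
  also have "(\<Sum>i=1..p. a i * sqrt (log_rank p i)) \<le> (\<Sum>i=1..p. sqrt (log_rank p i) * \<bar>u (q i)\<bar>)"
    using log_rank_ge_1[of _ p] by (intro sum_mono) (fastforce simp: a_def mult.commute intro!: mult_left_mono)
  also have "\<dots> = (\<Sum>i=1..p. sqrt (log_rank p (r (q i))) * \<bar>u (q i)\<bar>)"
    using q(2) by (intro sum.cong) auto
  also have "\<dots> = (\<Sum>j<p. sqrt (log_rank p (r j)) * \<bar>u j\<bar>)"
    by (rule sum.reindex_bij_betw[OF q(1)])
  finally show ?thesis using \<open>Q \<ge> 0\<close> by (simp add: mult_left_mono)
qed

section \<open>Counting and rounding on the integer lattice\<close>

definition lattice_points :: "'b set \<Rightarrow> real \<Rightarrow> ('b \<Rightarrow> int) set" where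
  "lattice_points J m = {z \<in> extensional J. (\<Sum>j\<in>J. \<bar>real_of_int (z j)\<bar>) \<le> m}"

text \<open>A geometric series of ratio at most 1/2 on either side of 0; the defect
  \<open>(1/2)^b\<close> is kept so that the induction closes.\<close>

lemma sum_exp_abs_le:
  fixes \<beta> :: real
  assumes "exp (- \<beta>) \<le> 1/2"
  shows "(\<Sum>z\<in>{-int b..int b}. exp (- \<beta> * \<bar>real_of_int z\<bar>)) \<le> 1 + 4 * exp (- \<beta>) * (1 - (1/2)^b)"
proof (induction b)
  case 0 then show ?case by simp
next
  case (Suc b)
  have eq: "{-int (Suc b)..int (Suc b)} = insert (- int (Suc b)) (insert (int (Suc b)) {-int b..int b})"
    by auto
  have "exp (- \<beta> * (1 + real b)) = exp (- \<beta>) * exp (- \<beta>) ^ b"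
    by (simp add: exp_add[symmetric] exp_of_nat_mult[symmetric] algebra_simps)
  also have "\<dots> \<le> exp (- \<beta>) * (1/2)^b"
    using assms by (intro mult_left_mono power_mono) auto
  finally have e: "exp (- \<beta> * (1 + real b)) \<le> exp (- \<beta>) * (1/2)^b" .
  have "(\<Sum>z\<in>{-int (Suc b)..int (Suc b)}. exp (- \<beta> * \<bar>real_of_int z\<bar>))
      = 2 * exp (- \<beta> * (1 + real b)) + (\<Sum>z\<in>{-int b..int b}. exp (- \<beta> * \<bar>real_of_int z\<bar>))"
  proof -
    have "- int (Suc b) \<notin> insert (int (Suc b)) {-int b..int b}" "int (Suc b) \<notin> {-int b..int b}" by auto
    from sum.insert[OF _ this(1)] sum.insert[OF _ this(2)] show ?thesis unfolding eq by simp
  qed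
  also have "\<dots> \<le> 2 * (exp (- \<beta>) * (1/2)^b) + (1 + 4 * exp (- \<beta>) * (1 - (1/2)^b))"
    using e Suc by (intro add_mono mult_left_mono) auto
  also have "\<dots> = 1 + 4 * exp (- \<beta>) * (1 - (1/2)^Suc b)" by (simp add: algebra_simps)
  finally show ?case .
qed

text \<open>The lattice points are counted with the weights \<open>exp (- \<beta> \<Sum>|z\<^sub>j|)\<close>, whose sum over
  the whole lattice factorises.\<close>

lemma lattice_points_card:
  assumes "finite J" "exp (- \<beta>) \<le> 1/2" "m \<ge> 0"
  shows "finite (lattice_points J m)"
    and "real (card (lattice_points J m)) \<le> exp (\<beta> * m + 4 * exp (- \<beta>) * real (card J))"
proof -
  define b where "b = nat \<lfloor>m\<rfloor>"
  define Z where "Z = PiE J (\<lambda>_. {-int b..int b})"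
  have Zf: "finite Z" unfolding Z_def using assms(1) by (intro finite_PiE) auto
  have sub: "lattice_points J m \<subseteq> Z"
  proof
    fix z assume z: "z \<in> lattice_points J m"
    have "\<bar>z j\<bar> \<le> int b" if "j \<in> J" for j
    proof -
      have "\<bar>real_of_int (z j)\<bar> \<le> (\<Sum>j\<in>J. \<bar>real_of_int (z j)\<bar>)"
        using assms(1) that by (intro member_le_sum) auto
      also have "\<dots> \<le> m" using z by (simp add: lattice_points_def)
      finally show ?thesis unfolding b_def using assms(3) by (simp add: le_floor_iff)
    qed
    then have "z j \<in> {-int b..int b}" if "j \<in> J" for j using that by (force simp: abs_le_iff)
    then show "z \<in> Z" using z unfolding Z_def lattice_points_def PiE_def by blast
  qed
  show "finite (lattice_points J m)" using sub Zf by (rule finite_subset)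
  have "exp (- \<beta>) \<le> 1" using assms(2) by linarith
  then have beta: "\<beta> \<ge> 0" by simp
  have "real (card (lattice_points J m)) * exp (- \<beta> * m)
     = (\<Sum>z\<in>lattice_points J m. exp (- \<beta> * m))" by simp
  also have "\<dots> \<le> (\<Sum>z\<in>lattice_points J m. exp (- \<beta> * (\<Sum>j\<in>J. \<bar>real_of_int (z j)\<bar>)))"
    using beta by (intro sum_mono) (auto simp: lattice_points_def intro: mult_left_mono)
  also have "\<dots> \<le> (\<Sum>z\<in>Z. exp (- \<beta> * (\<Sum>j\<in>J. \<bar>real_of_int (z j)\<bar>)))"
    using sub Zf by (intro sum_mono2) auto
  also have "\<dots> = (\<Sum>z\<in>Z. (\<Prod>j\<in>J. exp (- \<beta> * \<bar>real_of_int (z j)\<bar>)))"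
    using assms(1) by (simp add: sum_distrib_left exp_sum)
  also have "\<dots> = (\<Prod>j\<in>J. (\<Sum>z\<in>{-int b..int b}. exp (- \<beta> * \<bar>real_of_int z\<bar>)))"
    unfolding Z_def using assms(1) by (subst prod_sum_PiE) auto
  also have "\<dots> \<le> (\<Prod>j\<in>J. exp (4 * exp (- \<beta>)))"
  proof (intro prod_mono conjI sum_nonneg)
    fix j
    have "(\<Sum>z\<in>{-int b..int b}. exp (- \<beta> * \<bar>real_of_int z\<bar>)) \<le> 1 + 4 * exp (- \<beta>) * (1 - (1/2)^b)"
      by (rule sum_exp_abs_le[OF assms(2)])
    also have "\<dots> \<le> 1 + 4 * exp (- \<beta>) * 1" by (intro add_left_mono mult_left_mono) auto
    also have "\<dots> \<le> exp (4 * exp (- \<beta>))" using exp_ge_add_one_self by simp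
    finally show "(\<Sum>z\<in>{-int b..int b}. exp (- \<beta> * \<bar>real_of_int z\<bar>)) \<le> exp (4 * exp (- \<beta>))" .
  qed auto
  also have "\<dots> = exp (4 * exp (- \<beta>) * real (card J))"
    by (simp add: exp_of_nat_mult[symmetric] mult.commute)
  finally have "real (card (lattice_points J m)) * exp (- \<beta> * m) * exp (\<beta> * m)
      \<le> exp (4 * exp (- \<beta>) * real (card J)) * exp (\<beta> * m)" by (intro mult_right_mono) auto
  then show "real (card (lattice_points J m)) \<le> exp (\<beta> * m + 4 * exp (- \<beta>) * real (card J))"
    by (simp add: mult.assoc exp_add[symmetric] add.commute)
qed

text \<open>Rounding towards 0 rather than to the nearest point keeps the lattice vector below
  \<open>u\<close> in every coordinate, so the bound \<open>B\<close> passes to it. Integers satisfy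
  |z| <= z^2, which turns this Euclidean bound into the l1 budget that defines the lattice
  points.\<close>

lemma lattice_rounding:
  fixes u :: "'b \<Rightarrow> real"
  assumes "\<tau> > 0" "finite J" "(\<Sum>j\<in>J. (u j)\<^sup>2) \<le> B"
  obtains z where "z \<in> lattice_points J (B / \<tau>\<^sup>2)"
    "\<And>j. j \<in> J \<Longrightarrow> \<bar>u j - \<tau> * real_of_int (z j)\<bar> \<le> \<tau>"
    "\<And>j. j \<in> J \<Longrightarrow> \<bar>u j - \<tau> * real_of_int (z j)\<bar> \<le> \<bar>u j\<bar>"
    "\<And>j. j \<in> J \<Longrightarrow> \<bar>\<tau> * real_of_int (z j)\<bar> \<le> \<bar>u j\<bar>"
proof -
  define f where "f x = (if x \<ge> 0 then \<lfloor>x / \<tau>\<rfloor> else - \<lfloor>- x / \<tau>\<rfloor>)" for x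
  have f: "\<bar>x - \<tau> * real_of_int (f x)\<bar> \<le> \<tau> \<and> \<bar>x - \<tau> * real_of_int (f x)\<bar> \<le> \<bar>x\<bar> \<and> \<bar>\<tau> * real_of_int (f x)\<bar> \<le> \<bar>x\<bar>" for x
  proof -
    have g: "0 \<le> \<tau> * real_of_int \<lfloor>y / \<tau>\<rfloor> \<and> \<tau> * real_of_int \<lfloor>y / \<tau>\<rfloor> \<le> y \<and> y - \<tau> * real_of_int \<lfloor>y / \<tau>\<rfloor> \<le> \<tau>"
      if "y \<ge> 0" for y
    proof -
      have "real_of_int \<lfloor>y / \<tau>\<rfloor> \<le> y / \<tau>" "y / \<tau> < real_of_int \<lfloor>y / \<tau>\<rfloor> + 1" "0 \<le> \<lfloor>y / \<tau>\<rfloor>"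
        using that assms(1) by auto
      then have "\<tau> * real_of_int \<lfloor>y / \<tau>\<rfloor> \<le> y" "y < \<tau> * (real_of_int \<lfloor>y / \<tau>\<rfloor> + 1)"
        using assms(1) by (simp_all only: pos_le_divide_eq pos_divide_less_eq mult.commute)
      then show ?thesis using assms(1) \<open>0 \<le> \<lfloor>y / \<tau>\<rfloor>\<close> by (auto simp: algebra_simps)
    qed
    show ?thesis using g[of x] g[of "- x"] by (cases "x \<ge> 0") (auto simp: f_def)
  qed
  define z where "z = restrict (\<lambda>j. f (u j)) J"
  have "(\<Sum>j\<in>J. \<bar>real_of_int (z j)\<bar>) \<le> (\<Sum>j\<in>J. (u j)\<^sup>2 / \<tau>\<^sup>2)"
  proof (intro sum_mono)
    fix j assume j: "j \<in> J"
    have "\<bar>z j\<bar> * 1 \<le> \<bar>z j\<bar> * \<bar>z j\<bar>" 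
      by (cases "z j = 0") (auto simp del: mult_1_right abs_mult_self_eq)
    then have "\<bar>z j\<bar> \<le> \<bar>z j\<bar> * \<bar>z j\<bar>" by simp
    then have "\<bar>real_of_int (z j)\<bar> \<le> \<bar>real_of_int (z j)\<bar> * \<bar>real_of_int (z j)\<bar>"
      by (metis of_int_abs of_int_le_iff of_int_mult)
    then have "\<bar>real_of_int (z j)\<bar> \<le> (real_of_int (z j))\<^sup>2" by (simp add: power2_eq_square)
    also have "\<dots> = (\<tau> * real_of_int (z j))\<^sup>2 / \<tau>\<^sup>2" using assms(1) by (simp add: power_mult_distrib)
    also have "\<dots> \<le> (u j)\<^sup>2 / \<tau>\<^sup>2"
      using f[of "u j"] j by (intro divide_right_mono) (auto simp: z_def abs_le_square_iff[symmetric])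
    finally show "\<bar>real_of_int (z j)\<bar> \<le> (u j)\<^sup>2 / \<tau>\<^sup>2" .
  qed
  also have "\<dots> \<le> B / \<tau>\<^sup>2" unfolding sum_divide_distrib[symmetric]
    using assms by (intro divide_right_mono) auto
  finally have "z \<in> lattice_points J (B / \<tau>\<^sup>2)" by (simp add: lattice_points_def z_def)
  then show ?thesis using f by (intro that[of z]) (auto simp: z_def)
qed

section \<open>Subgaussian coordinates and independence\<close>

text \<open>Having all absolute moments is stable under sums and products, so integrability of any
  polynomial in the coordinates follows by introduction rules; with a fixed exponent, each product
  would call for a higher one.\<close>

definition all_moments :: "'a measure \<Rightarrow> ('a \<Rightarrow> real) \<Rightarrow> bool" where
  "all_moments M f \<longleftrightarrow> f \<in> borel_measurable M \<and> (\<forall>m::nat. integrable M (\<lambda>x. \<bar>f x\<bar> ^ m))"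

lemma all_moments_measurable: "all_moments M f \<Longrightarrow> f \<in> borel_measurable M"
  by (simp add: all_moments_def)

lemma all_moments_integrable:
  assumes "all_moments M f"
  shows "integrable M f"
proof -
  have "f \<in> borel_measurable M" "integrable M (\<lambda>x. \<bar>f x\<bar> ^ 1)"
    using assms unfolding all_moments_def by blast+
  then show ?thesis using integrable_abs_iff[of f M] by simp
qed

lemma all_moments_add:
  assumes "all_moments M f" "all_moments M g"
  shows "all_moments M (\<lambda>x. f x + g x)"
  unfolding all_moments_def
proof (intro conjI allI)
  show [measurable]: "(\<lambda>x. f x + g x) \<in> borel_measurable M"
    using assms by (auto simp: all_moments_def)
  fix m :: nat
  have "integrable M (\<lambda>x. 2 ^ m * (\<bar>f x\<bar> ^ m + \<bar>g x\<bar> ^ m))"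
    using assms by (auto simp: all_moments_def)
  then show "integrable M (\<lambda>x. \<bar>f x + g x\<bar> ^ m)"
  proof (rule Bochner_Integration.integrable_bound)
    show "AE x in M. norm (\<bar>f x + g x\<bar> ^ m) \<le> norm (2 ^ m * (\<bar>f x\<bar> ^ m + \<bar>g x\<bar> ^ m))"
    proof (rule AE_I2)
      fix x
      have "\<bar>f x + g x\<bar> ^ m \<le> (2 * max \<bar>f x\<bar> \<bar>g x\<bar>) ^ m" by (intro power_mono) auto
      also have "\<dots> \<le> 2 ^ m * (\<bar>f x\<bar> ^ m + \<bar>g x\<bar> ^ m)"
        unfolding power_mult_distrib by (intro mult_left_mono) (auto simp: max_def)
      finally show "norm (\<bar>f x + g x\<bar> ^ m) \<le> norm (2 ^ m * (\<bar>f x\<bar> ^ m + \<bar>g x\<bar> ^ m))" by simp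
    qed
  qed measurable
qed

lemma all_moments_mult:
  assumes "all_moments M f" "all_moments M g"
  shows "all_moments M (\<lambda>x. f x * g x)"
  unfolding all_moments_def
proof (intro conjI allI)
  show [measurable]: "(\<lambda>x. f x * g x) \<in> borel_measurable M"
    using assms by (auto simp: all_moments_def)
  fix m :: nat
  have "integrable M (\<lambda>x. \<bar>f x\<bar> ^ (2 * m) + \<bar>g x\<bar> ^ (2 * m))"
    using assms by (auto simp: all_moments_def)
  then show "integrable M (\<lambda>x. \<bar>f x * g x\<bar> ^ m)"
  proof (rule Bochner_Integration.integrable_bound)
    show "AE x in M. norm (\<bar>f x * g x\<bar> ^ m) \<le> norm (\<bar>f x\<bar> ^ (2 * m) + \<bar>g x\<bar> ^ (2 * m))"
    proof (rule AE_I2)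
      fix x
      have "\<bar>f x\<bar> ^ m * \<bar>g x\<bar> ^ m \<le> (\<bar>f x\<bar> ^ m)\<^sup>2 + (\<bar>g x\<bar> ^ m)\<^sup>2"
      proof -
        have "0 \<le> \<bar>f x\<bar> ^ m * \<bar>g x\<bar> ^ m" by simp
        then show ?thesis using sum_squares_bound[of "\<bar>f x\<bar> ^ m" "\<bar>g x\<bar> ^ m"] by linarith
      qed
      then show "norm (\<bar>f x * g x\<bar> ^ m) \<le> norm (\<bar>f x\<bar> ^ (2 * m) + \<bar>g x\<bar> ^ (2 * m))"
        by (simp add: abs_mult power_mult_distrib power_mult[symmetric] mult.commute)
    qed
  qed measurable
qed

lemma all_moments_const: "finite_measure M \<Longrightarrow> all_moments M (\<lambda>x. c)"
  by (simp add: all_moments_def finite_measure.integrable_const)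

lemma all_moments_diff:
  assumes "finite_measure M" "all_moments M f" "all_moments M g"
  shows "all_moments M (\<lambda>x. f x - g x)"
  using all_moments_add[OF assms(2) all_moments_mult[OF all_moments_const[OF assms(1), of "-1"] assms(3)]]
  by simp

lemma all_moments_sum:
  assumes "finite_measure M" "\<And>i. i \<in> A \<Longrightarrow> all_moments M (f i)"
  shows "all_moments M (\<lambda>x. \<Sum>i\<in>A. f i x)"
  using assms(2)
  by (induction A rule: infinite_finite_induct)
     (auto intro: all_moments_add all_moments_const[OF assms(1)])

lemma all_moments_power:
  assumes "finite_measure M" "all_moments M f"
  shows "all_moments M (\<lambda>x. f x ^ m)"
  by (induction m) (auto intro: all_moments_mult all_moments_const assms)

lemmas all_moments_intros = all_moments_add all_moments_mult all_moments_diff all_moments_sum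
  all_moments_power all_moments_const

lemma integral_sum_square:
  fixes f :: "'k \<Rightarrow> 'a \<Rightarrow> real"
  assumes "finite A" "\<And>k l. k \<in> A \<Longrightarrow> l \<in> A \<Longrightarrow> integrable M (\<lambda>x. f k x * f l x)"
    "\<And>k l. k \<in> A \<Longrightarrow> l \<in> A \<Longrightarrow> k \<noteq> l \<Longrightarrow> (\<integral>x. f k x * f l x \<partial>M) = 0"
  shows "(\<integral>x. (\<Sum>k\<in>A. f k x)\<^sup>2 \<partial>M) = (\<Sum>k\<in>A. \<integral>x. (f k x)\<^sup>2 \<partial>M)"
proof -
  have "(\<integral>x. (\<Sum>k\<in>A. f k x)\<^sup>2 \<partial>M) = (\<integral>x. (\<Sum>k\<in>A. \<Sum>l\<in>A. f k x * f l x) \<partial>M)"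
    by (simp add: power2_eq_square sum_product)
  also have "\<dots> = (\<Sum>k\<in>A. \<Sum>l\<in>A. \<integral>x. f k x * f l x \<partial>M)"
    using assms(2) by (simp add: Bochner_Integration.integral_sum)
  also have "\<dots> = (\<Sum>k\<in>A. \<Sum>l\<in>A. if l = k then \<integral>x. f k x * f k x \<partial>M else 0)"
    using assms(3) by (intro sum.cong) auto
  also have "\<dots> = (\<Sum>k\<in>A. \<integral>x. (f k x)\<^sup>2 \<partial>M)"
    using assms(1) by (simp add: sum.delta power2_eq_square)
  finally show ?thesis .
qed

section \<open>Exponential and fourth moments of subgaussian variables\<close>

lemma subgaussian_mono:
  assumes "subgaussian D L Z" "0 \<le> L" "L \<le> L'"
  shows "subgaussian D L' Z"
  unfolding subgaussian_def
proof (intro allI conjI)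
  fix t
  show "integrable D (\<lambda>\<omega>. exp (t * Z \<omega>))" using assms by (simp add: subgaussian_def)
  have "(\<integral>\<omega>. exp (t * Z \<omega>) \<partial>D) \<le> exp (L\<^sup>2 * t\<^sup>2 / 2)" using assms by (simp add: subgaussian_def)
  also have "\<dots> \<le> exp (L'\<^sup>2 * t\<^sup>2 / 2)" using assms by (simp add: mult_right_mono power_mono)
  finally show "(\<integral>\<omega>. exp (t * Z \<omega>) \<partial>D) \<le> exp (L'\<^sup>2 * t\<^sup>2 / 2)" .
qed

lemma power_le_fact_exp:
  fixes y :: real
  assumes "0 \<le> y"
  shows "y ^ m \<le> fact m * exp y"
proof -
  have "y ^ m /\<^sub>R fact m \<le> (\<Sum>n. y ^ n /\<^sub>R fact n)"
    using sum_le_suminf[of "\<lambda>n. y ^ n /\<^sub>R fact n" "{m}"] summable_exp_generic[of y] assms by simp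
  then show ?thesis by (simp add: exp_def field_simps)
qed

lemma subgaussian_all_moments:
  assumes "subgaussian D L Z" and [measurable]: "Z \<in> borel_measurable D"
  shows "all_moments D Z"
  unfolding all_moments_def
proof (intro conjI allI)
  fix m :: nat
  have "integrable D (\<lambda>x. exp (1 * Z x))" "integrable D (\<lambda>x. exp ((-1) * Z x))"
    using assms(1) unfolding subgaussian_def by blast+
  then have "integrable D (\<lambda>x. fact m * (exp (Z x) + exp (- Z x)))" by simp
  then show "integrable D (\<lambda>x. \<bar>Z x\<bar> ^ m)"
  proof (rule Bochner_Integration.integrable_bound)
    show "AE x in D. norm (\<bar>Z x\<bar> ^ m) \<le> norm (fact m * (exp (Z x) + exp (- Z x)))"
    proof (rule AE_I2)
      fix x
      have "\<bar>Z x\<bar> ^ m \<le> fact m * exp \<bar>Z x\<bar>" by (rule power_le_fact_exp) simp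
      also have "\<dots> \<le> fact m * (exp (Z x) + exp (- Z x))"
        by (intro mult_left_mono) (auto simp: abs_if)
      finally show "norm (\<bar>Z x\<bar> ^ m) \<le> norm (fact m * (exp (Z x) + exp (- Z x)))"
        by simp
    qed
  qed measurable
qed (use assms in auto)

text \<open>The square is linearised by an auxiliary Gaussian: \<open>exp (a\<^sup>2/2)\<close> is the Laplace
  transform of the standard normal law at \<open>a\<close>.\<close>

lemma subgaussian_exp_square:
  assumes sg: "subgaussian D S Z" and [measurable]: "Z \<in> borel_measurable D" and "S > 0"
    and "prob_space D"
  shows "integrable D (\<lambda>x. exp ((Z x)\<^sup>2 / (4 * S\<^sup>2)))"
    and "(\<integral>x. exp ((Z x)\<^sup>2 / (4 * S\<^sup>2)) \<partial>D) \<le> 2"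
proof -
  interpret prob_space D by fact
  \<comment> \<open>Scaled so that the Laplace transform of \<open>a\<close> at \<open>z\<close> is
    at most exp (z^2/4): half of the Gaussian exponent, so the integral over \<open>z\<close> still
    converges.\<close>
  define a where "a x = Z x / (sqrt 2 * S)" for x
  have [measurable]: "a \<in> borel_measurable D" unfolding a_def by measurable
  have sq: "(Z x)\<^sup>2 / (4 * S\<^sup>2) = (a x)\<^sup>2 / 2" for x
    by (simp add: a_def power_divide power_mult_distrib)
  have dens: "normal_density 0 1 z * exp (b * z) = exp (b\<^sup>2 / 2) * normal_density b 1 z" for b z :: real
    by (simp add: normal_density_def mult_exp_exp power2_eq_square field_simps)
  have 1: "ennreal (exp (b\<^sup>2 / 2)) = (\<integral>\<^sup>+z. ennreal (normal_density 0 1 z * exp (b * z)) \<partial>lborel)" for b :: real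
  proof -
    have "(\<integral>\<^sup>+z. ennreal (normal_density b 1 z) \<partial>lborel) = 1"
      by (subst nn_integral_eq_integral) auto
    then show ?thesis unfolding dens by (simp add: ennreal_mult nn_integral_cmult)
  qed
  have 2: "(\<integral>\<^sup>+x. ennreal (exp (a x * z)) \<partial>D) \<le> ennreal (exp (z\<^sup>2 / 4))" for z
  proof -
    have i: "integrable D (\<lambda>x. exp (a x * z))"
      and e: "(\<integral>x. exp (a x * z) \<partial>D) \<le> exp (S\<^sup>2 * (z / (sqrt 2 * S))\<^sup>2 / 2)"
      using sg[unfolded subgaussian_def, rule_format, of "z / (sqrt 2 * S)"]
      by (simp_all add: a_def mult.commute)
    have "S\<^sup>2 * (z / (sqrt 2 * S))\<^sup>2 / 2 = z\<^sup>2 / 4"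
      using \<open>S > 0\<close> by (simp add: power_divide power_mult_distrib)
    note e = e[unfolded this]
    show ?thesis using i e by (subst nn_integral_eq_integral) (auto intro: ennreal_leI)
  qed
  \<comment> \<open>The surviving exponent -z^2/4 belongs to variance 2; normalising it costs
    \<open>sqrt 2\<close>, which the final bound rounds up to 2.\<close>
  have 3: "normal_density 0 1 z * exp (z\<^sup>2 / 4) = sqrt 2 * normal_density 0 (sqrt 2) z" for z :: real
  proof -
    have e: "exp (- (z\<^sup>2 / 2)) * exp (z\<^sup>2 / 4) = exp (- (z\<^sup>2 / 4))"
      by (simp add: mult_exp_exp)
    have "sqrt (2 * pi * (sqrt 2)\<^sup>2) = sqrt 2 * sqrt (2 * pi)" by (simp add: real_sqrt_mult)
    then have c: "sqrt 2 * (1 / sqrt (2 * pi * (sqrt 2)\<^sup>2)) = 1 / sqrt (2 * pi)" by simp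
    have "normal_density 0 1 z * exp (z\<^sup>2 / 4) = 1 / sqrt (2 * pi) * (exp (- (z\<^sup>2 / 2)) * exp (z\<^sup>2 / 4))"
      by (simp add: normal_density_def)
    also have "\<dots> = sqrt 2 * (1 / sqrt (2 * pi * (sqrt 2)\<^sup>2)) * exp (- (z\<^sup>2 / 4))"
      unfolding e c ..
    also have "\<dots> = sqrt 2 * normal_density 0 (sqrt 2) z" by (simp add: normal_density_def)
    finally show ?thesis .
  qed
  have "(\<integral>\<^sup>+x. ennreal (exp ((Z x)\<^sup>2 / (4 * S\<^sup>2))) \<partial>D)
     = (\<integral>\<^sup>+x. (\<integral>\<^sup>+z. ennreal (normal_density 0 1 z * exp (a x * z)) \<partial>lborel) \<partial>D)"
    by (rule nn_integral_cong) (simp only: sq 1)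
  also have "\<dots> = (\<integral>\<^sup>+z. (\<integral>\<^sup>+x. ennreal (normal_density 0 1 z * exp (a x * z)) \<partial>D) \<partial>lborel)"
  proof -
    have "pair_sigma_finite D lborel"
      by (intro pair_sigma_finite.intro sigma_finite_measure_axioms lborel.sigma_finite_measure_axioms)
    then show ?thesis by (rule pair_sigma_finite.Fubini'[symmetric]) measurable
  qed
  also have "\<dots> \<le> (\<integral>\<^sup>+z. ennreal (sqrt 2 * normal_density 0 (sqrt 2) z) \<partial>lborel)"
  proof (intro nn_integral_mono)
    fix z :: real
    have "(\<integral>\<^sup>+x. ennreal (normal_density 0 1 z * exp (a x * z)) \<partial>D)
       = ennreal (normal_density 0 1 z) * (\<integral>\<^sup>+x. ennreal (exp (a x * z)) \<partial>D)"
      by (subst nn_integral_cmult[symmetric]) (auto simp: ennreal_mult)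
    also have "\<dots> \<le> ennreal (normal_density 0 1 z) * ennreal (exp (z\<^sup>2 / 4))"
      by (intro mult_left_mono 2) auto
    also have "\<dots> = ennreal (sqrt 2 * normal_density 0 (sqrt 2) z)"
      by (simp add: ennreal_mult[symmetric] 3)
    finally show "(\<integral>\<^sup>+x. ennreal (normal_density 0 1 z * exp (a x * z)) \<partial>D)
       \<le> ennreal (sqrt 2 * normal_density 0 (sqrt 2) z)" .
  qed
  also have "\<dots> = ennreal (sqrt 2)"
    by (subst nn_integral_eq_integral) auto
  finally have *: "(\<integral>\<^sup>+x. ennreal (exp ((Z x)\<^sup>2 / (4 * S\<^sup>2))) \<partial>D) \<le> ennreal (sqrt 2)" .
  show int: "integrable D (\<lambda>x. exp ((Z x)\<^sup>2 / (4 * S\<^sup>2)))"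
    using le_less_trans[OF * ennreal_less_top] by (intro integrableI_nonneg) auto
  have "ennreal (\<integral>x. exp ((Z x)\<^sup>2 / (4 * S\<^sup>2)) \<partial>D) \<le> ennreal (sqrt 2)"
    using * int by (subst nn_integral_eq_integral[symmetric]) auto
  then have "(\<integral>x. exp ((Z x)\<^sup>2 / (4 * S\<^sup>2)) \<partial>D) \<le> sqrt 2" by (simp add: ennreal_le_iff)
  also have "\<dots> \<le> 2" by (rule real_le_lsqrt) simp_all
  finally show "(\<integral>x. exp ((Z x)\<^sup>2 / (4 * S\<^sup>2)) \<partial>D) \<le> 2" .
qed

text \<open>With y = Z^2/(4 S^2), the exponential series gives y^2 <= 2 exp y, hence Z^4 <= 32 S^4
  exp y, and exp y has expectation at most 2.\<close>

lemma subgaussian_fourth_moment: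
  assumes sg: "subgaussian D S Z" and [measurable]: "Z \<in> borel_measurable D" and "S > 0"
    and "prob_space D"
  shows "(\<integral>x. (Z x) ^ 4 \<partial>D) \<le> 64 * S ^ 4"
proof -
  interpret prob_space D by fact
  note E = subgaussian_exp_square[OF assms]
  have am: "all_moments D Z" by (rule subgaussian_all_moments[OF sg]) measurable
  have "(\<integral>x. (Z x) ^ 4 \<partial>D) \<le> (\<integral>x. 32 * S ^ 4 * exp ((Z x)\<^sup>2 / (4 * S\<^sup>2)) \<partial>D)"
  proof (rule integral_mono)
    show "integrable D (\<lambda>x. (Z x) ^ 4)"
      using all_moments_integrable[OF all_moments_power[OF finite_measure_axioms am]] .
    show "integrable D (\<lambda>x. 32 * S ^ 4 * exp ((Z x)\<^sup>2 / (4 * S\<^sup>2)))" using E(1) by simp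
    fix x
    have "((Z x)\<^sup>2 / (4 * S\<^sup>2)) ^ 2 \<le> fact 2 * exp ((Z x)\<^sup>2 / (4 * S\<^sup>2))"
      by (rule power_le_fact_exp) simp
    then show "(Z x) ^ 4 \<le> 32 * S ^ 4 * exp ((Z x)\<^sup>2 / (4 * S\<^sup>2))"
      using \<open>S > 0\<close> by (simp add: power_divide power_mult_distrib field_simps)
  qed
  also have "\<dots> \<le> 32 * S ^ 4 * 2" using E \<open>S > 0\<close> by (simp add: mult_left_mono)
  finally show ?thesis by simp
qed

section \<open>Independent coordinates and the sigma-algebras they generate\<close>

locale indep_coords = prob_space M for M :: "'a measure" +
  fixes X :: "'i \<Rightarrow> 'a \<Rightarrow> real" and I :: "'i set"
  assumes indep: "indep_vars (\<lambda>_. borel) X I"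
begin

text \<open>The sigma-algebra generated by the coordinates in \<open>A\<close>, encoded as a measure
  so that being a function of these coordinates becomes ordinary measurability.\<close>

definition coord_algebra :: "'i set \<Rightarrow> 'a measure" where
  "coord_algebra A = vimage_algebra (space M) (\<lambda>\<omega>. \<lambda>k\<in>A. X k \<omega>) (\<Pi>\<^sub>M k\<in>A. borel)"

lemma space_coord_algebra [simp]: "space (coord_algebra A) = space M"
  by (simp add: coord_algebra_def)

lemma X_measurable: "k \<in> I \<Longrightarrow> X k \<in> borel_measurable M"
  using indep by (simp add: indep_vars_def)

lemma coord_algebra_map: "(\<lambda>\<omega>. \<lambda>k\<in>A. X k \<omega>) \<in> coord_algebra A \<rightarrow>\<^sub>M (\<Pi>\<^sub>M k\<in>A. borel)"
  unfolding coord_algebra_def by (rule measurable_vimage_algebra1) (auto simp: space_PiM)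

lemma X_coord_algebra: "k \<in> A \<Longrightarrow> X k \<in> borel_measurable (coord_algebra A)"
  using measurable_compose[OF coord_algebra_map measurable_component_singleton[of k A "\<lambda>_. borel"]]
  by simp

lemma coord_algebra_mono:
  assumes "f \<in> borel_measurable (coord_algebra A)" "A \<subseteq> B"
  shows "f \<in> borel_measurable (coord_algebra B)"
proof -
  have "(\<lambda>x. x) \<in> coord_algebra B \<rightarrow>\<^sub>M coord_algebra A"
    unfolding coord_algebra_def[of A]
    using X_coord_algebra[of _ B] assms(2)
    by (intro measurable_vimage_algebra2 measurable_restrict) auto
  from measurable_compose[OF this assms(1)] show ?thesis .
qed

lemma coord_algebra_measurable:
  assumes "f \<in> borel_measurable (coord_algebra A)" "A \<subseteq> I"
  shows "f \<in> borel_measurable M"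
proof -
  have "(\<lambda>x. x) \<in> M \<rightarrow>\<^sub>M coord_algebra A"
    unfolding coord_algebra_def using X_measurable assms(2)
    by (intro measurable_vimage_algebra2 measurable_restrict) auto
  from measurable_compose[OF this assms(1)] show ?thesis .
qed

text \<open>The blocks of coordinates over \<open>A\<close> and \<open>B\<close> are independent as
  random vectors, and functions measurable for the two coordinate algebras generate smaller
  sigma-algebras.\<close>

lemma indep_var_coord_algebra:
  fixes f g :: "'a \<Rightarrow> real"
  assumes "A \<inter> B = {}" "A \<subseteq> I" "B \<subseteq> I"
    "f \<in> borel_measurable (coord_algebra A)" "g \<in> borel_measurable (coord_algebra B)"
  shows "indep_var borel f borel g"
proof -
  have I2: "indep_set
      (sigma_sets (space M) {(\<lambda>\<omega>. \<lambda>k\<in>A. X k \<omega>) -` C \<inter> space M |C. C \<in> sets (\<Pi>\<^sub>M k\<in>A. borel)})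
      (sigma_sets (space M) {(\<lambda>\<omega>. \<lambda>k\<in>B. X k \<omega>) -` C \<inter> space M |C. C \<in> sets (\<Pi>\<^sub>M k\<in>B. borel)})"
    using indep_var_restrict[OF indep assms(1-3)] unfolding indep_var_eq by blast
  have sub: "sigma_sets (space M) {h -` C \<inter> space M |C. C \<in> sets borel}
      \<subseteq> sigma_sets (space M) {(\<lambda>\<omega>. \<lambda>k\<in>E. X k \<omega>) -` C \<inter> space M |C. C \<in> sets (\<Pi>\<^sub>M k\<in>E. borel)}"
    if "h \<in> borel_measurable (coord_algebra E)" for h :: "'a \<Rightarrow> real" and E
  proof (rule sigma_sets_mono)
    show "{h -` C \<inter> space M |C. C \<in> sets borel}
      \<subseteq> sigma_sets (space M) {(\<lambda>\<omega>. \<lambda>k\<in>E. X k \<omega>) -` C \<inter> space M |C. C \<in> sets (\<Pi>\<^sub>M k\<in>E. borel)}"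
    proof clarify
      fix C :: "real set" assume "C \<in> sets borel"
      then have "h -` C \<inter> space M \<in> sets (coord_algebra E)"
        using measurable_sets[OF that] by simp
      then show "h -` C \<inter> space M \<in> sigma_sets (space M) {(\<lambda>\<omega>. \<lambda>k\<in>E. X k \<omega>) -` C \<inter> space M |C. C \<in> sets (\<Pi>\<^sub>M k\<in>E. borel)}"
        by (simp add: coord_algebra_def sets_vimage_algebra)
    qed
  qed
  have "indep_set (sigma_sets (space M) {f -` C \<inter> space M |C. C \<in> sets borel})
     (sigma_sets (space M) {g -` C \<inter> space M |C. C \<in> sets borel})"
    using I2 sub[OF assms(4)] sub[OF assms(5)] unfolding indep_sets2_eq by blast
  then show ?thesis unfolding indep_var_eq
    using coord_algebra_measurable assms by blast
qed

lemma integral_mult_disjoint: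
  fixes f g :: "'a \<Rightarrow> real"
  assumes "A \<inter> B = {}" "A \<subseteq> I" "B \<subseteq> I"
    "f \<in> borel_measurable (coord_algebra A)" "g \<in> borel_measurable (coord_algebra B)"
    "integrable M f" "integrable M g"
  shows "(\<integral>x. f x * g x \<partial>M) = (\<integral>x. f x \<partial>M) * (\<integral>x. g x \<partial>M)"
    and "integrable M (\<lambda>x. f x * g x)"
  using indep_var_lebesgue_integral[OF indep_var_coord_algebra[OF assms(1-5)] assms(6,7)]
    indep_var_integrable[OF indep_var_coord_algebra[OF assms(1-5)] assms(6,7)] by auto

text \<open>Independence of two blocks at a time suffices: each factor is split off against the
  product of the others, which lives on the union of their blocks.\<close>

lemma integral_prod_disjoint:
  fixes f :: "'j \<Rightarrow> 'a \<Rightarrow> real"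
  assumes "finite J" "disjoint_family_on A J" "\<And>j. j \<in> J \<Longrightarrow> A j \<subseteq> I"
    "\<And>j. j \<in> J \<Longrightarrow> f j \<in> borel_measurable (coord_algebra (A j))"
    "\<And>j. j \<in> J \<Longrightarrow> integrable M (f j)"
  shows "integrable M (\<lambda>x. \<Prod>j\<in>J. f j x) \<and>
     (\<integral>x. (\<Prod>j\<in>J. f j x) \<partial>M) = (\<Prod>j\<in>J. \<integral>x. f j x \<partial>M)"
  using assms
proof (induction J rule: finite_induct)
  case empty then show ?case by (simp add: prob_space)
next
  case (insert j J)
  have IH: "integrable M (\<lambda>x. \<Prod>j\<in>J. f j x) \<and> (\<integral>x. (\<Prod>j\<in>J. f j x) \<partial>M) = (\<Prod>j\<in>J. \<integral>x. f j x \<partial>M)"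
    using insert.prems by (intro insert.IH) (auto simp: disjoint_family_on_def)
  have disj: "A j \<inter> (\<Union>i\<in>J. A i) = {}"
    using insert.prems(1) insert.hyps(2) by (auto simp: disjoint_family_on_def)
  have meas: "(\<lambda>x. \<Prod>j\<in>J. f j x) \<in> borel_measurable (coord_algebra (\<Union>i\<in>J. A i))"
  proof (rule borel_measurable_prod)
    fix i assume "i \<in> J"
    then show "f i \<in> borel_measurable (coord_algebra (\<Union>i\<in>J. A i))"
      using coord_algebra_mono[of "f i" "A i" "\<Union>i\<in>J. A i"] insert.prems(3)[of i] by auto
  qed
  note P = integral_mult_disjoint[OF disj, of "f j" "\<lambda>x. \<Prod>j\<in>J. f j x"]
  show ?case using P insert IH meas by (auto simp: UN_subset_iff)
qed

end

locale subgauss_coords = indep_coords M X I for M :: "'a measure" and X :: "'i \<Rightarrow> 'a \<Rightarrow> real" and I +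
  fixes K :: real
  assumes K_ge_1: "K \<ge> 1"
    and subgauss: "k \<in> I \<Longrightarrow> subgaussian M K (X k)"
    and mean_zero: "k \<in> I \<Longrightarrow> (\<integral>\<omega>. X k \<omega> \<partial>M) = 0"
    and unit_variance: "k \<in> I \<Longrightarrow> (\<integral>\<omega>. (X k \<omega>)\<^sup>2 \<partial>M) = 1"
begin

lemma lin_coord_algebra:
  "(\<lambda>\<omega>. \<Sum>k\<in>A. a k * X k \<omega>) \<in> borel_measurable (coord_algebra A)"
  using X_coord_algebra by (intro borel_measurable_sum borel_measurable_times) auto

lemma lin_measurable: "A \<subseteq> I \<Longrightarrow> (\<lambda>\<omega>. \<Sum>k\<in>A. a k * X k \<omega>) \<in> borel_measurable M"
  by (rule coord_algebra_measurable[OF lin_coord_algebra])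

lemma X_all_moments: "k \<in> I \<Longrightarrow> all_moments M (X k)"
  by (rule subgaussian_all_moments[OF subgauss X_measurable])

lemma lin_all_moments: "A \<subseteq> I \<Longrightarrow> all_moments M (\<lambda>\<omega>. \<Sum>k\<in>A. a k * X k \<omega>)"
  using X_all_moments finite_measure_axioms by (intro all_moments_intros) auto

lemma lin_mgf:
  assumes "finite A" "A \<subseteq> I"
  shows "integrable M (\<lambda>\<omega>. exp (t * (\<Sum>k\<in>A. a k * X k \<omega>)))"
    "(\<integral>\<omega>. exp (t * (\<Sum>k\<in>A. a k * X k \<omega>)) \<partial>M) \<le> exp (K\<^sup>2 * (\<Sum>k\<in>A. (a k)\<^sup>2) * t\<^sup>2 / 2)"
proof -
  have eq: "exp (t * (\<Sum>k\<in>A. a k * X k \<omega>)) = (\<Prod>k\<in>A. exp (t * a k * X k \<omega>))" for \<omega>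
    using assms(1) by (simp add: exp_sum sum_distrib_left mult.assoc)
  have sg: "integrable M (\<lambda>\<omega>. exp (t * a k * X k \<omega>)) \<and> (\<integral>\<omega>. exp (t * a k * X k \<omega>) \<partial>M) \<le> exp (K\<^sup>2 * (t * a k)\<^sup>2 / 2)"
    if "k \<in> A" for k using subgauss[of k] that assms(2) unfolding subgaussian_def by blast
  have *: "integrable M (\<lambda>x. \<Prod>k\<in>A. exp (t * a k * X k x)) \<and>
     (\<integral>x. (\<Prod>k\<in>A. exp (t * a k * X k x)) \<partial>M) = (\<Prod>k\<in>A. \<integral>x. exp (t * a k * X k x) \<partial>M)"
  proof (rule integral_prod_disjoint[OF assms(1), of "\<lambda>k. {k}"])
    fix k assume "k \<in> A"
    have [measurable]: "X k \<in> borel_measurable (coord_algebra {k})" by (rule X_coord_algebra) simp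
    show "(\<lambda>\<omega>. exp (t * a k * X k \<omega>)) \<in> borel_measurable (coord_algebra {k})" by measurable
  qed (use assms sg in \<open>auto simp: disjoint_family_on_def\<close>)
  show "integrable M (\<lambda>\<omega>. exp (t * (\<Sum>k\<in>A. a k * X k \<omega>)))" using * unfolding eq by blast
  have "(\<integral>\<omega>. exp (t * (\<Sum>k\<in>A. a k * X k \<omega>)) \<partial>M) = (\<Prod>k\<in>A. \<integral>x. exp (t * a k * X k x) \<partial>M)"
    using * unfolding eq by blast
  also have "\<dots> \<le> (\<Prod>k\<in>A. exp (K\<^sup>2 * (t * a k)\<^sup>2 / 2))"
    using sg by (intro prod_mono conjI) auto
  also have "\<dots> = exp (\<Sum>k\<in>A. K\<^sup>2 * (t * a k)\<^sup>2 / 2)" using assms(1) by (simp add: exp_sum)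
  also have "(\<Sum>k\<in>A. K\<^sup>2 * (t * a k)\<^sup>2 / 2) = K\<^sup>2 * (\<Sum>k\<in>A. (a k)\<^sup>2) * t\<^sup>2 / 2"
    by (simp add: sum_distrib_left sum_distrib_right sum_divide_distrib power_mult_distrib algebra_simps)
  finally show "(\<integral>\<omega>. exp (t * (\<Sum>k\<in>A. a k * X k \<omega>)) \<partial>M) \<le> exp (K\<^sup>2 * (\<Sum>k\<in>A. (a k)\<^sup>2) * t\<^sup>2 / 2)" .
qed

lemma lin_subgaussian:
  assumes "finite A" "A \<subseteq> I"
  shows "subgaussian M (K * L2_set a A) (\<lambda>\<omega>. \<Sum>k\<in>A. a k * X k \<omega>)"
  unfolding subgaussian_def
  using lin_mgf[OF assms, of _ a] by (simp add: L2_set_def power_mult_distrib sum_nonneg)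

lemma lin_second_moment:
  assumes "finite A" "A \<subseteq> I"
  shows "(\<integral>\<omega>. (\<Sum>k\<in>A. a k * X k \<omega>)\<^sup>2 \<partial>M) = (\<Sum>k\<in>A. (a k)\<^sup>2)"
proof -
  have am: "all_moments M (\<lambda>\<omega>. a k * X k \<omega>)" if "k \<in> A" for k
    using that assms X_all_moments finite_measure_axioms by (intro all_moments_intros) auto
  have "(\<integral>\<omega>. (\<Sum>k\<in>A. a k * X k \<omega>)\<^sup>2 \<partial>M) = (\<Sum>k\<in>A. \<integral>\<omega>. (a k * X k \<omega>)\<^sup>2 \<partial>M)"
  proof (rule integral_sum_square[OF assms(1)])
    fix k l assume kl: "k \<in> A" "l \<in> A"
    show "integrable M (\<lambda>x. a k * X k x * (a l * X l x))"
      using all_moments_integrable[OF all_moments_mult[OF am am]] kl by simp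
    assume "k \<noteq> l"
    have "(\<integral>x. X k x * X l x \<partial>M) = (\<integral>x. X k x \<partial>M) * (\<integral>x. X l x \<partial>M)"
      using kl assms \<open>k \<noteq> l\<close>
      by (intro integral_mult_disjoint[of "{k}" "{l}"] X_coord_algebra all_moments_integrable X_all_moments) auto
    then have "(\<integral>x. (a k * a l) * (X k x * X l x) \<partial>M) = 0"
      using mean_zero kl assms(2) by (subst integral_mult_right_zero) auto
    then show "(\<integral>x. a k * X k x * (a l * X l x) \<partial>M) = 0" by (simp add: mult_ac)
  qed
  also have "\<dots> = (\<Sum>k\<in>A. (a k)\<^sup>2)"
    using unit_variance assms(2) by (intro sum.cong) (auto simp: power_mult_distrib)
  finally show ?thesis .
qed

lemma lin_fourth_moment:
  assumes "finite A" "A \<subseteq> I"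
  shows "(\<integral>\<omega>. (\<Sum>k\<in>A. a k * X k \<omega>) ^ 4 \<partial>M) \<le> 64 * K ^ 4 * (\<Sum>k\<in>A. (a k)\<^sup>2)\<^sup>2"
proof (cases "L2_set a A = 0")
  \<comment> \<open>The fourth moment bound asks for a positive scale, so the zero linear form is
    treated apart.\<close>
  case True
  then have "a k = 0" if "k \<in> A" for k using L2_set_eq_0_iff[OF assms(1)] that by blast
  then show ?thesis by simp
next
  case False
  then have pos: "K * L2_set a A > 0" using K_ge_1 L2_set_nonneg[of a A] by (auto simp: less_le)
  have "(L2_set a A) ^ 4 = ((L2_set a A)\<^sup>2)\<^sup>2" by (simp add: power2_eq_square power4_eq_xxxx)
  also have "(L2_set a A)\<^sup>2 = (\<Sum>k\<in>A. (a k)\<^sup>2)" by (simp add: L2_set_def sum_nonneg)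
  finally show ?thesis
    using subgaussian_fourth_moment[OF lin_subgaussian[OF assms] lin_measurable[OF assms(2)] pos prob_space_axioms]
    by (simp add: power_mult_distrib mult.assoc)
qed

end

section \<open>A restricted lower bound for the design\<close>

lemma L2_set_abs_mono:
  "(\<And>i. i \<in> A \<Longrightarrow> \<bar>f i\<bar> \<le> \<bar>g i\<bar>) \<Longrightarrow> L2_set f A \<le> L2_set g A"
  unfolding L2_set_def by (intro real_sqrt_le_mono sum_mono) (simp add: abs_le_square_iff)

lemma L2_set_scale: "L2_set (\<lambda>i. a * f i) A = \<bar>a\<bar> * L2_set f A"
  unfolding L2_set_def power_mult_distrib sum_distrib_left[symmetric] by (simp add: real_sqrt_mult)

lemma L2_set_power2: "(L2_set f A)\<^sup>2 = (\<Sum>i\<in>A. (f i)\<^sup>2)"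
  by (simp add: L2_set_def sum_nonneg)

lemma sum_abs_le_sqrt_card:
  fixes f :: "'b \<Rightarrow> real"
  shows "(\<Sum>i\<in>A. \<bar>f i\<bar>) \<le> sqrt (real (card A)) * L2_set f A"
  using sum_mult_le_L2[of "\<lambda>_. 1" "\<lambda>i. \<bar>f i\<bar>" A] by (simp add: L2_set_def)

lemma L2_set_diff_le:
  "L2_set (\<lambda>i. f i - g i) A \<le> L2_set f A + L2_set g A"
  using L2_set_triangle_ineq[of f "\<lambda>i. - g i" A] by (simp add: L2_set_def)

section \<open>Deterministic lower bound from inequalities at lattice points\<close>

context
  fixes x :: "nat \<Rightarrow> nat \<Rightarrow> real" and R :: "nat set" and p n k :: nat and K c1 m :: real
  assumes fin: "finite R" and n: "card R = n" "n \<ge> 1" and p: "p \<ge> 1" and K: "K \<ge> 1"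
    and c1: "0 < c1" "c1 \<le> 1" and k: "1 \<le> k" "k \<le> p" "real k * log_rank p k \<le> c1 * real n"
    and k_max: "\<And>i. k < i \<Longrightarrow> i \<le> p \<Longrightarrow> c1 * real n \<le> real i * log_rank p i"
    and m: "m = (112 * K)\<^sup>2 * real k"
    and upper: "\<And>z S. z \<in> lattice_points R (4 * real n) \<Longrightarrow>
        (\<Sum>i\<in>R. (1 / (2 * sqrt (real n)) * real_of_int (z i))\<^sup>2) \<le> 1 \<Longrightarrow> S \<subseteq> {..<p} \<Longrightarrow> S \<noteq> {} \<Longrightarrow>
        (\<Sum>j\<in>S. (\<Sum>i\<in>R. 1 / (2 * sqrt (real n)) * real_of_int (z i) * x i j)\<^sup>2)
           \<le> 4 * K\<^sup>2 * (3 * (real (card S) * log_rank p (card S)) + 7 * real n)"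
    and lower: "\<And>z. z \<in> lattice_points {..<p} m \<Longrightarrow>
        real n / 4 * (\<Sum>j<p. (real_of_int (z j))\<^sup>2) \<le> (\<Sum>i\<in>R. (\<Sum>j<p. x i j * real_of_int (z j))\<^sup>2)"
begin

text \<open>Cauchy-Schwarz over \<open>S\<close>, in two regimes. Up to size \<open>k\<close> the
  term in \<open>n\<close> dominates and 4 * 10 <= 49 gives a bound that does not depend on
  \<open>S\<close>; beyond \<open>k\<close>, \<open>n\<close> is at most
  \<open>i * log_rank p i / c1\<close> and the bound has the form of a sum of Slope weights. This is
  the condition that \<open>truncated_sum_le\<close> puts on \<open>g\<close>.\<close>

lemma column_partial_sums:
  assumes z: "z \<in> lattice_points R (4 * real n)"
    "(\<Sum>i\<in>R. (1 / (2 * sqrt (real n)) * real_of_int (z i))\<^sup>2) \<le> 1"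
    and S: "S \<subseteq> {..<p}" "S \<noteq> {}"
  shows "(\<Sum>j\<in>S. \<bar>\<Sum>i\<in>R. 1 / (2 * sqrt (real n)) * real_of_int (z i) * x i j\<bar>)
     \<le> 7 * K * sqrt (real k * real n)
       + 2 * K * sqrt (10 / c1) * (real (card S) * sqrt (log_rank p (card S)))"
proof -
  define i where "i = card S"
  have fS: "finite S" using S finite_subset by blast
  have i: "1 \<le> i" "i \<le> p"
    using S card_mono[of "{..<p}" S] fS by (auto simp: i_def Suc_le_eq card_gt_0_iff)
  define h where "h = log_rank p i"
  have h: "h \<ge> 1" using log_rank_ge_1[OF i] by (simp add: h_def)
  define g where "g j = (\<Sum>i\<in>R. 1 / (2 * sqrt (real n)) * real_of_int (z i) * x i j)" for j
  have g2: "(\<Sum>j\<in>S. (g j)\<^sup>2) \<le> 4 * K\<^sup>2 * (3 * (real i * h) + 7 * real n)"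
    using upper[OF z S] by (simp add: g_def i_def h_def)
  have b: "(\<Sum>j\<in>S. \<bar>g j\<bar>) \<le> sqrt (real i * (\<Sum>j\<in>S. (g j)\<^sup>2))"
    using sum_abs_le_sqrt_card[of g S] by (simp add: L2_set_def real_sqrt_mult i_def)
  have nonneg: "7 * K * sqrt (real k * real n) \<ge> 0" "2 * K * sqrt (10 / c1) * (real i * sqrt h) \<ge> 0"
    using K c1 h by auto
  show ?thesis
  proof (cases "i \<le> k")
    case True
    have "real i * h \<le> real k * log_rank p k"
      unfolding h_def using i True k by (intro mult_log_rank_mono) auto
    also have "\<dots> \<le> c1 * real n" by (rule k(3))
    also have "\<dots> \<le> 1 * real n" using c1 by (intro mult_right_mono) auto
    finally have ih: "real i * h \<le> real n" by simp
    have "real i * (\<Sum>j\<in>S. (g j)\<^sup>2) \<le> real k * (4 * K\<^sup>2 * (3 * real n + 7 * real n))"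
      using True by (intro mult_mono order_trans[OF g2] mult_left_mono add_mono sum_nonneg) (use ih in auto)
    also have "\<dots> \<le> (7 * K)\<^sup>2 * (real k * real n)"
      by (simp add: power_mult_distrib mult_right_mono)
    finally have "sqrt (real i * (\<Sum>j\<in>S. (g j)\<^sup>2)) \<le> sqrt ((7 * K)\<^sup>2 * (real k * real n))"
      by (rule real_sqrt_le_mono)
    also have "\<dots> = 7 * K * sqrt (real k * real n)" using K by (simp add: real_sqrt_mult)
    finally have "(\<Sum>j\<in>S. \<bar>g j\<bar>) \<le> 7 * K * sqrt (real k * real n) + 2 * K * sqrt (10 / c1) * (real i * sqrt h)"
      using b nonneg by linarith
    then show ?thesis unfolding g_def i_def h_def .
  next
    case False
    then have "c1 * real n \<le> real i * h" unfolding h_def using k_max[of i] i by simp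
    then have "real n \<le> real i * h / c1" using c1 by (simp add: pos_le_divide_eq mult.commute)
    moreover have "real i * h \<le> real i * h / c1"
      using c1 h by (simp add: pos_le_divide_eq mult_left_le)
    moreover have "3 * a + 7 * b \<le> 10 * q" if "b \<le> q" "a \<le> q" for a b q :: real
      using that by linarith
    ultimately have "3 * (real i * h) + 7 * real n \<le> 10 * (real i * h / c1)" by blast
    then have "4 * K\<^sup>2 * (3 * (real i * h) + 7 * real n) \<le> 4 * K\<^sup>2 * (10 * (real i * h / c1))"
      by (rule mult_left_mono) simp
    then have "real i * (\<Sum>j\<in>S. (g j)\<^sup>2) \<le> real i * (4 * K\<^sup>2 * (10 * (real i * h / c1)))"
      using g2 by (intro mult_left_mono) auto
    also have "\<dots> = (2 * K * real i)\<^sup>2 * (10 / c1 * h)"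
      by (simp add: power_mult_distrib power2_eq_square)
    finally have "sqrt (real i * (\<Sum>j\<in>S. (g j)\<^sup>2)) \<le> sqrt ((2 * K * real i)\<^sup>2 * (10 / c1 * h))"
      by (rule real_sqrt_le_mono)
    also have "\<dots> = 2 * K * real i * (sqrt (10 / c1) * sqrt h)"
      using K by (simp only: real_sqrt_mult real_sqrt_abs) simp
    also have "\<dots> = 2 * K * sqrt (10 / c1) * (real i * sqrt h)" by (simp only: mult_ac)
    finally have "(\<Sum>j\<in>S. \<bar>g j\<bar>) \<le> 7 * K * sqrt (real k * real n) + 2 * K * sqrt (10 / c1) * (real i * sqrt h)"
      using b nonneg by linarith
    then show ?thesis unfolding g_def i_def h_def .
  qed
qed

text \<open>The norm of the image is its inner product with its own direction. Rounding this
  direction to the net leaves an error of norm at most 1/2, absorbed at the price of the factor 2;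
  after exchanging the sums, the design is seen only through its columns tested at a net
  point.\<close>

lemma rounding_error_image:
  assumes rk: "ranking p u r" and tau: "\<tau> \<ge> 0"
    and w: "\<And>j. j < p \<Longrightarrow> \<bar>w j\<bar> \<le> \<bar>u j\<bar>" "\<And>j. j < p \<Longrightarrow> \<bar>w j\<bar> \<le> \<tau>"
  shows "L2_set (\<lambda>i. \<Sum>j<p. x i j * w j) R \<le> 2 * (\<tau> * (7 * K * sqrt (real k * real n))
       + 2 * K * sqrt (10 / c1) * (\<Sum>j<p. sqrt (log_rank p (r j)) * \<bar>u j\<bar>))" (is "_ \<le> 2 * ?rhs")
proof -
  define y where "y i = (\<Sum>j<p. x i j * w j)" for i
  define N where "N = L2_set y R"
  have N0: "N \<ge> 0" by (simp add: N_def L2_set_nonneg)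
  have log0: "log_rank p (r j) \<ge> 0" if "j < p" for j
    using rk that log_rank_ge_1[of "r j" p] by (fastforce simp: ranking_def bij_betw_def)
  have rhs0: "?rhs \<ge> 0" using K c1 tau log0 by (intro add_nonneg_nonneg mult_nonneg_nonneg sum_nonneg) auto
  show ?thesis
  proof (cases "N = 0")
    case True
    then have "L2_set (\<lambda>i. \<Sum>j<p. x i j * w j) R = 0" by (simp add: N_def y_def[abs_def])
    then show ?thesis using mult_nonneg_nonneg[of 2, OF _ rhs0] by (simp only:)
  next
    case False
    then have Np: "N > 0" using N0 by simp
    define v where "v i = y i / N" for i
    have y2: "(\<Sum>i\<in>R. (y i)\<^sup>2) = N\<^sup>2" by (simp add: N_def L2_set_power2)
    have v1: "(\<Sum>i\<in>R. (v i)\<^sup>2) = 1"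
      using Np y2 by (simp add: v_def power_divide sum_divide_distrib[symmetric])
    \<comment> \<open>Errors of at most \<open>t\<close> in \<open>n\<close> coordinates have
      Euclidean norm at most 1/2, and a unit vector rounded with this step has l1 budget 1/t^2 = 4
      n.\<close>
    define t where "t = 1 / (2 * sqrt (real n))"
    have t: "t > 0" "1 / t\<^sup>2 = 4 * real n" using n by (auto simp: t_def power_divide power_mult_distrib)
    obtain z where z: "z \<in> lattice_points R (1 / t\<^sup>2)"
      "\<And>i. i \<in> R \<Longrightarrow> \<bar>v i - t * real_of_int (z i)\<bar> \<le> t"
      "\<And>i. i \<in> R \<Longrightarrow> \<bar>v i - t * real_of_int (z i)\<bar> \<le> \<bar>v i\<bar>"
      "\<And>i. i \<in> R \<Longrightarrow> \<bar>t * real_of_int (z i)\<bar> \<le> \<bar>v i\<bar>"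
      using lattice_rounding[OF t(1) fin eq_refl[OF v1]] by metis
    have z2: "(\<Sum>i\<in>R. (t * real_of_int (z i))\<^sup>2) \<le> 1"
      unfolding v1[symmetric] using z(4) by (intro sum_mono) (simp add: abs_le_square_iff)
    define g where "g j = (\<Sum>i\<in>R. t * real_of_int (z i) * x i j)" for j
    have err: "L2_set (\<lambda>i. v i - t * real_of_int (z i)) R \<le> 1/2"
    proof -
      have "L2_set (\<lambda>i. v i - t * real_of_int (z i)) R \<le> L2_set (\<lambda>i. t) R"
        using z(2) t by (intro L2_set_abs_mono) auto
      also have "\<dots> = 1/2" using n t by (simp add: L2_set_def real_sqrt_mult) (simp add: t_def)
      finally show ?thesis .
    qed
    have "N = (\<Sum>i\<in>R. y i * v i)"
      using y2 Np by (simp add: v_def power2_eq_square sum_divide_distrib[symmetric])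
    also have "\<dots> = (\<Sum>i\<in>R. y i * (t * real_of_int (z i))) + (\<Sum>i\<in>R. y i * (v i - t * real_of_int (z i)))"
      by (simp add: sum.distrib[symmetric] algebra_simps)
    also have "(\<Sum>i\<in>R. y i * (v i - t * real_of_int (z i))) \<le> N * (1/2)"
      using order_trans[OF sum_mult_le_L2 mult_left_mono[OF err L2_set_nonneg]] by (simp add: N_def)
    also have "(\<Sum>i\<in>R. y i * (t * real_of_int (z i))) = (\<Sum>j<p. w j * g j)"
    proof -
      have "(\<Sum>i\<in>R. y i * (t * real_of_int (z i))) = (\<Sum>i\<in>R. \<Sum>j<p. w j * (t * real_of_int (z i) * x i j))"
        unfolding y_def sum_distrib_right by (intro sum.cong refl) (simp only: mult_ac)
      also have "\<dots> = (\<Sum>j<p. w j * g j)" unfolding g_def sum_distrib_left by (rule sum.swap)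
      finally show ?thesis .
    qed
    also have "(\<Sum>j<p. w j * g j) \<le> (\<Sum>j<p. \<bar>w j\<bar> * \<bar>g j\<bar>)"
      by (intro sum_mono) (simp add: abs_mult[symmetric])
    also have "\<dots> \<le> ?rhs"
    proof (rule truncated_sum_le[OF rk p _ _ tau w])
      fix S assume "S \<subseteq> {..<p}" "S \<noteq> {}"
      from column_partial_sums[OF z(1)[unfolded t(2)] z2[unfolded t_def] this]
      show "(\<Sum>j\<in>S. \<bar>g j\<bar>) \<le> 7 * K * sqrt (real k * real n)
          + 2 * K * sqrt (10 / c1) * (real (card S) * sqrt (log_rank p (card S)))"
        by (simp add: g_def t_def)
    qed (use K c1 in auto)
    finally have "N \<le> ?rhs + N * (1/2)" by (simp only: add.commute)
    moreover have "a \<le> 2 * b" if "a \<le> b + a * (1/2)" for a b :: real using that by linarith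
    ultimately have "N \<le> 2 * ?rhs" by blast
    then show ?thesis unfolding N_def y_def[abs_def] .
  qed
qed

text \<open>The same duality with the direction of \<open>w\<close> itself: the entries of a unit
  vector over \<open>S\<close> sum to at most sqrt |S| in absolute value. For |S| > \<open>k\<close>
  this is bounded by the Slope part, because \<open>c1 * n\<close> is then at most |S|
  log(ep/|S|).\<close>

lemma rounding_error_norm:
  assumes rk: "ranking p u r" and tau: "\<tau> \<ge> 0"
    and w: "\<And>j. j < p \<Longrightarrow> \<bar>w j\<bar> \<le> \<bar>u j\<bar>" "\<And>j. j < p \<Longrightarrow> \<bar>w j\<bar> \<le> \<tau>"
  shows "L2_set w {..<p} \<le> \<tau> * sqrt (real k)
     + 1 / sqrt (c1 * real n) * (\<Sum>j<p. sqrt (log_rank p (r j)) * \<bar>u j\<bar>)" (is "_ \<le> ?rhs")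
proof -
  define N where "N = L2_set w {..<p}"
  have N0: "N \<ge> 0" by (simp add: N_def L2_set_nonneg)
  have log0: "log_rank p (r j) \<ge> 0" if "j < p" for j
    using rk that log_rank_ge_1[of "r j" p] by (fastforce simp: ranking_def bij_betw_def)
  have rhs0: "?rhs \<ge> 0" using c1 tau log0 by (intro add_nonneg_nonneg mult_nonneg_nonneg sum_nonneg) auto
  have cn: "c1 * real n > 0" using c1 n by simp
  show ?thesis
  proof (cases "N = 0")
    case True then show ?thesis using rhs0 by (simp add: N_def)
  next
    case False
    then have Np: "N > 0" using N0 by simp
    have w2: "(\<Sum>j<p. (w j)\<^sup>2) = N\<^sup>2" by (simp add: N_def L2_set_power2)
    have "\<bar>w j\<bar> * \<bar>w j / N\<bar> = (w j)\<^sup>2 / N" for j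
      using Np by (simp add: abs_divide power2_eq_square)
    then have "N = (\<Sum>j<p. \<bar>w j\<bar> * \<bar>w j / N\<bar>)"
      unfolding sum_divide_distrib[symmetric] w2 using Np
      by (simp only: sum_divide_distrib[symmetric] w2) (simp add: power2_eq_square)
    also have "\<dots> \<le> ?rhs"
    proof (rule truncated_sum_le[OF rk p _ _ tau w])
      fix S assume S: "S \<subseteq> {..<p}" "S \<noteq> {}"
      define i where "i = card S"
      have fS: "finite S" using S finite_subset by blast
      have i: "1 \<le> i" "i \<le> p"
        using S card_mono[of "{..<p}" S] fS by (auto simp: i_def Suc_le_eq card_gt_0_iff)
      have h: "log_rank p i \<ge> 1" using log_rank_ge_1[OF i] .
      have "L2_set w S \<le> N" unfolding N_def L2_set_def using S by (intro real_sqrt_le_mono sum_mono2) auto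
      then have "L2_set (\<lambda>j. w j / N) S \<le> 1"
        using L2_set_scale[of "1/N" w S] Np by simp
      then have "(\<Sum>j\<in>S. \<bar>w j / N\<bar>) \<le> sqrt (real i) * 1"
        unfolding i_def by (intro order_trans[OF sum_abs_le_sqrt_card] mult_left_mono) auto
      also have "\<dots> \<le> sqrt (real k) + 1 / sqrt (c1 * real n) * (real i * sqrt (log_rank p i))"
      proof (cases "i \<le> k")
        case True
        have "1 / sqrt (c1 * real n) * (real i * sqrt (log_rank p i)) \<ge> 0" using cn h by auto
        moreover have "sqrt (real i) \<le> sqrt (real k)" using True by simp
        ultimately show ?thesis by linarith
      next
        case False
        then have "c1 * real n \<le> real i * log_rank p i" using k_max[of i] i by simp
        then have "sqrt (c1 * real n) * sqrt (real i) \<le> sqrt (real i * log_rank p i) * sqrt (real i)"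
          by (intro mult_right_mono real_sqrt_le_mono) auto
        also have "\<dots> = real i * sqrt (log_rank p i)"
          by (simp add: real_sqrt_mult)
        finally have "sqrt (real i) \<le> 1 / sqrt (c1 * real n) * (real i * sqrt (log_rank p i))"
          using cn by (simp add: pos_le_divide_eq mult.commute)
        moreover have "sqrt (real k) \<ge> 0" by simp
        ultimately show ?thesis by linarith
      qed
      finally show "(\<Sum>j\<in>S. \<bar>w j / N\<bar>) \<le> sqrt (real k)
          + 1 / sqrt (c1 * real n) * (real (card S) * sqrt (log_rank p (card S)))"
        by (simp add: i_def)
    qed (use cn in auto)
    finally show ?thesis by (simp add: N_def)
  qed
qed

lemma restricted_lower_bound_unit:
  assumes rk: "ranking p u r" and u1: "L2_set u {..<p} = 1"
  shows "L2_set (\<lambda>i. \<Sum>j<p. x i j * u j) R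
     \<ge> sqrt (real n) / 4 - 16 * K / sqrt c1 * (\<Sum>j<p. sqrt (log_rank p (r j)) * \<bar>u j\<bar>)"
proof -
  define H where "H = (\<Sum>j<p. sqrt (log_rank p (r j)) * \<bar>u j\<bar>)"
  have log0: "log_rank p (r j) \<ge> 0" if "j < p" for j
    using rk that log_rank_ge_1[of "r j" p] by (fastforce simp: ranking_def bij_betw_def)
  have H0: "H \<ge> 0" unfolding H_def using log0 by (intro sum_nonneg mult_nonneg_nonneg) auto
  have mp: "m > 0" using m K k by simp
  \<comment> \<open>With \<open>m = (112 * K)^2 * k\<close>, rounding moves \<open>u\<close> by at
    most 1/112 in norm and its image by 1/8 of \<open>sqrt n\<close>, up to Slope terms. The
    coefficient left is (1/2)(111/112) - 1/8, which exceeds 1/4.\<close>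
  define \<tau> where "\<tau> = 1 / sqrt m"
  have tau: "\<tau> > 0" "1 / \<tau>\<^sup>2 = m" using mp by (auto simp: \<tau>_def power_divide)
  have sm: "sqrt m = 112 * K * sqrt (real k)" using K by (simp add: m real_sqrt_mult)
  have u2: "(\<Sum>j<p. (u j)\<^sup>2) \<le> 1" using u1 L2_set_power2[of u "{..<p}"] by simp
  obtain z where z: "z \<in> lattice_points {..<p} (1 / \<tau>\<^sup>2)"
    "\<And>j. j < p \<Longrightarrow> \<bar>u j - \<tau> * real_of_int (z j)\<bar> \<le> \<tau>"
    "\<And>j. j < p \<Longrightarrow> \<bar>u j - \<tau> * real_of_int (z j)\<bar> \<le> \<bar>u j\<bar>"
    using lattice_rounding[OF tau(1) finite_lessThan[of p] u2] by (metis lessThan_iff)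
  define w where "w j = u j - \<tau> * real_of_int (z j)" for j
  define y where "y i = (\<Sum>j<p. x i j * real_of_int (z j))" for i
  have I: "L2_set (\<lambda>i. \<Sum>j<p. x i j * w j) R \<le> 2 * (\<tau> * (7 * K * sqrt (real k * real n))
       + 2 * K * sqrt (10 / c1) * H)"
    unfolding H_def by (rule rounding_error_image[OF rk]) (use tau z in \<open>auto simp: w_def\<close>)
  have W: "L2_set w {..<p} \<le> \<tau> * sqrt (real k) + 1 / sqrt (c1 * real n) * H"
    unfolding H_def by (rule rounding_error_norm[OF rk]) (use tau z in \<open>auto simp: w_def\<close>)
  have tk: "\<tau> * (7 * K * sqrt (real k * real n)) = sqrt (real n) / 16"
    using K k by (simp add: \<tau>_def sm real_sqrt_mult)
  have tk2: "\<tau> * sqrt (real k) \<le> 1 / 112"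
    using K k by (simp add: \<tau>_def sm)
  have "sqrt (real n / 4 * (\<Sum>j<p. (real_of_int (z j))\<^sup>2)) \<le> L2_set y R"
    unfolding L2_set_def y_def using lower[of z] z(1) tau(2) by (intro real_sqrt_le_mono) simp
  then have "sqrt (real n) / 2 * L2_set (\<lambda>j. real_of_int (z j)) {..<p} \<le> L2_set y R"
    by (simp add: L2_set_def real_sqrt_mult real_sqrt_divide)
  then have Y: "sqrt (real n) / 2 * L2_set (\<lambda>j. \<tau> * real_of_int (z j)) {..<p} \<le> L2_set (\<lambda>i. \<tau> * y i) R"
    unfolding L2_set_scale using tau(1) mult_left_mono[of _ _ \<tau>] by (simp add: mult_ac)
  have "1 \<le> L2_set (\<lambda>j. \<tau> * real_of_int (z j)) {..<p} + L2_set w {..<p}"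
    using L2_set_triangle_ineq[of "\<lambda>j. \<tau> * real_of_int (z j)" w "{..<p}"] u1 by (simp add: w_def)
  then have "sqrt (real n) / 2 * (1 - L2_set w {..<p}) \<le> sqrt (real n) / 2 * L2_set (\<lambda>j. \<tau> * real_of_int (z j)) {..<p}"
    by (intro mult_left_mono) auto
  also note Y
  also have "L2_set (\<lambda>i. \<tau> * y i) R \<le> L2_set (\<lambda>i. \<Sum>j<p. x i j * u j) R + L2_set (\<lambda>i. \<Sum>j<p. x i j * w j) R"
    using L2_set_diff_le[of "\<lambda>i. \<Sum>j<p. x i j * u j" "\<lambda>i. \<Sum>j<p. x i j * w j" R]
    by (simp add: w_def y_def algebra_simps sum_subtractf sum_distrib_left)
  finally have main: "L2_set (\<lambda>i. \<Sum>j<p. x i j * u j) R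
      \<ge> sqrt (real n) / 2 * (1 - L2_set w {..<p}) - L2_set (\<lambda>i. \<Sum>j<p. x i j * w j) R" by simp
  have "sqrt (real n) / 2 * (1 - L2_set w {..<p})
      \<ge> sqrt (real n) / 2 * (1 - (1 / 112 + 1 / sqrt (c1 * real n) * H))"
    using W tk2 by (intro mult_left_mono) auto
  moreover have "sqrt (real n) / 2 * (1 - (1 / 112 + 1 / sqrt (c1 * real n) * H))
      = 111 / 224 * sqrt (real n) - 1 / 2 / sqrt c1 * H"
    using n c1 by (simp add: real_sqrt_mult field_simps)
  moreover have "2 * (\<tau> * (7 * K * sqrt (real k * real n)) + 2 * K * sqrt (10 / c1) * H)
      = sqrt (real n) / 8 + 4 * K * sqrt 10 / sqrt c1 * H"
    unfolding tk by (simp add: real_sqrt_divide)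
  \<comment> \<open>The Slope terms from the norm and from the image of the rounding error are
    collected into the constant 16; \<open>K >= 1\<close> absorbs the summand 1/2.\<close>
  moreover have "1 / 2 / sqrt c1 * H + 4 * K * sqrt 10 / sqrt c1 * H \<le> 16 * K / sqrt c1 * H"
  proof -
    have "sqrt 10 \<le> 35/10" by (rule real_le_lsqrt) (auto simp: power2_eq_square)
    then have "K * sqrt 10 \<le> K * (35/10)" using K by (intro mult_left_mono) auto
    then have "1/2 + 4 * K * sqrt 10 \<le> 16 * K" using K by linarith
    then have "(1/2 + 4 * K * sqrt 10) * (H / sqrt c1) \<le> 16 * K * (H / sqrt c1)"
      using H0 c1 by (intro mult_right_mono) auto
    then show ?thesis by (simp add: algebra_simps)
  qed
  moreover have "sqrt (real n) \<ge> 0" by simp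
  moreover have "N / 4 - g \<le> x" if "a \<le> b" "a = 111 / 224 * N - d" "e = N / 8 + f" "d + f \<le> g"
      "0 \<le> N" "b - y \<le> x" "y \<le> e" for a b d e f g x y N :: real
    using that by linarith
  ultimately show ?thesis using main I unfolding H_def[symmetric] by blast
qed

lemma restricted_lower_bound:
  assumes rk: "ranking p u r"
  shows "L2_set (\<lambda>i. \<Sum>j<p. x i j * u j) R
     \<ge> sqrt (real n) / 4 * L2_set u {..<p}
        - 16 * K / sqrt c1 * (\<Sum>j<p. sqrt (log_rank p (r j)) * \<bar>u j\<bar>)"
proof (cases "L2_set u {..<p} = 0")
  case True
  then have "u j = 0" if "j < p" for j using L2_set_eq_0_iff[of "{..<p}" u] that by auto
  then show ?thesis using True by (simp add: L2_set_nonneg)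
next
  case False
  define N where "N = L2_set u {..<p}"
  have N: "N > 0" unfolding N_def using False by (metis L2_set_nonneg less_le)
  have "L2_set (\<lambda>j. 1 / N * u j) {..<p} = 1"
    unfolding L2_set_scale using N by (simp add: N_def)
  from restricted_lower_bound_unit[OF ranking_scale[OF rk] this]
  have "L2_set (\<lambda>i. 1 / N * (\<Sum>j<p. x i j * u j)) R
      \<ge> sqrt (real n) / 4 - 16 * K / sqrt c1 * (1 / N * (\<Sum>j<p. sqrt (log_rank p (r j)) * \<bar>u j\<bar>))"
    using N by (simp add: sum_distrib_left abs_mult mult_ac)
  then have "N * (1 / N * L2_set (\<lambda>i. \<Sum>j<p. x i j * u j) R) \<ge> N *
      (sqrt (real n) / 4 - 16 * K / sqrt c1 * (1 / N * (\<Sum>j<p. sqrt (log_rank p (r j)) * \<bar>u j\<bar>)))"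
    unfolding L2_set_scale using N by (intro mult_left_mono) auto
  then show ?thesis using N by (simp add: right_diff_distrib N_def mult_ac)
qed

end

section \<open>Tail bounds for the design and the exceptional event\<close>

lemma exp_minus_le_quadratic:
  fixes x :: real
  assumes "0 \<le> x"
  shows "exp (- x) \<le> 1 - x + x\<^sup>2 / 2"
proof -
  have pos: "1 + x + x\<^sup>2 / 2 > 0" using assms by (intro add_pos_nonneg) auto
  have "exp (- x) * (1 + x + x\<^sup>2 / 2) \<le> exp (- x) * exp x"
    using exp_lower_Taylor_quadratic[OF assms] by (intro mult_left_mono) auto
  also have "\<dots> = 1" by (simp add: mult_exp_exp)
  also have "1 \<le> (1 - x + x\<^sup>2 / 2) * (1 + x + x\<^sup>2 / 2)"
  proof -
    have "(1 - x + x\<^sup>2 / 2) * (1 + x + x\<^sup>2 / 2) = 1 + (x\<^sup>2 / 2)\<^sup>2"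
      by (simp add: power2_eq_square algebra_simps)
    then show ?thesis by simp
  qed
  finally show ?thesis using pos by (simp add: mult_le_cancel_right)
qed

lemma (in prob_space) markov_inequality:
  fixes f :: "'a \<Rightarrow> real"
  assumes "integrable M f" "\<And>x. 0 \<le> f x" "c > 0" "(\<integral>x. f x \<partial>M) \<le> b * c"
  shows "prob {x \<in> space M. c \<le> f x} \<le> b"
proof -
  have "prob {x \<in> space M. c \<le> f x} \<le> (\<integral>x. f x \<partial>M) / c"
    using assms(1-3) by (intro integral_Markov_inequality_measure[where A = "{}"]) auto
  also have "\<dots> \<le> b" using assms(3,4) by (simp add: pos_divide_le_eq)
  finally show ?thesis .
qed

lemma sum_exp_minus_le_1: "(\<Sum>i=1..p. exp (- real i)) \<le> 1"
proof -
  have "exp (-1) \<le> (1/2::real)" using exp_ge_add_one_self[of 1] by (simp add: exp_minus field_simps)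
  then have *: "exp (- real i) \<le> (1/2) ^ i" for i
    using power_mono[of "exp (-1)" "1/2::real" i] by (simp add: exp_of_nat_mult[symmetric])
  have "(\<Sum>i=1..p. exp (- real i)) \<le> (\<Sum>i=1..p. (1/2) ^ i)" by (intro sum_mono *)
  also have "\<dots> = 1 - (1/2) ^ p" by (induction p) (auto simp: field_simps)
  finally show ?thesis by (simp add: order_trans)
qed

locale subgauss_design = subgauss_coords M X "R \<times> {..<p}" K
  for M :: "'a measure" and X :: "nat \<times> nat \<Rightarrow> 'a \<Rightarrow> real" and R :: "nat set" and p :: nat and K :: real +
  assumes fin_R: "finite R" and p_pos: "p \<ge> 1"
begin

lemma row_eq: "(\<Sum>j<p. X (i, j) \<omega> * u j) = (\<Sum>k\<in>{i} \<times> {..<p}. u (snd k) * X k \<omega>)"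
proof -
  have "{i} \<times> {..<p} = Pair i ` {..<p}" by auto
  then show ?thesis by (simp add: sum.reindex inj_on_def mult.commute)
qed

lemma row_sum_square: "(\<Sum>k\<in>{i} \<times> {..<p}. (u (snd k))\<^sup>2) = (\<Sum>j<p. (u j)\<^sup>2)" for u :: "nat \<Rightarrow> real"
proof -
  have "{i} \<times> {..<p} = Pair i ` {..<p}" by auto
  then show ?thesis by (simp add: sum.reindex inj_on_def)
qed

lemma column_eq: "(\<Sum>i\<in>R. v i * X (i, j) \<omega>) = (\<Sum>k\<in>R \<times> {j}. v (fst k) * X k \<omega>)"
proof -
  have "R \<times> {j} = (\<lambda>i. (i, j)) ` R" by auto
  then show ?thesis by (simp add: sum.reindex inj_on_def)
qed

lemma column_sum_square: "(\<Sum>k\<in>R \<times> {j}. (v (fst k))\<^sup>2) = (\<Sum>i\<in>R. (v i)\<^sup>2)" for v :: "nat \<Rightarrow> real"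
proof -
  have "R \<times> {j} = (\<lambda>i. (i, j)) ` R" by auto
  then show ?thesis by (simp add: sum.reindex inj_on_def)
qed

text \<open>The square of a row sum Y is nonnegative, so its lower tail needs only two moments: exp
  (- l Y^2) is at most 1 - l Y^2 + l^2 Y^4 / 2. With V the second moment and l V = \<mu> = 1/(64
  K^4), the expectation is at most 1 - \<mu>/2. Over n independent rows this multiplies to exp (- n
  \<mu> / 2), and the threshold n V / 4 takes back half of the exponent.\<close>

lemma row_sums_lower_tail:
  assumes U: "(\<Sum>j<p. (u j)\<^sup>2) > 0"
  shows "{\<omega> \<in> space M. (\<Sum>i\<in>R. (\<Sum>j<p. X (i, j) \<omega> * u j)\<^sup>2) \<le> real (card R) / 4 * (\<Sum>j<p. (u j)\<^sup>2)} \<in> events"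
    and "prob {\<omega> \<in> space M. (\<Sum>i\<in>R. (\<Sum>j<p. X (i, j) \<omega> * u j)\<^sup>2) \<le> real (card R) / 4 * (\<Sum>j<p. (u j)\<^sup>2)}
      \<le> exp (- real (card R) / (256 * K ^ 4))"
proof -
  define Y where "Y i \<omega> = (\<Sum>k\<in>{i} \<times> {..<p}. u (snd k) * X k \<omega>)" for i \<omega>
  define V where "V = (\<Sum>j<p. (u j)\<^sup>2)"
  have V: "V > 0" using U by (simp add: V_def)
  define \<mu> where "\<mu> = 1 / (64 * K ^ 4)"
  have K0: "K > 0" using K_ge_1 by simp
  have mu: "\<mu> > 0" using K0 by (simp add: \<mu>_def)
  define l where "l = \<mu> / V"
  have l: "l > 0" using mu V by (simp add: l_def)
  have sub: "{i} \<times> {..<p} \<subseteq> R \<times> {..<p}" if "i \<in> R" for i using that by auto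
  have am: "all_moments M (Y i)" if "i \<in> R" for i
    unfolding Y_def by (rule lin_all_moments[OF sub[OF that]])
  have Ym: "Y i \<in> borel_measurable M" if "i \<in> R" for i using am[OF that] by (rule all_moments_measurable)
  define f where "f i \<omega> = exp (- (l * (Y i \<omega>)\<^sup>2))" for i \<omega>
  have fc: "f i \<in> borel_measurable (coord_algebra ({i} \<times> {..<p}))" for i
  proof -
    have [measurable]: "Y i \<in> borel_measurable (coord_algebra ({i} \<times> {..<p}))"
      unfolding Y_def by (rule lin_coord_algebra)
    show ?thesis unfolding f_def by measurable
  qed
  have fi: "integrable M (f i)" if "i \<in> R" for i
  proof (rule integrable_const_bound[of _ 1])
    have [measurable]: "Y i \<in> borel_measurable M" by (rule Ym[OF that])
    show "f i \<in> borel_measurable M" unfolding f_def by measurable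
    show "AE x in M. norm (f i x) \<le> 1" using l by (auto simp: f_def)
  qed
  have fE: "(\<integral>\<omega>. f i \<omega> \<partial>M) \<le> exp (- \<mu> / 2)" if "i \<in> R" for i
  proof -
    have i2: "integrable M (\<lambda>\<omega>. (Y i \<omega>) ^ m)" for m
      by (rule all_moments_integrable[OF all_moments_power[OF finite_measure_axioms am[OF that]]])
    have "(\<integral>\<omega>. f i \<omega> \<partial>M) \<le> (\<integral>\<omega>. 1 - l * (Y i \<omega>)\<^sup>2 + l\<^sup>2 / 2 * (Y i \<omega>) ^ 4 \<partial>M)"
    proof (rule integral_mono[OF fi[OF that]])
      show "integrable M (\<lambda>\<omega>. 1 - l * (Y i \<omega>)\<^sup>2 + l\<^sup>2 / 2 * (Y i \<omega>) ^ 4)" using i2 by auto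
      fix \<omega>
      have "(l * (Y i \<omega>)\<^sup>2)\<^sup>2 = l\<^sup>2 * (Y i \<omega>) ^ 4" by (simp add: power_mult_distrib flip: power_mult)
      then show "f i \<omega> \<le> 1 - l * (Y i \<omega>)\<^sup>2 + l\<^sup>2 / 2 * (Y i \<omega>) ^ 4"
        unfolding f_def using exp_minus_le_quadratic[of "l * (Y i \<omega>)\<^sup>2"] l by simp
    qed
    also have "\<dots> = 1 - l * (\<integral>\<omega>. (Y i \<omega>)\<^sup>2 \<partial>M) + l\<^sup>2 / 2 * (\<integral>\<omega>. (Y i \<omega>) ^ 4 \<partial>M)"
      using i2 by (simp add: prob_space)
    also have "(\<integral>\<omega>. (Y i \<omega>)\<^sup>2 \<partial>M) = V"
      unfolding Y_def using lin_second_moment[of "{i} \<times> {..<p}" "\<lambda>k. u (snd k)"] sub[OF that]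
      by (simp add: row_sum_square V_def)
    also have "l\<^sup>2 / 2 * (\<integral>\<omega>. (Y i \<omega>) ^ 4 \<partial>M) \<le> l\<^sup>2 / 2 * (64 * K ^ 4 * V\<^sup>2)"
      unfolding Y_def using lin_fourth_moment[of "{i} \<times> {..<p}" "\<lambda>k. u (snd k)"] sub[OF that]
      by (intro mult_left_mono) (auto simp: row_sum_square V_def)
    also have "1 - l * V + l\<^sup>2 / 2 * (64 * K ^ 4 * V\<^sup>2) = 1 - \<mu> / 2"
    proof -
      have "l\<^sup>2 * V\<^sup>2 = \<mu>\<^sup>2" "l * V = \<mu>" using V by (auto simp: l_def power_divide)
      moreover have "64 * K ^ 4 * \<mu> = 1" using K0 by (simp add: \<mu>_def)
      then have "64 * K ^ 4 * \<mu>\<^sup>2 = \<mu>"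
        by (simp only: power2_eq_square mult.assoc[symmetric] mult_1_left)
      moreover have "l\<^sup>2 / 2 * (64 * K ^ 4 * V\<^sup>2) = 64 * K ^ 4 * (l\<^sup>2 * V\<^sup>2) / 2" by simp
      ultimately show ?thesis by simp
    qed
    also have "\<dots> \<le> exp (- \<mu> / 2)" using exp_ge_add_one_self[of "- \<mu> / 2"] by simp
    finally show ?thesis by simp
  qed
  have P: "integrable M (\<lambda>\<omega>. \<Prod>i\<in>R. f i \<omega>) \<and> (\<integral>\<omega>. (\<Prod>i\<in>R. f i \<omega>) \<partial>M) = (\<Prod>i\<in>R. \<integral>\<omega>. f i \<omega> \<partial>M)"
    by (rule integral_prod_disjoint[OF fin_R, of "\<lambda>i. {i} \<times> {..<p}"])
       (use sub fc fi in \<open>auto simp: disjoint_family_on_def\<close>)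
  have "(\<integral>\<omega>. (\<Prod>i\<in>R. f i \<omega>) \<partial>M) = (\<Prod>i\<in>R. \<integral>\<omega>. f i \<omega> \<partial>M)" using P by blast
  also have "\<dots> \<le> (\<Prod>i\<in>R. exp (- \<mu> / 2))"
    using fE by (intro prod_mono conjI integral_nonneg) (simp_all add: f_def)
  also have "\<dots> = exp (- (real (card R) * \<mu> / 4)) * exp (- (real (card R) * \<mu> / 4))"
    by (simp add: exp_of_nat_mult[symmetric] mult_exp_exp)
  finally have E: "(\<integral>\<omega>. (\<Prod>i\<in>R. f i \<omega>) \<partial>M) \<le> exp (- (real (card R) * \<mu> / 4)) * exp (- (real (card R) * \<mu> / 4))" .
  have "prob {\<omega> \<in> space M. exp (- (real (card R) * \<mu> / 4)) \<le> (\<Prod>i\<in>R. f i \<omega>)} \<le> exp (- (real (card R) * \<mu> / 4))"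
    by (rule markov_inequality[OF _ _ _ E]) (use P in \<open>auto simp: f_def intro!: prod_nonneg\<close>)
  moreover have "exp (- (real (card R) * \<mu> / 4)) \<le> (\<Prod>i\<in>R. f i \<omega>) \<longleftrightarrow>
      (\<Sum>i\<in>R. (\<Sum>j<p. X (i, j) \<omega> * u j)\<^sup>2) \<le> real (card R) / 4 * V" for \<omega>
  proof -
    have "(\<Prod>i\<in>R. f i \<omega>) = exp (- (l * (\<Sum>i\<in>R. (Y i \<omega>)\<^sup>2)))"
      using fin_R by (simp add: f_def exp_sum[symmetric] sum_negf sum_distrib_left)
    moreover have "(real (card R) * \<mu> / 4) = l * (real (card R) / 4 * V)" using V by (simp add: l_def)
    ultimately show ?thesis unfolding row_eq Y_def[symmetric]
      by (simp only: exp_le_cancel_iff neg_le_iff_le mult_le_cancel_left_pos[OF l])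
  qed
  moreover have "- (real (card R) * \<mu> / 4) = - real (card R) / (256 * K ^ 4)" by (simp add: \<mu>_def)
  ultimately show "prob {\<omega> \<in> space M. (\<Sum>i\<in>R. (\<Sum>j<p. X (i, j) \<omega> * u j)\<^sup>2) \<le> real (card R) / 4 * (\<Sum>j<p. (u j)\<^sup>2)}
      \<le> exp (- real (card R) / (256 * K ^ 4))"
    by (simp add: V_def)
  have [measurable]: "(\<lambda>\<omega>. \<Sum>i\<in>R. (Y i \<omega>)\<^sup>2) \<in> borel_measurable M"
    using Ym by (intro borel_measurable_sum borel_measurable_power) auto
  show "{\<omega> \<in> space M. (\<Sum>i\<in>R. (\<Sum>j<p. X (i, j) \<omega> * u j)\<^sup>2) \<le> real (card R) / 4 * (\<Sum>j<p. (u j)\<^sup>2)} \<in> events"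
    unfolding row_eq Y_def[symmetric] by measurable
qed

text \<open>Truncation at the level \<open>l\<close> handles all index sets at once: over any
  \<open>S\<close> the scaled squares sum to at most |S| l plus this excess, so no union over
  subsets is taken. Columns are independent, and each exponential factor has expectation at most 1 +
  2 exp (-l) by the exponential moment of the square.\<close>

lemma column_sums_upper_tail:
  assumes v: "(\<Sum>i\<in>R. (v i)\<^sup>2) \<le> 1"
  shows "{\<omega> \<in> space M. 2 * real p * exp (- l) + t
      \<le> (\<Sum>j<p. max 0 ((\<Sum>i\<in>R. v i * X (i, j) \<omega>)\<^sup>2 / (4 * K\<^sup>2) - l))} \<in> events"
    and "prob {\<omega> \<in> space M. 2 * real p * exp (- l) + t
      \<le> (\<Sum>j<p. max 0 ((\<Sum>i\<in>R. v i * X (i, j) \<omega>)\<^sup>2 / (4 * K\<^sup>2) - l))} \<le> exp (- t)"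
proof -
  define g where "g j \<omega> = (\<Sum>k\<in>R \<times> {j}. v (fst k) * X k \<omega>)" for j \<omega>
  have sub: "R \<times> {j} \<subseteq> R \<times> {..<p}" if "j < p" for j using that by auto
  have gm: "g j \<in> borel_measurable M" if "j < p" for j
    unfolding g_def by (rule lin_measurable[OF sub[OF that]])
  have L1: "L2_set (\<lambda>k. v (fst k)) (R \<times> {j}) \<le> 1" for j
    unfolding L2_set_def column_sum_square using v by simp
  have sg: "subgaussian M K (g j)" if "j < p" for j
  proof (rule subgaussian_mono)
    show "subgaussian M (K * L2_set (\<lambda>k. v (fst k)) (R \<times> {j})) (g j)"
      unfolding g_def using fin_R sub[OF that] by (intro lin_subgaussian) auto
    show "0 \<le> K * L2_set (\<lambda>k. v (fst k)) (R \<times> {j})" using K_ge_1 by (simp add: L2_set_nonneg)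
    show "K * L2_set (\<lambda>k. v (fst k)) (R \<times> {j}) \<le> K"
      using mult_left_mono[OF L1[of j], of K] K_ge_1 by (simp only: mult_1_right)
  qed
  have K0: "K > 0" using K_ge_1 by simp
  note E = subgaussian_exp_square[OF sg gm K0 prob_space_axioms]
  define f where "f j \<omega> = exp (max 0 ((g j \<omega>)\<^sup>2 / (4 * K\<^sup>2) - l))" for j \<omega>
  have fle: "f j \<omega> \<le> 1 + exp (- l) * exp ((g j \<omega>)\<^sup>2 / (4 * K\<^sup>2))" for j \<omega>
    by (auto simp: f_def max_def mult_exp_exp add_increasing)
  have fm: "f j \<in> borel_measurable M" if "j < p" for j
  proof -
    have [measurable]: "g j \<in> borel_measurable M" by (rule gm[OF that])
    show ?thesis unfolding f_def by measurable
  qed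
  have bi: "integrable M (\<lambda>\<omega>. 1 + exp (- l) * exp ((g j \<omega>)\<^sup>2 / (4 * K\<^sup>2)))" if "j < p" for j
    using E(1)[OF that that] by auto
  have fi: "integrable M (f j)" if "j < p" for j
    using bi[OF that] by (rule Bochner_Integration.integrable_bound)
      (use fm[OF that] fle in \<open>auto simp: f_def abs_of_pos add_pos_pos\<close>)
  have fE: "(\<integral>\<omega>. f j \<omega> \<partial>M) \<le> exp (2 * exp (- l))" if "j < p" for j
  proof -
    have "(\<integral>\<omega>. f j \<omega> \<partial>M) \<le> (\<integral>\<omega>. 1 + exp (- l) * exp ((g j \<omega>)\<^sup>2 / (4 * K\<^sup>2)) \<partial>M)"
      by (rule integral_mono[OF fi[OF that] bi[OF that] fle])
    also have "\<dots> = 1 + exp (- l) * (\<integral>\<omega>. exp ((g j \<omega>)\<^sup>2 / (4 * K\<^sup>2)) \<partial>M)"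
      using E(1)[OF that that] by (simp add: prob_space)
    also have "\<dots> \<le> 1 + exp (- l) * 2" using E(2)[OF that that] by (intro add_left_mono mult_left_mono) auto
    also have "\<dots> \<le> exp (2 * exp (- l))" using exp_ge_add_one_self[of "2 * exp (- l)"] by (simp add: mult.commute)
    finally show ?thesis .
  qed
  have fc: "f j \<in> borel_measurable (coord_algebra (R \<times> {j}))" for j
  proof -
    have [measurable]: "g j \<in> borel_measurable (coord_algebra (R \<times> {j}))"
      unfolding g_def by (rule lin_coord_algebra)
    show ?thesis unfolding f_def by measurable
  qed
  have P: "integrable M (\<lambda>\<omega>. \<Prod>j<p. f j \<omega>) \<and> (\<integral>\<omega>. (\<Prod>j<p. f j \<omega>) \<partial>M) = (\<Prod>j<p. \<integral>\<omega>. f j \<omega> \<partial>M)"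
    by (rule integral_prod_disjoint[of _ "\<lambda>j. R \<times> {j}"])
       (use sub fc fi in \<open>auto simp: disjoint_family_on_def\<close>)
  have "(\<integral>\<omega>. (\<Prod>j<p. f j \<omega>) \<partial>M) = (\<Prod>j<p. \<integral>\<omega>. f j \<omega> \<partial>M)" using P by blast
  also have "\<dots> \<le> (\<Prod>j<p. exp (2 * exp (- l)))"
    using fE by (intro prod_mono conjI integral_nonneg) (simp_all add: f_def)
  also have "\<dots> = exp (- t) * exp (2 * real p * exp (- l) + t)"
    by (simp add: exp_of_nat_mult[symmetric] mult_exp_exp mult_ac)
  finally have B: "(\<integral>\<omega>. (\<Prod>j<p. f j \<omega>) \<partial>M) \<le> exp (- t) * exp (2 * real p * exp (- l) + t)" .
  have eq: "exp (2 * real p * exp (- l) + t) \<le> (\<Prod>j<p. f j \<omega>) \<longleftrightarrow> 2 * real p * exp (- l) + t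
      \<le> (\<Sum>j<p. max 0 ((\<Sum>i\<in>R. v i * X (i, j) \<omega>)\<^sup>2 / (4 * K\<^sup>2) - l))" for \<omega>
    unfolding f_def g_def column_eq by (simp add: exp_sum[symmetric])
  have "prob {\<omega> \<in> space M. exp (2 * real p * exp (- l) + t) \<le> (\<Prod>j<p. f j \<omega>)} \<le> exp (- t)"
    by (rule markov_inequality[OF _ _ _ B]) (use P in \<open>auto simp: f_def intro!: prod_nonneg\<close>)
  then show "prob {\<omega> \<in> space M. 2 * real p * exp (- l) + t
      \<le> (\<Sum>j<p. max 0 ((\<Sum>i\<in>R. v i * X (i, j) \<omega>)\<^sup>2 / (4 * K\<^sup>2) - l))} \<le> exp (- t)"
    unfolding eq .
  have "(\<lambda>\<omega>. \<Prod>j<p. f j \<omega>) \<in> borel_measurable M" using fm by (intro borel_measurable_prod) auto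
  then have "{\<omega> \<in> space M. exp (2 * real p * exp (- l) + t) \<le> (\<Prod>j<p. f j \<omega>)} \<in> events"
    by measurable
  then show "{\<omega> \<in> space M. 2 * real p * exp (- l) + t
      \<le> (\<Sum>j<p. max 0 ((\<Sum>i\<in>R. v i * X (i, j) \<omega>)\<^sup>2 / (4 * K\<^sup>2) - l))} \<in> events"
    unfolding eq .
qed

text \<open>Two union bounds, over a net of directions in the space of responses and over lattice
  points in the space of parameters, supply the inequalities assumed by
  \<open>restricted_lower_bound\<close>. That bound is deterministic, so one exceptional set serves
  all \<open>u\<close>.\<close>

lemma restricted_lower_bound_event:
  assumes n: "n = card R" "n \<ge> 1"
    and c1: "c1 = 1 / (512 * K ^ 4 * ((112 * K)\<^sup>2 + 2))" and small: "log_rank p 1 \<le> c1 * real n"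
  obtains B where "B \<in> events" "prob B \<le> 2 * exp (- real n / (512 * K ^ 4))"
    "\<And>\<omega> u r. \<omega> \<in> space M - B \<Longrightarrow> ranking p u r \<Longrightarrow>
       L2_set (\<lambda>i. \<Sum>j<p. X (i, j) \<omega> * u j) R
        \<ge> sqrt (real n) / 4 * L2_set u {..<p} - 16 * K / sqrt c1 * (\<Sum>j<p. sqrt (log_rank p (r j)) * \<bar>u j\<bar>)"
proof -
  have K0: "K > 0" using K_ge_1 by simp
  have K4: "K ^ 4 \<ge> 1" using K_ge_1 by (rule one_le_power)
  have c1p: "0 < c1" unfolding c1 using K0 by (intro divide_pos_pos mult_pos_pos add_nonneg_pos) auto
  have c1le: "c1 \<le> 1"
  proof -
    have "1 * 1 \<le> (512 * K ^ 4) * ((112 * K)\<^sup>2 + 2)" using K4 by (intro mult_mono) auto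
    then show ?thesis unfolding c1 using K0 by simp
  qed
  \<comment> \<open>The largest sparsity whose lattice can be afforded; by \<open>small\<close> the
    set contains 1, so the maximum exists.\<close>
  define k where "k = Max {k \<in> {1..p}. real k * log_rank p k \<le> c1 * real n}"
  have fS: "finite {k \<in> {1..p}. real k * log_rank p k \<le> c1 * real n}" by simp
  have "1 \<in> {k \<in> {1..p}. real k * log_rank p k \<le> c1 * real n}" using small p_pos by simp
  then have "k \<in> {k \<in> {1..p}. real k * log_rank p k \<le> c1 * real n}"
    unfolding k_def using fS by (intro Max_in) auto
  then have k: "1 \<le> k" "k \<le> p" "real k * log_rank p k \<le> c1 * real n" by auto
  have k_max: "c1 * real n \<le> real i * log_rank p i" if "k < i" "i \<le> p" for i
  proof (rule ccontr)
    assume "\<not> ?thesis"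
    then have "i \<in> {k \<in> {1..p}. real k * log_rank p k \<le> c1 * real n}" using that by auto
    then have "i \<le> k" unfolding k_def using fS by (intro Max_ge) auto
    then show False using that by simp
  qed
  define m where "m = (112 * K)\<^sup>2 * real k"
  define t where "t = 1 / (2 * sqrt (real n))"
  define Z1 where "Z1 = {z \<in> lattice_points R (4 * real n). (\<Sum>i\<in>R. (t * real_of_int (z i))\<^sup>2) \<le> 1}"
  define E1 where "E1 z i = {\<omega> \<in> space M. 2 * real p * exp (- ln (real p / real i)) + (real i + 7 * real n)
      \<le> (\<Sum>j<p. max 0 ((\<Sum>a\<in>R. t * real_of_int (z a) * X (a, j) \<omega>)\<^sup>2 / (4 * K\<^sup>2) - ln (real p / real i)))}"
    for z i
  \<comment> \<open>The origin is excluded because the tail bound divides by the squared norm; the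
    wanted inequality is trivial there.\<close>
  define Z2 where "Z2 = {z \<in> lattice_points {..<p} m. (\<Sum>j<p. (real_of_int (z j))\<^sup>2) > 0}"
  define E2 where "E2 z = {\<omega> \<in> space M. (\<Sum>i\<in>R. (\<Sum>j<p. X (i, j) \<omega> * real_of_int (z j))\<^sup>2)
      \<le> real (card R) / 4 * (\<Sum>j<p. (real_of_int (z j))\<^sup>2)}" for z
  define B1 where "B1 = (\<Union>z\<in>Z1. \<Union>i\<in>{1..p}. E1 z i)"
  define B2 where "B2 = (\<Union>z\<in>Z2. E2 z)"
  have e1: "exp (-1) \<le> (1/2::real)" using exp_ge_add_one_self[of 1] by (simp add: exp_minus field_simps)
  have L1: "finite (lattice_points R (4 * real n))"
      "real (card (lattice_points R (4 * real n))) \<le> exp (1 * (4 * real n) + 4 * exp (-1) * real (card R))"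
    using lattice_points_card[OF fin_R e1, of "4 * real n"] by auto
  have ek: "exp (- log_rank p k) = exp (-1) * (real k / real p)"
    using k by (simp add: log_rank_def exp_diff exp_minus field_simps)
  have "exp (- log_rank p k) \<le> 1/2"
  proof -
    have "exp (-1) * (real k / real p) \<le> 1/2 * 1" using e1 k by (intro mult_mono) auto
    then show ?thesis unfolding ek by simp
  qed
  \<comment> \<open>Counting with \<beta> = \<open>log_rank p k\<close> balances the two terms of
    the exponent: p exp (- \<beta>) equals k/e, so both are of order
    \<open>k * log_rank p k\<close>.\<close>
  note L2 = lattice_points_card[OF finite_lessThan[of p] this, of m]
  have m0: "m \<ge> 0" by (simp add: m_def)
  have F1: "finite Z1" unfolding Z1_def using L1 by auto
  have F2: "finite Z2" unfolding Z2_def using L2(1)[OF m0] by auto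
  have E1e: "E1 z i \<in> events" "prob (E1 z i) \<le> exp (- (real i + 7 * real n))" if "z \<in> Z1" for z i
    using column_sums_upper_tail[of "\<lambda>a. t * real_of_int (z a)" "ln (real p / real i)" "real i + 7 * real n"] that
    unfolding E1_def Z1_def by blast+
  have E2e: "E2 z \<in> events" "prob (E2 z) \<le> exp (- real n / (256 * K ^ 4))" if "z \<in> Z2" for z
    using row_sums_lower_tail[of "\<lambda>j. real_of_int (z j)"] that
    unfolding E2_def Z2_def n(1) by blast+
  have P1: "prob B1 \<le> exp (- real n / (512 * K ^ 4))"
  proof -
    have "prob B1 \<le> (\<Sum>z\<in>Z1. prob (\<Union>i\<in>{1..p}. E1 z i))"
      unfolding B1_def using E1e F1 by (intro finite_measure_subadditive_finite) auto
    also have "\<dots> \<le> (\<Sum>z\<in>Z1. \<Sum>i=1..p. exp (- (real i + 7 * real n)))"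
      using E1e by (intro sum_mono order_trans[OF finite_measure_subadditive_finite]) auto
    also have "\<dots> = real (card Z1) * (exp (- (7 * real n)) * (\<Sum>i=1..p. exp (- real i)))"
      by (simp add: sum_distrib_left mult_exp_exp add.commute)
    \<comment> \<open>The net has at most exp (4 n + 2 n) points, while each event has probability
      at most exp (- i - 7 n): hence the 7 n in the level of \<open>E1\<close>. The summand
      \<open>i\<close> there makes the sum over sizes geometric.\<close>
    also have "\<dots> \<le> exp (6 * real n) * (exp (- (7 * real n)) * 1)"
    proof (intro mult_mono sum_exp_minus_le_1)
      have "real (card Z1) \<le> real (card (lattice_points R (4 * real n)))"
        unfolding Z1_def using L1(1) by (intro of_nat_mono card_mono) auto
      also note L1(2)
      also have "exp (1 * (4 * real n) + 4 * exp (-1) * real (card R)) \<le> exp (6 * real n)"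
      proof -
        have "4 * exp (-1) * real (card R) \<le> 4 * (1/2) * real n"
          unfolding n(1)[symmetric] by (intro mult_right_mono mult_left_mono e1) auto
        then show ?thesis unfolding exp_le_cancel_iff by linarith
      qed
      finally show "real (card Z1) \<le> exp (6 * real n)" .
    qed (auto intro!: mult_nonneg_nonneg sum_nonneg)
    also have "\<dots> = exp (- real n)" by (simp add: mult_exp_exp)
    also have "\<dots> \<le> exp (- real n / (512 * K ^ 4))"
    proof -
      have "real n / (512 * K ^ 4) \<le> real n / 1" using K4 by (intro divide_left_mono) auto
      then show ?thesis by simp
    qed
    finally show ?thesis .
  qed
  have P2: "prob B2 \<le> exp (- real n / (512 * K ^ 4))"
  proof -
    have "prob B2 \<le> (\<Sum>z\<in>Z2. prob (E2 z))"
      unfolding B2_def using E2e F2 by (intro finite_measure_subadditive_finite) auto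
    also have "\<dots> \<le> (\<Sum>z\<in>Z2. exp (- real n / (256 * K ^ 4)))" using E2e by (intro sum_mono) auto
    also have "\<dots> = real (card Z2) * exp (- real n / (256 * K ^ 4))" by simp
    \<comment> \<open>The value of \<open>c1\<close> is made for this line: the number of lattice
      points may use up half of the exponent n / (256 K^4) of the tail bound.\<close>
    also have "\<dots> \<le> exp (real n / (512 * K ^ 4)) * exp (- real n / (256 * K ^ 4))"
    proof (rule mult_right_mono)
      have "real (card Z2) \<le> real (card (lattice_points {..<p} m))"
        unfolding Z2_def using L2(1)[OF m0] by (intro of_nat_mono card_mono) auto
      also note L2(2)[OF m0]
      also have "exp (log_rank p k * m + 4 * exp (- log_rank p k) * real (card {..<p})) \<le> exp (real n / (512 * K ^ 4))"
      proof -
        have h1: "log_rank p k \<ge> 1" using k by (intro log_rank_ge_1)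
        have "4 * exp (- log_rank p k) * real (card {..<p}) = 4 * exp (-1) * real k"
          unfolding ek using p_pos by simp
        also have "\<dots> \<le> 4 * (1/2) * real k" by (intro mult_right_mono mult_left_mono e1) auto
        also have "\<dots> = 2 * real k" by simp
        also have "\<dots> \<le> 2 * (real k * log_rank p k)"
          using mult_left_mono[OF h1, of "real k"] by simp
        finally have "log_rank p k * m + 4 * exp (- log_rank p k) * real (card {..<p})
           \<le> ((112 * K)\<^sup>2 + 2) * (real k * log_rank p k)" by (simp add: m_def algebra_simps)
        also have "\<dots> \<le> ((112 * K)\<^sup>2 + 2) * (c1 * real n)" using k by (intro mult_left_mono) auto
        also have "\<dots> = real n / (512 * K ^ 4)"
        proof -
          have "(112 * K)\<^sup>2 + 2 > 0" by (intro add_nonneg_pos) auto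
          moreover have "a * (1 / (b * a) * q) = q / b" if "a > 0" for a b q :: real using that by simp
          ultimately show ?thesis unfolding c1 by blast
        qed
        finally show ?thesis by simp
      qed
      finally show "real (card Z2) \<le> exp (real n / (512 * K ^ 4))" .
    qed simp
    also have "\<dots> = exp (- real n / (512 * K ^ 4))" by (simp add: mult_exp_exp)
    finally show ?thesis .
  qed
  show ?thesis
  proof (rule that[of "B1 \<union> B2"])
    have B1e: "B1 \<in> events" unfolding B1_def using F1 E1e by (intro sets.finite_UN) auto
    have B2e: "B2 \<in> events" unfolding B2_def using F2 E2e by (intro sets.finite_UN) auto
    show "B1 \<union> B2 \<in> events" using B1e B2e by auto
    have "prob (B1 \<union> B2) \<le> prob B1 + prob B2" using B1e B2e by (rule measure_Un_le)
    then show "prob (B1 \<union> B2) \<le> 2 * exp (- real n / (512 * K ^ 4))" using P1 P2 by linarith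
  next
    fix \<omega> u r assume w: "\<omega> \<in> space M - (B1 \<union> B2)" and rk: "ranking p u r"
    show "L2_set (\<lambda>i. \<Sum>j<p. X (i, j) \<omega> * u j) R
        \<ge> sqrt (real n) / 4 * L2_set u {..<p} - 16 * K / sqrt c1 * (\<Sum>j<p. sqrt (log_rank p (r j)) * \<bar>u j\<bar>)"
    proof (rule restricted_lower_bound[OF fin_R n(1)[symmetric] n(2) p_pos K_ge_1 c1p c1le k k_max m_def _ _ rk])
      fix z S assume z: "z \<in> lattice_points R (4 * real n)"
        "(\<Sum>i\<in>R. (1 / (2 * sqrt (real n)) * real_of_int (z i))\<^sup>2) \<le> 1" and S: "S \<subseteq> {..<p}" "S \<noteq> {}"
      define i where "i = card S"
      have fS: "finite S" using S finite_subset by blast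
      have i: "1 \<le> i" "i \<le> p"
        using S card_mono[of "{..<p}" S] fS by (auto simp: i_def Suc_le_eq card_gt_0_iff)
      \<comment> \<open>At this level the term \<open>2 * p * exp (- l)\<close> is 2 i, comparable
        with the size of \<open>S\<close>.\<close>
      define l where "l = ln (real p / real i)"
      define g where "g j = (\<Sum>a\<in>R. t * real_of_int (z a) * X (a, j) \<omega>)" for j
      have "z \<in> Z1" using z by (simp add: Z1_def t_def)
      then have "\<omega> \<notin> E1 z i" using w i by (auto simp: B1_def)
      then have "(\<Sum>j<p. max 0 ((g j)\<^sup>2 / (4 * K\<^sup>2) - l)) \<le> 2 * real p * exp (- l) + (real i + 7 * real n)"
        using w by (simp add: E1_def g_def l_def)
      also have "2 * real p * exp (- l) = 2 * real i"
        unfolding l_def using i by (simp add: exp_minus field_simps)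
      finally have b: "(\<Sum>j<p. max 0 ((g j)\<^sup>2 / (4 * K\<^sup>2) - l)) \<le> 3 * real i + 7 * real n" by simp
      have "(\<Sum>j\<in>S. (g j)\<^sup>2) / (4 * K\<^sup>2) \<le> (\<Sum>j\<in>S. l + max 0 ((g j)\<^sup>2 / (4 * K\<^sup>2) - l))"
        unfolding sum_divide_distrib by (intro sum_mono) auto
      also have "\<dots> = real i * l + (\<Sum>j\<in>S. max 0 ((g j)\<^sup>2 / (4 * K\<^sup>2) - l))"
        by (simp add: sum.distrib i_def)
      also have "(\<Sum>j\<in>S. max 0 ((g j)\<^sup>2 / (4 * K\<^sup>2) - l)) \<le> (\<Sum>j<p. max 0 ((g j)\<^sup>2 / (4 * K\<^sup>2) - l))"
        using S by (intro sum_mono2) auto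
      also note b
      also have "real i * l + (3 * real i + 7 * real n) \<le> 3 * (real i * log_rank p i) + 7 * real n"
      proof -
        have "l \<ge> 0" using i by (simp add: l_def)
        then have "real i * l \<ge> 0" by simp
        moreover have "real i * log_rank p i = real i + real i * l" by (simp add: log_rank_def l_def algebra_simps)
        ultimately show ?thesis by linarith
      qed
      finally have "(\<Sum>j\<in>S. (g j)\<^sup>2) / (4 * K\<^sup>2) \<le> 3 * (real i * log_rank p i) + 7 * real n" by simp
      then show "(\<Sum>j\<in>S. (\<Sum>i\<in>R. 1 / (2 * sqrt (real n)) * real_of_int (z i) * X (i, j) \<omega>)\<^sup>2)
           \<le> 4 * K\<^sup>2 * (3 * (real (card S) * log_rank p (card S)) + 7 * real n)"
        using K0 by (simp add: pos_divide_le_eq g_def t_def i_def mult.commute)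
    next
      fix z assume z: "z \<in> lattice_points {..<p} m"
      show "real n / 4 * (\<Sum>j<p. (real_of_int (z j))\<^sup>2) \<le> (\<Sum>i\<in>R. (\<Sum>j<p. X (i, j) \<omega> * real_of_int (z j))\<^sup>2)"
      proof (cases "z \<in> Z2")
        case True
        then have "\<omega> \<notin> E2 z" using w by (auto simp: B2_def)
        then show ?thesis using w n by (auto simp: E2_def)
      next
        case False
        then have "\<not> (\<Sum>j<p. (real_of_int (z j))\<^sup>2) > 0" using z by (simp add: Z2_def)
        moreover have "(\<Sum>j<p. (real_of_int (z j))\<^sup>2) \<ge> 0" by (intro sum_nonneg) auto
        ultimately have "(\<Sum>j<p. (real_of_int (z j))\<^sup>2) = 0" by linarith
        then show ?thesis by (simp only: mult_zero_right) (intro sum_nonneg, auto)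
      qed
    qed
  qed
qed

end

section \<open>Moments of the second-stage statistic\<close>

context subgauss_coords
begin

text \<open>Polarisation of the second moment.\<close>

lemma lin_product_moment:
  assumes "finite A" "A \<subseteq> I"
  shows "(\<integral>\<omega>. (\<Sum>k\<in>A. a k * X k \<omega>) * (\<Sum>k\<in>A. b k * X k \<omega>) \<partial>M) = (\<Sum>k\<in>A. a k * b k)"
proof -
  have eq: "(\<Sum>k\<in>A. a k * X k \<omega>) * (\<Sum>k\<in>A. b k * X k \<omega>)
     = ((\<Sum>k\<in>A. (a k + b k) * X k \<omega>)\<^sup>2 - (\<Sum>k\<in>A. (a k - b k) * X k \<omega>)\<^sup>2) / 4" for \<omega>
    by (simp add: algebra_simps sum.distrib sum_subtractf power2_eq_square)
  have i: "integrable M (\<lambda>\<omega>. (\<Sum>k\<in>A. c k * X k \<omega>)\<^sup>2)" for c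
    by (intro all_moments_integrable all_moments_power finite_measure_axioms lin_all_moments assms(2))
  have "(\<integral>\<omega>. (\<Sum>k\<in>A. a k * X k \<omega>) * (\<Sum>k\<in>A. b k * X k \<omega>) \<partial>M)
     = ((\<Sum>k\<in>A. (a k + b k)\<^sup>2) - (\<Sum>k\<in>A. (a k - b k)\<^sup>2)) / 4"
    unfolding eq using i lin_second_moment[OF assms] by simp
  also have "\<dots> = (\<Sum>k\<in>A. a k * b k)"
    by (simp add: sum_subtractf[symmetric] sum_divide_distrib power2_eq_square algebra_simps)
  finally show ?thesis .
qed

end

lemma integral_double_sum:
  fixes f :: "'k \<Rightarrow> 'l \<Rightarrow> 'a \<Rightarrow> real"
  assumes "\<And>i j. i \<in> A \<Longrightarrow> j \<in> B \<Longrightarrow> integrable M (f i j)"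
  shows "(\<integral>x. (\<Sum>i\<in>A. \<Sum>j\<in>B. f i j x) \<partial>M) = (\<Sum>i\<in>A. \<Sum>j\<in>B. \<integral>x. f i j x \<partial>M)"
proof -
  have "(\<integral>x. (\<Sum>i\<in>A. \<Sum>j\<in>B. f i j x) \<partial>M) = (\<Sum>i\<in>A. \<integral>x. (\<Sum>j\<in>B. f i j x) \<partial>M)"
    using assms by (intro Bochner_Integration.integral_sum Bochner_Integration.integrable_sum) auto
  also have "\<dots> = (\<Sum>i\<in>A. \<Sum>j\<in>B. \<integral>x. f i j x \<partial>M)"
    using assms by (intro sum.cong refl Bochner_Integration.integral_sum) auto
  finally show ?thesis .
qed

lemma sum_distinct_pairs:
  fixes f :: "'k \<Rightarrow> 'k \<Rightarrow> real"
  assumes "finite R"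
  shows "(\<Sum>(k, l)\<in>{(k, l) \<in> R \<times> R. k \<noteq> l}. f k l) = (\<Sum>k\<in>R. \<Sum>l\<in>R - {k}. f k l)"
proof -
  have "{(k, l) \<in> R \<times> R. k \<noteq> l} = Sigma R (\<lambda>k. R - {k})" by auto
  then show ?thesis using assms by (simp add: sum.Sigma)
qed

lemma card_distinct_pairs:
  assumes "finite R"
  shows "card {(k, l) \<in> R \<times> R. k \<noteq> l} = card R * (card R - 1)"
proof -
  have "{(k, l) \<in> R \<times> R. k \<noteq> l} = Sigma R (\<lambda>k. R - {k})" by auto
  then show ?thesis using assms by (simp add: card_SigmaI)
qed

lemma sum_distinct_pairs_affine:
  fixes e :: "'k \<Rightarrow> real"
  assumes "finite R"
  shows "(\<Sum>(k, l)\<in>{(k, l) \<in> R \<times> R. k \<noteq> l}. (e k + d) * (e l + d))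
    = (\<Sum>(k, l)\<in>{(k, l) \<in> R \<times> R. k \<noteq> l}. e k * e l)
      + 2 * d * (real (card R) - 1) * (\<Sum>k\<in>R. e k) + real (card R) * (real (card R) - 1) * d\<^sup>2"
proof -
  \<comment> \<open>An off-diagonal sum is the square of the total minus the diagonal; used for
    \<open>e\<close> and for its translate, this leaves only ordinary sums.\<close>
  have all: "(\<Sum>(k, l)\<in>{(k, l) \<in> R \<times> R. k \<noteq> l}. g k * g l) = (\<Sum>k\<in>R. g k)\<^sup>2 - (\<Sum>k\<in>R. (g k)\<^sup>2)"
    for g :: "'k \<Rightarrow> real"
  proof -
    have "(\<Sum>l\<in>R - {k}. g k * g l) = g k * (\<Sum>l\<in>R. g l) - (g k)\<^sup>2" if "k \<in> R" for k
    proof -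
      have d: "(\<Sum>l\<in>R - {k}. g l) = (\<Sum>l\<in>R. g l) - g k" using assms that by (simp add: sum_diff1)
      show ?thesis unfolding sum_distrib_left[symmetric] d by (simp add: right_diff_distrib power2_eq_square)
    qed
    then have "(\<Sum>(k, l)\<in>{(k, l) \<in> R \<times> R. k \<noteq> l}. g k * g l) = (\<Sum>k\<in>R. g k * (\<Sum>l\<in>R. g l) - (g k)\<^sup>2)"
      unfolding sum_distinct_pairs[OF assms] by (intro sum.cong) auto
    also have "\<dots> = (\<Sum>k\<in>R. g k)\<^sup>2 - (\<Sum>k\<in>R. (g k)\<^sup>2)"
      by (simp add: sum_subtractf sum_distrib_right[symmetric] power2_eq_square)
    finally show ?thesis .
  qed
  have "(\<Sum>k\<in>R. (e k + d)\<^sup>2) = (\<Sum>k\<in>R. (e k)\<^sup>2) + 2 * d * (\<Sum>k\<in>R. e k) + real (card R) * d\<^sup>2"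
  proof -
    have "(\<Sum>k\<in>R. (e k + d)\<^sup>2) = (\<Sum>k\<in>R. (e k)\<^sup>2 + (2 * d) * e k + d\<^sup>2)"
      by (intro sum.cong refl) (simp add: power2_sum mult_ac)
    also have "\<dots> = (\<Sum>k\<in>R. (e k)\<^sup>2) + 2 * d * (\<Sum>k\<in>R. e k) + real (card R) * d\<^sup>2"
      unfolding sum.distrib sum_distrib_left[symmetric] by simp
    finally show ?thesis .
  qed
  moreover have "(\<Sum>k\<in>R. e k + d) = (\<Sum>k\<in>R. e k) + real (card R) * d"
    by (simp add: sum.distrib)
  ultimately show ?thesis unfolding all[of e] all[of "\<lambda>k. e k + d"]
    by (simp add: power2_eq_square algebra_simps)
qed

text \<open>The bias terms cancel: the statistic is unbiased whatever the first-stage vector \<open>t\<close>,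
  and its linear part involves \<open>\<theta>\<close> and not \<open>t\<close>.\<close>

lemma a_stat_decomposition:
  fixes x :: "nat \<Rightarrow> nat \<Rightarrow> real"
  assumes "finite R" "card R \<ge> 2"
    and d: "\<And>k. k \<in> R \<Longrightarrow> fst d (k, j) = x k j" "\<And>k. k \<in> R \<Longrightarrow> residual p t d k = r k"
    and e: "\<And>k. k \<in> R \<Longrightarrow> e k = x k j * r k - (\<theta> j - t j)"
  shows "a_stat R p d t j = (\<theta> j)\<^sup>2 + 2 / real (card R) * (\<theta> j * (\<Sum>k\<in>R. e k))
     + 1 / (real (card R) * (real (card R) - 1)) * (\<Sum>(k, l)\<in>{(k, l) \<in> R \<times> R. k \<noteq> l}. e k * e l)"
proof -
  define n where "n = real (card R)"
  define D where "D = \<theta> j - t j"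
  define S where "S = (\<Sum>k\<in>R. e k)"
  define U where "U = (\<Sum>(k, l)\<in>{(k, l) \<in> R \<times> R. k \<noteq> l}. e k * e l)"
  have n: "n \<ge> 2" using assms(2) by (simp add: n_def)
  have xr: "x k j * r k = e k + D" if "k \<in> R" for k using e[OF that] by (simp add: D_def)
  have 1: "(\<Sum>k\<in>R. fst d (k, j) * residual p t d k) = S + n * D"
  proof -
    have "(\<Sum>k\<in>R. fst d (k, j) * residual p t d k) = (\<Sum>k\<in>R. e k + D)"
      using d xr by (intro sum.cong) auto
    then show ?thesis by (simp add: sum.distrib S_def n_def)
  qed
  have 2: "(\<Sum>(k, l) \<in> {(k, l) \<in> R \<times> R. k \<noteq> l}.
          fst d (k, j) * fst d (l, j) * residual p t d k * residual p t d l)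
     = U + 2 * D * (n - 1) * S + n * (n - 1) * D\<^sup>2"
  proof -
    have "fst d (k, j) * fst d (l, j) * residual p t d k * residual p t d l = (e k + D) * (e l + D)"
      if "k \<in> R" "l \<in> R" for k l
    proof -
      have "fst d (k, j) * fst d (l, j) * residual p t d k * residual p t d l = (x k j * r k) * (x l j * r l)"
        using d that by simp
      then show ?thesis using xr that by simp
    qed
    then have "(\<Sum>(k, l) \<in> {(k, l) \<in> R \<times> R. k \<noteq> l}.
          fst d (k, j) * fst d (l, j) * residual p t d k * residual p t d l)
       = (\<Sum>(k, l) \<in> {(k, l) \<in> R \<times> R. k \<noteq> l}. (e k + D) * (e l + D))"
      by (intro sum.cong) auto
    also have "\<dots> = U + 2 * D * (n - 1) * S + n * (n - 1) * D\<^sup>2"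
      unfolding sum_distinct_pairs_affine[OF assms(1)] U_def S_def n_def ..
    finally show ?thesis .
  qed
  have q: "1 / (n * (n - 1)) * (U + 2 * D * (n - 1) * S + n * (n - 1) * D\<^sup>2)
      = 1 / (n * (n - 1)) * U + 2 * D / n * S + D\<^sup>2"
    using n by (simp add: field_simps)
  have "a_stat R p d t j = (t j)\<^sup>2 + 2 * t j / n * (S + n * D) + (1 / (n * (n - 1)) * U + 2 * D / n * S + D\<^sup>2)"
    unfolding a_stat_def 1 2 n_def[symmetric] q ..
  also have "\<dots> = (t j + D)\<^sup>2 + 2 / n * ((t j + D) * S) + 1 / (n * (n - 1)) * U"
    using n by (simp add: power2_sum add_divide_distrib ring_distribs)
  finally show ?thesis by (simp add: D_def n_def S_def U_def)
qed

section \<open>Residuals and centred products of independent rows\<close>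

locale subgauss_sample = subgauss_coords M Z "(R \<times> {..<p}) <+> R" K
  for M :: "'a measure" and Z :: "nat \<times> nat + nat \<Rightarrow> 'a \<Rightarrow> real" and R :: "nat set" and p :: nat and K :: real +
  assumes fin_R: "finite R"
begin

definition rows :: "nat set \<Rightarrow> (nat \<times> nat + nat) set" where
  "rows T = (T \<times> {..<p}) <+> T"

lemma rows_mono: "S \<subseteq> T \<Longrightarrow> rows S \<subseteq> rows T"
  by (auto simp: rows_def)

lemma rows_subset: "T \<subseteq> R \<Longrightarrow> rows T \<subseteq> (R \<times> {..<p}) <+> R"
  by (auto simp: rows_def)

lemma rows_disjoint: "S \<inter> T = {} \<Longrightarrow> rows S \<inter> rows T = {}"
  by (auto simp: rows_def)

lemma finite_row: "finite (rows {k})"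
  by (simp add: rows_def)

text \<open>The residual of row \<open>k\<close> when the first-stage error is \<Delta> = \<theta> -
  t. With 0 in place of \<sigma> it is the plain linear form of the design row, so one set of moment
  bounds serves both factors of the products below.\<close>

definition res :: "(nat \<Rightarrow> real) \<Rightarrow> real \<Rightarrow> nat \<Rightarrow> 'a \<Rightarrow> real" where
  "res \<Delta> \<sigma> k \<omega> = (\<Sum>j<p. Z (Inl (k, j)) \<omega> * \<Delta> j) + \<sigma> * Z (Inr k) \<omega>"

definition coefs :: "(nat \<Rightarrow> real) \<Rightarrow> real \<Rightarrow> nat \<times> nat + nat \<Rightarrow> real" where
  "coefs w s i = (case i of Inl (k, j) \<Rightarrow> w j | Inr k \<Rightarrow> s)"

lemma sum_row: "(\<Sum>i\<in>rows {k}. f i) = (\<Sum>j<p. f (Inl (k, j))) + f (Inr k)" for f :: "nat \<times> nat + nat \<Rightarrow> real"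
proof -
  have "{k} \<times> {..<p} = Pair k ` {..<p}" by auto
  then show ?thesis by (simp add: rows_def sum.Plus sum.reindex inj_on_def)
qed

lemma res_eq: "res \<Delta> \<sigma> k \<omega> = (\<Sum>i\<in>rows {k}. coefs \<Delta> \<sigma> i * Z i \<omega>)"
  by (simp add: res_def sum_row coefs_def mult.commute)

lemma coefs_square: "(\<Sum>i\<in>rows {k}. (coefs \<Delta> \<sigma> i)\<^sup>2) = (\<Sum>j<p. (\<Delta> j)\<^sup>2) + \<sigma>\<^sup>2"
  by (simp add: sum_row coefs_def)

lemma res_coord_algebra: "res \<Delta> \<sigma> k \<in> borel_measurable (coord_algebra (rows {k}))"
  unfolding res_eq[abs_def] by (rule lin_coord_algebra)

lemma res_all_moments: "k \<in> R \<Longrightarrow> all_moments M (res \<Delta> \<sigma> k)"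
  unfolding res_eq[abs_def] by (rule lin_all_moments[OF rows_subset]) simp

lemma res_second_moment: "k \<in> R \<Longrightarrow> (\<integral>\<omega>. (res \<Delta> \<sigma> k \<omega>)\<^sup>2 \<partial>M) = (\<Sum>j<p. (\<Delta> j)\<^sup>2) + \<sigma>\<^sup>2"
  unfolding res_eq using lin_second_moment[OF finite_row rows_subset, of k] by (simp add: coefs_square)

lemma res_fourth_moment:
  "k \<in> R \<Longrightarrow> (\<integral>\<omega>. (res \<Delta> \<sigma> k \<omega>) ^ 4 \<partial>M) \<le> 64 * K ^ 4 * ((\<Sum>j<p. (\<Delta> j)\<^sup>2) + \<sigma>\<^sup>2)\<^sup>2"
  unfolding res_eq
  using lin_fourth_moment[OF finite_row rows_subset, of k "coefs \<Delta> \<sigma>"] by (simp add: coefs_square)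

lemma res_product_moment:
  "k \<in> R \<Longrightarrow> (\<integral>\<omega>. res w s k \<omega> * res \<Delta> \<sigma> k \<omega> \<partial>M) = (\<Sum>j<p. w j * \<Delta> j) + s * \<sigma>"
  unfolding res_eq using lin_product_moment[OF finite_row rows_subset, of k "coefs w s" "coefs \<Delta> \<sigma>"]
  by (simp add: sum_row coefs_def)

text \<open>As the entries are uncorrelated with unit variance, an entry times its residual has mean
  \<open>\<Delta> j\<close>. This is the fluctuation around it, the \<open>e\<close> of
  \<open>a_stat_decomposition\<close>.\<close>

definition eta :: "(nat \<Rightarrow> real) \<Rightarrow> real \<Rightarrow> nat \<Rightarrow> nat \<Rightarrow> 'a \<Rightarrow> real" where
  "eta \<Delta> \<sigma> k j \<omega> = Z (Inl (k, j)) \<omega> * res \<Delta> \<sigma> k \<omega> - \<Delta> j"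

lemma eta_coord_algebra:
  assumes "j < p"
  shows "eta \<Delta> \<sigma> k j \<in> borel_measurable (coord_algebra (rows {k}))"
proof -
  have [measurable]: "Z (Inl (k, j)) \<in> borel_measurable (coord_algebra (rows {k}))"
    using assms by (intro X_coord_algebra) (auto simp: rows_def)
  have [measurable]: "res \<Delta> \<sigma> k \<in> borel_measurable (coord_algebra (rows {k}))"
    by (rule res_coord_algebra)
  show ?thesis unfolding eta_def by measurable
qed

lemma eta_all_moments:
  assumes "k \<in> R" "j < p"
  shows "all_moments M (eta \<Delta> \<sigma> k j)"
  unfolding eta_def[abs_def]
  using assms
  by (intro all_moments_diff all_moments_mult all_moments_const finite_measure_axioms res_all_moments X_all_moments) auto

lemma sum_eta:
  "(\<Sum>j<p. w j * eta \<Delta> \<sigma> k j \<omega>) = res w 0 k \<omega> * res \<Delta> \<sigma> k \<omega> - (\<Sum>j<p. w j * \<Delta> j)"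
  unfolding eta_def res_def[of w] by (simp add: algebra_simps sum_subtractf sum_distrib_left sum_distrib_right)

lemma eta_mean:
  assumes "k \<in> R" "j < p"
  shows "(\<integral>\<omega>. eta \<Delta> \<sigma> k j \<omega> \<partial>M) = 0"
proof -
  define w where "w i = (if i = j then 1 else (0::real))" for i
  have s: "(\<Sum>i<p. w i * f i) = f j" for f :: "nat \<Rightarrow> real"
  proof -
    have "(\<Sum>i<p. w i * f i) = (\<Sum>i<p. if i = j then f i else 0)"
      by (intro sum.cong) (auto simp: w_def)
    then show ?thesis using assms(2) by (simp add: sum.delta)
  qed
  have "eta \<Delta> \<sigma> k j \<omega> = res w 0 k \<omega> * res \<Delta> \<sigma> k \<omega> - \<Delta> j" for \<omega>
    using sum_eta[of w \<Delta> \<sigma> k \<omega>] by (simp only: s)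
  moreover have "integrable M (\<lambda>\<omega>. res w 0 k \<omega> * res \<Delta> \<sigma> k \<omega>)"
    using assms(1) by (intro all_moments_integrable all_moments_mult res_all_moments)
  ultimately show ?thesis
    using res_product_moment[OF assms(1), of w 0 \<Delta> \<sigma>] by (simp add: s prob_space)
qed

definition var_bound :: "(nat \<Rightarrow> real) \<Rightarrow> real \<Rightarrow> real" where
  "var_bound \<Delta> \<sigma> = 64 * K ^ 4 * ((\<Sum>j<p. (\<Delta> j)\<^sup>2) + \<sigma>\<^sup>2)"

text \<open>The variance is at most the second moment of a product of two linear forms, which splits
  into fourth moments. Holding for every direction \<open>w\<close>, this bounds the covariance
  matrix of the fluctuations in operator norm; a bound on its trace alone would cost the U-statistic
  a factor \<open>p\<close>.\<close>

lemma eta_variance: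
  assumes k: "k \<in> R" and s: "\<sigma> > 0"
  shows "(\<integral>\<omega>. (\<Sum>j<p. w j * eta \<Delta> \<sigma> k j \<omega>)\<^sup>2 \<partial>M) \<le> var_bound \<Delta> \<sigma> * (\<Sum>j<p. (w j)\<^sup>2)"
proof -
  define W where "W = (\<Sum>j<p. (w j)\<^sup>2)"
  define \<rho> where "\<rho> = (\<Sum>j<p. (\<Delta> j)\<^sup>2) + \<sigma>\<^sup>2"
  have rho: "\<rho> > 0" unfolding \<rho>_def using s by (intro add_nonneg_pos sum_nonneg) auto
  have W0: "W \<ge> 0" unfolding W_def by (intro sum_nonneg) auto
  show ?thesis
  proof (cases "W = 0")
    case True
    then have "w j = 0" if "j < p" for j
      using that sum_nonneg_eq_0_iff[of "{..<p}" "\<lambda>j. (w j)\<^sup>2"] by (auto simp: W_def)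
    then show ?thesis by simp
  next
    case False
    then have Wp: "W > 0" using W0 by simp
    define Y where "Y \<omega> = res w 0 k \<omega> * res \<Delta> \<sigma> k \<omega>" for \<omega>
    define c where "c = (\<Sum>j<p. w j * \<Delta> j)"
    have am: "all_moments M Y" unfolding Y_def by (intro all_moments_mult res_all_moments k)
    have iY: "integrable M Y" "integrable M (\<lambda>\<omega>. (Y \<omega>)\<^sup>2)"
      using all_moments_integrable[OF am] all_moments_integrable[OF all_moments_power[OF finite_measure_axioms am]] by auto
    have EY: "(\<integral>\<omega>. Y \<omega> \<partial>M) = c"
      unfolding Y_def using res_product_moment[OF k, of w 0 \<Delta> \<sigma>] by (simp add: c_def)
    have "(\<integral>\<omega>. (\<Sum>j<p. w j * eta \<Delta> \<sigma> k j \<omega>)\<^sup>2 \<partial>M) = (\<integral>\<omega>. (Y \<omega>)\<^sup>2 - 2 * c * Y \<omega> + c\<^sup>2 \<partial>M)"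
      unfolding sum_eta Y_def c_def by (simp add: power2_diff algebra_simps)
    also have "\<dots> = (\<integral>\<omega>. (Y \<omega>)\<^sup>2 \<partial>M) - c\<^sup>2"
      using iY EY by (simp add: prob_space power2_eq_square)
    also have "\<dots> \<le> (\<integral>\<omega>. (Y \<omega>)\<^sup>2 \<partial>M)" by simp
    \<comment> \<open>These weights equalise the bounds on the two fourth-moment terms, with the
      same result as Cauchy-Schwarz; they make sense because \<open>W = 0\<close> was treated
      first.\<close>
    also have "\<dots> \<le> (\<integral>\<omega>. \<rho> / (2 * W) * (res w 0 k \<omega>) ^ 4 + W / (2 * \<rho>) * (res \<Delta> \<sigma> k \<omega>) ^ 4 \<partial>M)"
    proof (rule integral_mono[OF iY(2)])
      show "integrable M (\<lambda>\<omega>. \<rho> / (2 * W) * (res w 0 k \<omega>) ^ 4 + W / (2 * \<rho>) * (res \<Delta> \<sigma> k \<omega>) ^ 4)"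
        by (intro all_moments_integrable all_moments_add all_moments_mult all_moments_const
            all_moments_power finite_measure_axioms res_all_moments k)
      fix \<omega>
      define a b where "a = (res w 0 k \<omega>)\<^sup>2" and "b = (res \<Delta> \<sigma> k \<omega>)\<^sup>2"
      have "0 \<le> (\<rho> * a - W * b)\<^sup>2" by simp
      then have "2 * (\<rho> * W) * (a * b) \<le> \<rho>\<^sup>2 * a\<^sup>2 + W\<^sup>2 * b\<^sup>2"
        by (simp add: power2_eq_square algebra_simps)
      then have "a * b \<le> (\<rho>\<^sup>2 * a\<^sup>2 + W\<^sup>2 * b\<^sup>2) / (2 * (\<rho> * W))"
        using rho Wp by (simp add: pos_le_divide_eq mult.commute)
      also have "\<dots> = \<rho> / (2 * W) * a\<^sup>2 + W / (2 * \<rho>) * b\<^sup>2"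
        using rho Wp by (simp add: field_simps power2_eq_square)
      finally show "(Y \<omega>)\<^sup>2 \<le> \<rho> / (2 * W) * (res w 0 k \<omega>) ^ 4 + W / (2 * \<rho>) * (res \<Delta> \<sigma> k \<omega>) ^ 4"
        by (simp add: a_def b_def Y_def power_mult_distrib flip: power_mult)
    qed
    also have "\<dots> = \<rho> / (2 * W) * (\<integral>\<omega>. (res w 0 k \<omega>) ^ 4 \<partial>M) + W / (2 * \<rho>) * (\<integral>\<omega>. (res \<Delta> \<sigma> k \<omega>) ^ 4 \<partial>M)"
      using all_moments_integrable[OF all_moments_power[OF finite_measure_axioms res_all_moments[OF k]]] by simp
    also have "\<dots> \<le> \<rho> / (2 * W) * (64 * K ^ 4 * W\<^sup>2) + W / (2 * \<rho>) * (64 * K ^ 4 * \<rho>\<^sup>2)"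
      using res_fourth_moment[OF k, of w 0] res_fourth_moment[OF k, of \<Delta> \<sigma>] rho Wp
      by (intro add_mono mult_left_mono) (auto simp: W_def \<rho>_def)
    also have "\<dots> = 64 * K ^ 4 * \<rho> * W" using rho Wp by (simp add: power2_eq_square)
    finally show ?thesis by (simp add: var_bound_def \<rho>_def W_def)
  qed
qed

lemma eta_square_moment:
  assumes "k \<in> R" "j < p" "\<sigma> > 0"
  shows "(\<integral>\<omega>. (eta \<Delta> \<sigma> k j \<omega>)\<^sup>2 \<partial>M) \<le> var_bound \<Delta> \<sigma>"
proof -
  define w where "w i = (if i = j then 1 else (0::real))" for i
  have s: "(\<Sum>i<p. w i * f i) = f j" for f :: "nat \<Rightarrow> real"
  proof -
    have "(\<Sum>i<p. w i * f i) = (\<Sum>i<p. if i = j then f i else 0)"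
      by (intro sum.cong) (auto simp: w_def)
    then show ?thesis using assms(2) by (simp add: sum.delta)
  qed
  have "(\<Sum>i<p. (w i)\<^sup>2) = 1" using s[of w] by (simp add: power2_eq_square w_def)
  then show ?thesis using eta_variance[OF assms(1,3), of w \<Delta>] by (simp add: s)
qed

lemma integral_rows_mult:
  assumes "S \<inter> T = {}" "S \<subseteq> R" "T \<subseteq> R"
    "f \<in> borel_measurable (coord_algebra (rows S))" "g \<in> borel_measurable (coord_algebra (rows T))"
    "all_moments M f" "all_moments M g"
  shows "(\<integral>x. f x * g x \<partial>M) = (\<integral>x. f x \<partial>M) * (\<integral>x. g x \<partial>M)"
  using assms
  by (intro integral_mult_disjoint(1)[of "rows S" "rows T"] rows_disjoint rows_subset all_moments_integrable)

text \<open>The kernel of the U-statistic, summed over all columns: the inner product of the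
  fluctuation vectors of two rows.\<close>

definition etas :: "(nat \<Rightarrow> real) \<Rightarrow> real \<Rightarrow> nat \<times> nat \<Rightarrow> 'a \<Rightarrow> real" where
  "etas \<Delta> \<sigma> kl \<omega> = (\<Sum>j<p. eta \<Delta> \<sigma> (fst kl) j \<omega> * eta \<Delta> \<sigma> (snd kl) j \<omega>)"

lemma etas_coord_algebra:
  assumes "k \<in> T" "l \<in> T"
  shows "etas \<Delta> \<sigma> (k, l) \<in> borel_measurable (coord_algebra (rows T))"
proof -
  have "eta \<Delta> \<sigma> m j \<in> borel_measurable (coord_algebra (rows T))" if "j < p" "m \<in> T" for m j
    using coord_algebra_mono[OF eta_coord_algebra[OF that(1)] rows_mono[of "{m}" T]] that by auto
  then show ?thesis unfolding etas_def[abs_def] using assms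
    by (auto intro!: borel_measurable_sum borel_measurable_times)
qed

lemma etas_all_moments:
  assumes "k \<in> R" "l \<in> R"
  shows "all_moments M (etas \<Delta> \<sigma> (k, l))"
  unfolding etas_def[abs_def] using assms
  by (auto intro!: all_moments_sum all_moments_mult finite_measure_axioms eta_all_moments)

lemma etas_swap: "etas \<Delta> \<sigma> (k, l) \<omega> = etas \<Delta> \<sigma> (l, k) \<omega>"
  by (simp add: etas_def mult.commute)

text \<open>Degeneracy of the kernel: when row \<open>k\<close> occurs only once among the four, its
  fluctuation has mean zero and is independent of the remaining factors.\<close>

lemma etas_uncorrelated:
  assumes "k \<in> R" "l \<in> R" "k' \<in> R" "l' \<in> R" "k \<notin> {l, k', l'}"
  shows "(\<integral>\<omega>. etas \<Delta> \<sigma> (k, l) \<omega> * etas \<Delta> \<sigma> (k', l') \<omega> \<partial>M) = 0"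
proof -
  define g where "g j \<omega> = eta \<Delta> \<sigma> l j \<omega> * etas \<Delta> \<sigma> (k', l') \<omega>" for j \<omega>
  have gm: "all_moments M (g j)" if "j < p" for j
    unfolding g_def[abs_def] using assms that by (intro all_moments_mult eta_all_moments etas_all_moments) auto
  have gc: "g j \<in> borel_measurable (coord_algebra (rows {l, k', l'}))" if "j < p" for j
  proof -
    have 1: "eta \<Delta> \<sigma> l j \<in> borel_measurable (coord_algebra (rows {l, k', l'}))"
      by (rule coord_algebra_mono[OF eta_coord_algebra[OF that] rows_mono]) auto
    have 2: "etas \<Delta> \<sigma> (k', l') \<in> borel_measurable (coord_algebra (rows {l, k', l'}))"
      by (rule etas_coord_algebra) auto
    show ?thesis unfolding g_def[abs_def] using 1 2 by (rule borel_measurable_times)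
  qed
  have "(\<integral>\<omega>. etas \<Delta> \<sigma> (k, l) \<omega> * etas \<Delta> \<sigma> (k', l') \<omega> \<partial>M)
     = (\<integral>\<omega>. (\<Sum>j<p. eta \<Delta> \<sigma> k j \<omega> * g j \<omega>) \<partial>M)"
    by (simp add: etas_def[of _ _ "(k, l)"] g_def sum_distrib_right mult.assoc)
  also have "\<dots> = (\<Sum>j<p. \<integral>\<omega>. eta \<Delta> \<sigma> k j \<omega> * g j \<omega> \<partial>M)"
    using assms(1) gm by (intro Bochner_Integration.integral_sum all_moments_integrable all_moments_mult eta_all_moments) auto
  also have "\<dots> = 0"
  proof (intro sum.neutral ballI)
    fix j assume "j \<in> {..<p}"
    then have j: "j < p" by simp
    have "(\<integral>\<omega>. eta \<Delta> \<sigma> k j \<omega> * g j \<omega> \<partial>M) = (\<integral>\<omega>. eta \<Delta> \<sigma> k j \<omega> \<partial>M) * (\<integral>\<omega>. g j \<omega> \<partial>M)"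
      by (rule integral_rows_mult[of "{k}" "{l, k', l'}"])
         (use assms j in \<open>auto intro: eta_coord_algebra gc eta_all_moments gm\<close>)
    then show "(\<integral>\<omega>. eta \<Delta> \<sigma> k j \<omega> * g j \<omega> \<partial>M) = 0" using eta_mean[OF assms(1) j] by simp
  qed
  finally show ?thesis .
qed

text \<open>Averaging over row \<open>k\<close> leaves a quadratic form in row \<open>l\<close> whose matrix is the
  covariance of row \<open>k\<close>.\<close>

lemma etas_second_moment:
  assumes "k \<in> R" "l \<in> R" "k \<noteq> l" "\<sigma> > 0"
  shows "(\<integral>\<omega>. (etas \<Delta> \<sigma> (k, l) \<omega>)\<^sup>2 \<partial>M) \<le> real p * (var_bound \<Delta> \<sigma>)\<^sup>2"
proof -
  let ?e = "eta \<Delta> \<sigma>"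
  define S where "S i j = (\<integral>\<omega>. ?e k i \<omega> * ?e k j \<omega> \<partial>M)" for i j
  have em: "all_moments M (\<lambda>\<omega>. ?e m i \<omega> * ?e m j \<omega>)" if "m \<in> R" "i < p" "j < p" for m i j
    using that by (intro all_moments_mult eta_all_moments)
  have ec: "(\<lambda>\<omega>. ?e m i \<omega> * ?e m j \<omega>) \<in> borel_measurable (coord_algebra (rows {m}))"
    if "i < p" "j < p" for m i j
    using eta_coord_algebra[OF that(1), of \<Delta> \<sigma> m] eta_coord_algebra[OF that(2), of \<Delta> \<sigma> m]
    by (rule borel_measurable_times)
  have B0: "var_bound \<Delta> \<sigma> \<ge> 0" unfolding var_bound_def by (intro mult_nonneg_nonneg add_nonneg_nonneg sum_nonneg) auto
  have sq: "(\<Sum>i<p. a i)\<^sup>2 = (\<Sum>i<p. \<Sum>j<p. a i * a j)" for a :: "nat \<Rightarrow> real"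
    by (simp add: power2_eq_square sum_product)
  have quad: "(\<Sum>i<p. \<Sum>j<p. S i j * (w i * w j)) = (\<integral>\<omega>. (\<Sum>i<p. w i * ?e k i \<omega>)\<^sup>2 \<partial>M)" for w
  proof -
    have "(\<integral>\<omega>. (\<Sum>i<p. w i * ?e k i \<omega>)\<^sup>2 \<partial>M) = (\<integral>\<omega>. (\<Sum>i<p. \<Sum>j<p. w i * w j * (?e k i \<omega> * ?e k j \<omega>)) \<partial>M)"
      by (simp add: sq mult_ac)
    also have "\<dots> = (\<Sum>i<p. \<Sum>j<p. w i * w j * S i j)"
      using all_moments_integrable[OF em[OF assms(1)]]
      by (subst integral_double_sum) (auto simp: S_def)
    finally show ?thesis by (simp add: mult_ac)
  qed
  have "(\<integral>\<omega>. (etas \<Delta> \<sigma> (k, l) \<omega>)\<^sup>2 \<partial>M)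
     = (\<integral>\<omega>. (\<Sum>i<p. \<Sum>j<p. (?e k i \<omega> * ?e k j \<omega>) * (?e l i \<omega> * ?e l j \<omega>)) \<partial>M)"
    by (simp add: etas_def sq mult_ac)
  also have "\<dots> = (\<Sum>i<p. \<Sum>j<p. \<integral>\<omega>. (?e k i \<omega> * ?e k j \<omega>) * (?e l i \<omega> * ?e l j \<omega>) \<partial>M)"
    using all_moments_integrable[OF all_moments_mult[OF em[OF assms(1)] em[OF assms(2)]]]
    by (intro integral_double_sum) auto
  also have "\<dots> = (\<Sum>i<p. \<Sum>j<p. S i j * (\<integral>\<omega>. ?e l i \<omega> * ?e l j \<omega> \<partial>M))"
  proof (intro sum.cong refl)
    fix i j assume "i \<in> {..<p}" "j \<in> {..<p}"
    then show "(\<integral>\<omega>. (?e k i \<omega> * ?e k j \<omega>) * (?e l i \<omega> * ?e l j \<omega>) \<partial>M) = S i j * (\<integral>\<omega>. ?e l i \<omega> * ?e l j \<omega> \<partial>M)"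
      unfolding S_def using assms
      by (intro integral_rows_mult[of "{k}" "{l}"] ec em) auto
  qed
  also have "\<dots> = (\<integral>\<omega>. (\<Sum>i<p. \<Sum>j<p. S i j * (?e l i \<omega> * ?e l j \<omega>)) \<partial>M)"
    using all_moments_integrable[OF em[OF assms(2)]]
    by (subst integral_double_sum) auto
  \<comment> \<open>The averaged row contributes the operator norm of its covariance and the other
    row a trace, at most \<open>p\<close> times \<open>var_bound\<close>. The result is therefore
    linear in \<open>p\<close>, as the rate requires.\<close>
  also have "\<dots> \<le> (\<integral>\<omega>. var_bound \<Delta> \<sigma> * (\<Sum>i<p. (?e l i \<omega>)\<^sup>2) \<partial>M)"
  proof (rule integral_mono)
    show "integrable M (\<lambda>\<omega>. \<Sum>i<p. \<Sum>j<p. S i j * (?e l i \<omega> * ?e l j \<omega>))"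
      using all_moments_integrable[OF em[OF assms(2)]]
      by (intro Bochner_Integration.integrable_sum integrable_mult_right) auto
    show "integrable M (\<lambda>\<omega>. var_bound \<Delta> \<sigma> * (\<Sum>i<p. (?e l i \<omega>)\<^sup>2))"
      using all_moments_integrable[OF em[OF assms(2)]] by (auto simp: power2_eq_square)
    fix \<omega>
    show "(\<Sum>i<p. \<Sum>j<p. S i j * (?e l i \<omega> * ?e l j \<omega>)) \<le> var_bound \<Delta> \<sigma> * (\<Sum>i<p. (?e l i \<omega>)\<^sup>2)"
      unfolding quad by (rule eta_variance[OF assms(1,4)])
  qed
  also have "\<dots> = var_bound \<Delta> \<sigma> * (\<Sum>i<p. \<integral>\<omega>. (?e l i \<omega>)\<^sup>2 \<partial>M)"
    using all_moments_integrable[OF em[OF assms(2)]]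
    by (simp add: Bochner_Integration.integral_sum power2_eq_square)
  also have "\<dots> \<le> var_bound \<Delta> \<sigma> * (\<Sum>i<p. var_bound \<Delta> \<sigma>)"
    using eta_square_moment[OF assms(2) _ assms(4)] B0 by (intro mult_left_mono sum_mono) auto
  also have "\<dots> = real p * (var_bound \<Delta> \<sigma>)\<^sup>2" by (simp add: power2_eq_square)
  finally show ?thesis .
qed

lemma linear_part_second_moment:
  assumes "\<sigma> > 0"
  shows "(\<integral>\<omega>. (\<Sum>k\<in>R. \<Sum>j<p. w j * eta \<Delta> \<sigma> k j \<omega>)\<^sup>2 \<partial>M)
     \<le> real (card R) * (var_bound \<Delta> \<sigma> * (\<Sum>j<p. (w j)\<^sup>2))"
proof -
  define f where "f k \<omega> = (\<Sum>j<p. w j * eta \<Delta> \<sigma> k j \<omega>)" for k \<omega>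
  have fm: "all_moments M (f k)" if "k \<in> R" for k
    unfolding f_def[abs_def] using that
    by (auto intro!: all_moments_sum all_moments_mult all_moments_const finite_measure_axioms eta_all_moments)
  have fc: "f k \<in> borel_measurable (coord_algebra (rows {k}))" for k
    unfolding f_def[abs_def] using eta_coord_algebra by (auto intro!: borel_measurable_sum borel_measurable_times)
  have f0: "(\<integral>\<omega>. f k \<omega> \<partial>M) = 0" if "k \<in> R" for k
    unfolding f_def using that eta_mean[OF that] all_moments_integrable[OF eta_all_moments[OF that]]
    by (simp add: Bochner_Integration.integral_sum)
  have "(\<integral>\<omega>. (\<Sum>k\<in>R. f k \<omega>)\<^sup>2 \<partial>M) = (\<Sum>k\<in>R. \<integral>\<omega>. (f k \<omega>)\<^sup>2 \<partial>M)"
  proof (rule integral_sum_square[OF fin_R])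
    fix k l assume kl: "k \<in> R" "l \<in> R"
    show "integrable M (\<lambda>x. f k x * f l x)"
      by (intro all_moments_integrable all_moments_mult fm kl)
    assume "k \<noteq> l"
    then have "(\<integral>x. f k x * f l x \<partial>M) = (\<integral>x. f k x \<partial>M) * (\<integral>x. f l x \<partial>M)"
      using kl by (intro integral_rows_mult[of "{k}" "{l}"] fc fm) auto
    then show "(\<integral>x. f k x * f l x \<partial>M) = 0" using f0 kl by simp
  qed
  also have "\<dots> \<le> (\<Sum>k\<in>R. var_bound \<Delta> \<sigma> * (\<Sum>j<p. (w j)\<^sup>2))"
    unfolding f_def using assms by (intro sum_mono eta_variance) auto
  finally show ?thesis by (simp add: f_def)
qed

text \<open>An ordered pair is correlated only with itself and with its reversal, since any other
  pair leaves one of the two rows unmatched; this gives the factor 2.\<close>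

lemma quadratic_part_second_moment:
  assumes "\<sigma> > 0"
  shows "(\<integral>\<omega>. (\<Sum>kl\<in>{(k, l) \<in> R \<times> R. k \<noteq> l}. etas \<Delta> \<sigma> kl \<omega>)\<^sup>2 \<partial>M)
     \<le> real (card R * (card R - 1)) * (2 * (real p * (var_bound \<Delta> \<sigma>)\<^sup>2))"
proof -
  define P where "P = {(k, l) \<in> R \<times> R. k \<noteq> l}"
  have fP: "finite P" unfolding P_def using fin_R by (auto intro: finite_subset[of _ "R \<times> R"])
  let ?H = "etas \<Delta> \<sigma>"
  have Hi: "integrable M (\<lambda>\<omega>. ?H a \<omega> * ?H b \<omega>)" if "a \<in> P" "b \<in> P" for a b
    using that etas_all_moments unfolding P_def
    by (auto intro!: all_moments_integrable all_moments_mult)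
  have main: "(\<Sum>b\<in>P. \<integral>\<omega>. ?H a \<omega> * ?H b \<omega> \<partial>M) \<le> 2 * (real p * (var_bound \<Delta> \<sigma>)\<^sup>2)" if a: "a \<in> P" for a
  proof -
    obtain k l where kl: "a = (k, l)" "k \<in> R" "l \<in> R" "k \<noteq> l" using a by (auto simp: P_def)
    have "(\<Sum>b\<in>P. \<integral>\<omega>. ?H a \<omega> * ?H b \<omega> \<partial>M) = (\<Sum>b\<in>{(k, l), (l, k)}. \<integral>\<omega>. ?H a \<omega> * ?H b \<omega> \<partial>M)"
    proof (rule sum.mono_neutral_right[OF fP])
      show "{(k, l), (l, k)} \<subseteq> P" using kl by (auto simp: P_def)
      show "\<forall>b\<in>P - {(k, l), (l, k)}. (\<integral>\<omega>. ?H a \<omega> * ?H b \<omega> \<partial>M) = 0"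
      proof
        fix b assume b: "b \<in> P - {(k, l), (l, k)}"
        obtain k' l' where b': "b = (k', l')" "k' \<in> R" "l' \<in> R" "k' \<noteq> l'" using b by (auto simp: P_def)
        have "k \<notin> {l, k', l'} \<or> l \<notin> {k, k', l'}" using b b' kl by auto
        then show "(\<integral>\<omega>. ?H a \<omega> * ?H b \<omega> \<partial>M) = 0"
        proof
          assume "k \<notin> {l, k', l'}"
          then show ?thesis unfolding kl(1) b'(1) using kl b' by (intro etas_uncorrelated)
        next
          assume "l \<notin> {k, k', l'}"
          then have "(\<integral>\<omega>. ?H (l, k) \<omega> * ?H b \<omega> \<partial>M) = 0"
            unfolding b'(1) using kl b' by (intro etas_uncorrelated)
          then show ?thesis unfolding kl(1) by (subst etas_swap)
        qed
      qed
    qed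
    also have "\<dots> = 2 * (\<integral>\<omega>. (?H (k, l) \<omega>)\<^sup>2 \<partial>M)"
      using kl etas_swap[of \<Delta> \<sigma> l k] by (simp add: power2_eq_square)
    also have "\<dots> \<le> 2 * (real p * (var_bound \<Delta> \<sigma>)\<^sup>2)"
      using etas_second_moment[OF kl(2-4) assms] by simp
    finally show ?thesis .
  qed
  have "(\<integral>\<omega>. (\<Sum>a\<in>P. ?H a \<omega>)\<^sup>2 \<partial>M) = (\<Sum>a\<in>P. \<Sum>b\<in>P. \<integral>\<omega>. ?H a \<omega> * ?H b \<omega> \<partial>M)"
    unfolding power2_eq_square sum_product using Hi by (intro integral_double_sum)
  also have "\<dots> \<le> (\<Sum>a\<in>P. 2 * (real p * (var_bound \<Delta> \<sigma>)\<^sup>2))" by (intro sum_mono main)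
  also have "\<dots> = real (card P) * (2 * (real p * (var_bound \<Delta> \<sigma>)\<^sup>2))" by simp
  also have "card P = card R * (card R - 1)" unfolding P_def by (rule card_distinct_pairs[OF fin_R])
  finally show ?thesis unfolding P_def .
qed

text \<open>For the threshold in (c): the residual variance concentrates around its mean, which is
  \<sigma>^2 up to the first-stage error.\<close>

lemma res_square_variance:
  "(\<integral>\<omega>. (\<Sum>k\<in>R. (res \<Delta> \<sigma> k \<omega>)\<^sup>2 - ((\<Sum>j<p. (\<Delta> j)\<^sup>2) + \<sigma>\<^sup>2))\<^sup>2 \<partial>M)
     \<le> real (card R) * (64 * K ^ 4 * ((\<Sum>j<p. (\<Delta> j)\<^sup>2) + \<sigma>\<^sup>2)\<^sup>2)"
proof -
  define \<rho> where "\<rho> = (\<Sum>j<p. (\<Delta> j)\<^sup>2) + \<sigma>\<^sup>2"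
  define f where "f k \<omega> = (res \<Delta> \<sigma> k \<omega>)\<^sup>2 - \<rho>" for k \<omega>
  have rm: "all_moments M (\<lambda>\<omega>. (res \<Delta> \<sigma> k \<omega>) ^ m)" if "k \<in> R" for k m
    by (intro all_moments_power finite_measure_axioms res_all_moments that)
  have fm: "all_moments M (f k)" if "k \<in> R" for k
    unfolding f_def[abs_def] by (intro all_moments_diff all_moments_const finite_measure_axioms rm that)
  have fc: "f k \<in> borel_measurable (coord_algebra (rows {k}))" for k
    unfolding f_def[abs_def] using res_coord_algebra[of \<Delta> \<sigma> k]
    by (intro borel_measurable_diff borel_measurable_power borel_measurable_const)
  have f0: "(\<integral>\<omega>. f k \<omega> \<partial>M) = 0" if "k \<in> R" for k
    unfolding f_def using res_second_moment[OF that] all_moments_integrable[OF rm[OF that]]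
    by (simp add: prob_space \<rho>_def)
  have "(\<integral>\<omega>. (\<Sum>k\<in>R. f k \<omega>)\<^sup>2 \<partial>M) = (\<Sum>k\<in>R. \<integral>\<omega>. (f k \<omega>)\<^sup>2 \<partial>M)"
  proof (rule integral_sum_square[OF fin_R])
    fix k l assume kl: "k \<in> R" "l \<in> R"
    show "integrable M (\<lambda>x. f k x * f l x)"
      by (intro all_moments_integrable all_moments_mult fm kl)
    assume "k \<noteq> l"
    then have "(\<integral>x. f k x * f l x \<partial>M) = (\<integral>x. f k x \<partial>M) * (\<integral>x. f l x \<partial>M)"
      using kl by (intro integral_rows_mult[of "{k}" "{l}"] fc fm) auto
    then show "(\<integral>x. f k x * f l x \<partial>M) = 0" using f0 kl by simp
  qed
  also have "\<dots> \<le> (\<Sum>k\<in>R. 64 * K ^ 4 * \<rho>\<^sup>2)"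
  proof (rule sum_mono)
    fix k assume k: "k \<in> R"
    have "(\<integral>\<omega>. (f k \<omega>)\<^sup>2 \<partial>M) = (\<integral>\<omega>. (res \<Delta> \<sigma> k \<omega>) ^ 4 - 2 * \<rho> * (res \<Delta> \<sigma> k \<omega>)\<^sup>2 + \<rho>\<^sup>2 \<partial>M)"
      unfolding f_def by (simp add: power2_diff algebra_simps flip: power_mult)
    also have "\<dots> = (\<integral>\<omega>. (res \<Delta> \<sigma> k \<omega>) ^ 4 \<partial>M) - 2 * \<rho> * (\<integral>\<omega>. (res \<Delta> \<sigma> k \<omega>)\<^sup>2 \<partial>M) + \<rho>\<^sup>2"
      using all_moments_integrable[OF rm[OF k]] by (simp add: prob_space)
    also have "\<dots> = (\<integral>\<omega>. (res \<Delta> \<sigma> k \<omega>) ^ 4 \<partial>M) - \<rho>\<^sup>2"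
      unfolding res_second_moment[OF k] \<rho>_def[symmetric] by (simp add: power2_eq_square)
    also have "\<dots> \<le> 64 * K ^ 4 * \<rho>\<^sup>2"
      using res_fourth_moment[OF k, of \<Delta> \<sigma>] by (simp add: \<rho>_def) (smt (verit) zero_le_power2)
    finally show "(\<integral>\<omega>. (f k \<omega>)\<^sup>2 \<partial>M) \<le> 64 * K ^ 4 * \<rho>\<^sup>2" .
  qed
  finally show ?thesis by (simp add: f_def \<rho>_def)
qed

end

section \<open>Sample splitting\<close>

text \<open>The map along which \<open>obs_law\<close> is a push-forward, with the row set as a
  parameter so that it can also be applied to a subsample.\<close>

definition observe :: "nat set \<Rightarrow> nat \<Rightarrow> (nat \<Rightarrow> real) \<Rightarrow> real \<Rightarrow> sample \<Rightarrow> sample" where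
  "observe R p \<theta> \<sigma> = (\<lambda>(x, e). (x, \<lambda>i\<in>R. (\<Sum>j<p. x (i, j) * \<theta> j) + \<sigma> * e i))"

lemma fst_observe: "fst (observe R p \<theta> \<sigma> w) = fst w"
  by (simp add: observe_def split_beta)

lemma sample_fst_measurable:
  "i \<in> R \<Longrightarrow> j < p \<Longrightarrow> (\<lambda>d. fst d (i, j)) \<in> borel_measurable (sample_space R p)"
  unfolding sample_space_def by measurable

lemma sample_snd_measurable:
  "i \<in> R \<Longrightarrow> (\<lambda>d. snd d i) \<in> borel_measurable (sample_space R p)"
  unfolding sample_space_def by measurable

lemma vec_component_measurable: "j < p \<Longrightarrow> (\<lambda>t. t j) \<in> borel_measurable (vec_space p)"
  unfolding vec_space_def by measurable

lemma observe_measurable: "observe R p \<theta> \<sigma> \<in> sample_space R p \<rightarrow>\<^sub>M sample_space R p"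
proof -
  have "(\<lambda>w. (fst w, \<lambda>i\<in>R. (\<Sum>j<p. fst w (i, j) * \<theta> j) + \<sigma> * snd w i))
     \<in> sample_space R p \<rightarrow>\<^sub>M (\<Pi>\<^sub>M ij\<in>R \<times> {..<p}. borel) \<Otimes>\<^sub>M (\<Pi>\<^sub>M i\<in>R. borel)"
  proof (intro measurable_Pair measurable_restrict)
    show "fst \<in> sample_space R p \<rightarrow>\<^sub>M (\<Pi>\<^sub>M ij\<in>R \<times> {..<p}. borel)"
      unfolding sample_space_def by (rule measurable_fst)
    fix i assume "i \<in> R"
    then show "(\<lambda>w. (\<Sum>j<p. fst w (i, j) * \<theta> j) + \<sigma> * snd w i) \<in> borel_measurable (sample_space R p)"
      by (intro borel_measurable_add borel_measurable_sum borel_measurable_times borel_measurable_const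
          sample_fst_measurable sample_snd_measurable) auto
  qed
  then show ?thesis unfolding observe_def sample_space_def by (simp add: split_beta)
qed

lemma subsample_measurable:
  assumes "R \<subseteq> R'"
  shows "subsample R p \<in> sample_space R' p \<rightarrow>\<^sub>M sample_space R p"
proof -
  have "(\<lambda>w. (\<lambda>ij\<in>R \<times> {..<p}. fst w ij, \<lambda>i\<in>R. snd w i))
     \<in> sample_space R' p \<rightarrow>\<^sub>M (\<Pi>\<^sub>M ij\<in>R \<times> {..<p}. borel) \<Otimes>\<^sub>M (\<Pi>\<^sub>M i\<in>R. borel)"
    using assms by (intro measurable_Pair measurable_restrict)
      (auto intro!: sample_fst_measurable sample_snd_measurable)
  then show ?thesis unfolding subsample_def sample_space_def by (simp add: split_beta restrict_def)
qed

text \<open>Responses are formed row by row, so observing and restricting commute. Both stages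
  thereby become functions of disjoint, hence independent, blocks of design and noise.\<close>

lemma subsample_observe:
  assumes "R \<subseteq> R'"
  shows "subsample R p (observe R' p \<theta> \<sigma> w) = observe R p \<theta> \<sigma> (subsample R p w)"
proof -
  have "(\<lambda>i\<in>R. (\<Sum>j<p. fst w (i, j) * \<theta> j) + \<sigma> * snd w i)
     = (\<lambda>i\<in>R. (\<Sum>j<p. restrict (fst w) (R \<times> {..<p}) (i, j) * \<theta> j) + \<sigma> * restrict (snd w) R i)"
    by (intro restrict_ext) auto
  then show ?thesis using assms
    by (auto simp: subsample_def observe_def split_beta Int_absorb1 fun_eq_iff)
qed

lemma residual_observe:
  "k \<in> R \<Longrightarrow> residual p t (observe R p \<theta> \<sigma> w) k = (\<Sum>j<p. fst w (k, j) * (\<theta> j - t j)) + \<sigma> * snd w k"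
  by (simp add: residual_def observe_def split_beta right_diff_distrib sum_subtractf)

lemma residual_eq: "residual p t d k = snd d k - (\<Sum>j<p. fst d (k, j) * t j)"
  by (simp add: residual_def split_beta)

lemma residual_measurable:
  assumes "\<And>j. j < p \<Longrightarrow> (\<lambda>z. fst (f z) (k, j)) \<in> borel_measurable S"
    "(\<lambda>z. snd (f z) k) \<in> borel_measurable S" "\<And>j. j < p \<Longrightarrow> (\<lambda>z. g z j) \<in> borel_measurable S"
  shows "(\<lambda>z. residual p (g z) (f z) k) \<in> borel_measurable S"
  unfolding residual_eq using assms
  by (intro borel_measurable_diff borel_measurable_sum borel_measurable_times) auto

lemma a_stat_measurable:
  assumes "\<And>k j. k \<in> R \<Longrightarrow> j < p \<Longrightarrow> (\<lambda>z. fst (f z) (k, j)) \<in> borel_measurable S"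
    "\<And>k. k \<in> R \<Longrightarrow> (\<lambda>z. snd (f z) k) \<in> borel_measurable S"
    "\<And>j. j < p \<Longrightarrow> (\<lambda>z. g z j) \<in> borel_measurable S" and j: "j < p"
  shows "(\<lambda>z. a_stat R p (f z) (g z) j) \<in> borel_measurable S"
proof -
  have r: "(\<lambda>z. residual p (g z) (f z) k) \<in> borel_measurable S" if "k \<in> R" for k
    using assms that by (intro residual_measurable) auto
  have "(\<lambda>z. \<Sum>(k, l)\<in>{(k, l) \<in> R \<times> R. k \<noteq> l}. fst (f z) (k, j) * fst (f z) (l, j)
      * residual p (g z) (f z) k * residual p (g z) (f z) l) \<in> borel_measurable S"
    using assms(1)[OF _ j] r by (intro borel_measurable_sum) (auto intro!: borel_measurable_times)
  then show ?thesis unfolding a_stat_def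
    using assms r by (intro borel_measurable_add borel_measurable_power borel_measurable_times
        borel_measurable_divide borel_measurable_const borel_measurable_sum) auto
qed

text \<open>Pulls a claim about observations back to the space of design and noise, where one
  measurable exceptional set is enough whatever the predicate \<open>E\<close>.\<close>

lemma obs_prob_le:
  assumes "A \<in> sets D" and space: "sets D = sets (sample_space {..<N} p)"
    and good: "\<And>w. w \<in> space D \<Longrightarrow> w \<notin> A \<Longrightarrow> \<not> E (observe {..<N} p \<theta> \<sigma> w)"
  shows "obs_prob N p D \<theta> \<sigma> E \<le> emeasure D A"
proof -
  let ?S = "sample_space {..<N} p"
  have law: "obs_law N p D \<theta> \<sigma> = distr D ?S (observe {..<N} p \<theta> \<sigma>)"
    by (simp add: obs_law_def observe_def)
  have meas: "observe {..<N} p \<theta> \<sigma> \<in> D \<rightarrow>\<^sub>M ?S"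
    using observe_measurable measurable_cong_sets[OF space refl] by blast
  show ?thesis
  proof (cases "{d \<in> space ?S. E d} \<in> sets ?S")
    case True
    then have "obs_prob N p D \<theta> \<sigma> E
       = emeasure D (observe {..<N} p \<theta> \<sigma> -` {d \<in> space ?S. E d} \<inter> space D)"
      unfolding obs_prob_def law using meas by (simp add: emeasure_distr)
    also have "\<dots> \<le> emeasure D A"
      using good assms(1) by (intro emeasure_mono) auto
    finally show ?thesis .
  next
    \<comment> \<open>\<open>emeasure\<close> is 0 on sets that are not measurable.\<close>
    case False
    then show ?thesis unfolding obs_prob_def law by (simp add: emeasure_notin_sets)
  qed
qed

text \<open>Chebyshev's inequality conditionally on \<open>X1\<close>: independence makes the joint
  law a product, the inequality is applied to each section over \<open>G\<close>, and Fubini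
  integrates the sections. The second moment is a nonnegative integral, so its finiteness is part of
  the bound.\<close>

lemma (in prob_space) indep_chebyshev:
  fixes F :: "'b \<times> 'b \<Rightarrow> real"
  assumes ind: "indep_var S1 X1 S2 X2" and G: "G \<in> sets S1"
    and F [measurable]: "F \<in> borel_measurable (S1 \<Otimes>\<^sub>M S2)" and t: "t > 0" and V: "V \<ge> 0"
    and bound: "\<And>a. a \<in> G \<Longrightarrow> (\<integral>\<^sup>+x. ennreal ((F (a, X2 x))\<^sup>2) \<partial>M) \<le> ennreal V"
  shows "{x \<in> space M. X1 x \<in> G \<and> t \<le> \<bar>F (X1 x, X2 x)\<bar>} \<in> events"
    and "prob {x \<in> space M. X1 x \<in> G \<and> t \<le> \<bar>F (X1 x, X2 x)\<bar>} \<le> V / t\<^sup>2"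
proof -
  have rv: "random_variable S1 X1" "random_variable S2 X2"
    and eq: "distr M S1 X1 \<Otimes>\<^sub>M distr M S2 X2 = distr M (S1 \<Otimes>\<^sub>M S2) (\<lambda>x. (X1 x, X2 x))"
    using ind unfolding indep_var_distribution_eq by auto
  note rv[measurable]
  define A where "A = {z \<in> space (S1 \<Otimes>\<^sub>M S2). fst z \<in> G \<and> t \<le> \<bar>F z\<bar>}"
  have A: "A \<in> sets (S1 \<Otimes>\<^sub>M S2)" unfolding A_def using G by measurable
  have pre: "{x \<in> space M. X1 x \<in> G \<and> t \<le> \<bar>F (X1 x, X2 x)\<bar>} = (\<lambda>x. (X1 x, X2 x)) -` A \<inter> space M"
    using measurable_space[OF rv(1)] measurable_space[OF rv(2)] by (auto simp: A_def space_pair_measure)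
  have pm: "(\<lambda>x. (X1 x, X2 x)) \<in> M \<rightarrow>\<^sub>M S1 \<Otimes>\<^sub>M S2" by measurable
  show "{x \<in> space M. X1 x \<in> G \<and> t \<le> \<bar>F (X1 x, X2 x)\<bar>} \<in> events"
    unfolding pre using measurable_sets[OF pm A] .
  interpret P1: prob_space "distr M S1 X1" by (rule prob_space_distr[OF rv(1)])
  interpret P2: prob_space "distr M S2 X2" by (rule prob_space_distr[OF rv(2)])
  have "emeasure M {x \<in> space M. X1 x \<in> G \<and> t \<le> \<bar>F (X1 x, X2 x)\<bar>}
     = emeasure (distr M S1 X1 \<Otimes>\<^sub>M distr M S2 X2) A"
    unfolding pre eq using pm A by (simp add: emeasure_distr)
  also have "\<dots> = (\<integral>\<^sup>+a. emeasure (distr M S2 X2) (Pair a -` A) \<partial>distr M S1 X1)"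
    by (rule P2.emeasure_pair_measure_alt) (use A in \<open>simp add: sets_pair_measure_cong[OF sets_distr sets_distr]\<close>)
  also have "\<dots> \<le> (\<integral>\<^sup>+a. ennreal (V / t\<^sup>2) \<partial>distr M S1 X1)"
  proof (rule nn_integral_mono)
    fix a assume "a \<in> space (distr M S1 X1)"
    then have a: "a \<in> space S1" by simp
    show "emeasure (distr M S2 X2) (Pair a -` A) \<le> ennreal (V / t\<^sup>2)"
    proof (cases "a \<in> G")
      case False
      then have "Pair a -` A = {}" by (auto simp: A_def)
      then show ?thesis by simp
    next
      case True
      have Fa [measurable]: "(\<lambda>b. F (a, b)) \<in> borel_measurable S2"
        using a by measurable
      have "Pair a -` A = {b \<in> space S2. t \<le> \<bar>F (a, b)\<bar>}"
        using a True by (auto simp: A_def space_pair_measure)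
      then have "emeasure (distr M S2 X2) (Pair a -` A) = emeasure M {x \<in> space M. t \<le> \<bar>F (a, X2 x)\<bar>}"
        using rv(2) measurable_space[OF rv(2)]
        by (subst emeasure_distr) (auto intro!: arg_cong[of _ _ "emeasure M"])
      also have "{x \<in> space M. t \<le> \<bar>F (a, X2 x)\<bar>} \<subseteq> {x \<in> space M. 1 \<le> ennreal (1 / t\<^sup>2) * ennreal ((F (a, X2 x))\<^sup>2)}"
      proof clarify
        fix x assume "x \<in> space M" "t \<le> \<bar>F (a, X2 x)\<bar>"
        then have "t\<^sup>2 \<le> (F (a, X2 x))\<^sup>2" using t by (metis abs_le_square_iff abs_of_pos)
        then have "1 \<le> 1 / t\<^sup>2 * (F (a, X2 x))\<^sup>2" using t by (simp add: pos_le_divide_eq)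
        then have "ennreal 1 \<le> ennreal (1 / t\<^sup>2 * (F (a, X2 x))\<^sup>2)" by (rule ennreal_leI)
        then show "1 \<le> ennreal (1 / t\<^sup>2) * ennreal ((F (a, X2 x))\<^sup>2)"
          by (subst ennreal_mult[symmetric]) auto
      qed
      then have "emeasure M {x \<in> space M. t \<le> \<bar>F (a, X2 x)\<bar>}
         \<le> emeasure M {x \<in> space M. 1 \<le> ennreal (1 / t\<^sup>2) * ennreal ((F (a, X2 x))\<^sup>2)}"
        by (intro emeasure_mono) measurable
      also have "\<dots> \<le> ennreal (1 / t\<^sup>2) * (\<integral>\<^sup>+x. ennreal ((F (a, X2 x))\<^sup>2) * indicator (space M) x \<partial>M)"
        by (rule nn_integral_Markov_inequality) measurable
      also have "(\<integral>\<^sup>+x. ennreal ((F (a, X2 x))\<^sup>2) * indicator (space M) x \<partial>M) = (\<integral>\<^sup>+x. ennreal ((F (a, X2 x))\<^sup>2) \<partial>M)"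
        by (intro nn_integral_cong) auto
      also have "ennreal (1 / t\<^sup>2) * \<dots> \<le> ennreal (1 / t\<^sup>2) * ennreal V"
        by (intro mult_left_mono bound[OF True]) auto
      also have "\<dots> = ennreal (V / t\<^sup>2)" using V by (subst ennreal_mult[symmetric]) auto
      finally show ?thesis .
    qed
  qed
  also have "\<dots> = ennreal (V / t\<^sup>2)" using P1.emeasure_space_1 by simp
  finally have "ennreal (prob {x \<in> space M. X1 x \<in> G \<and> t \<le> \<bar>F (X1 x, X2 x)\<bar>}) \<le> ennreal (V / t\<^sup>2)"
    by (simp add: emeasure_eq_measure)
  then show "prob {x \<in> space M. X1 x \<in> G \<and> t \<le> \<bar>F (X1 x, X2 x)\<bar>} \<le> V / t\<^sup>2"
    using V by (simp add: ennreal_le_iff)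
qed

section \<open>The two stages under the law of design and noise\<close>

locale subgauss_law =
  fixes N p :: nat and D :: "sample measure" and K :: real
  assumes law: "design_noise_law N p D" and K1: "K \<ge> 1"
    and sg: "k \<in> ({..<N} \<times> {..<p}) <+> {..<N} \<Longrightarrow> subgaussian D K (coord k)"
begin

lemma sets_D: "sets D = sets (sample_space {..<N} p)"
  using law by (simp add: design_noise_law_def)

lemma prob_space_D: "prob_space D"
  using law by (simp add: design_noise_law_def)

sublocale prob_space D by (rule prob_space_D)

lemma indep_D: "indep_vars (\<lambda>_. borel) coord (({..<N} \<times> {..<p}) <+> {..<N})"
  using law by (simp add: design_noise_law_def)

lemma subgauss_sample_rows:
  assumes "R \<subseteq> {..<N}"
  shows "subgauss_sample D coord R p K"
proof -
  have sub: "(R \<times> {..<p}) <+> R \<subseteq> ({..<N} \<times> {..<p}) <+> {..<N}" using assms by auto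
  have mom: "(\<integral>w. coord k w \<partial>D) = 0" "(\<integral>w. (coord k w)\<^sup>2 \<partial>D) = 1"
    if "k \<in> ({..<N} \<times> {..<p}) <+> {..<N}" for k
  proof -
    have "(\<integral>w. coord k w \<partial>D) = 0 \<and> (\<integral>w. (coord k w - (\<integral>v. coord k v \<partial>D))\<^sup>2 \<partial>D) = 1"
      using law that unfolding design_noise_law_def by blast
    then show "(\<integral>w. coord k w \<partial>D) = 0" "(\<integral>w. (coord k w)\<^sup>2 \<partial>D) = 1" by auto
  qed
  show ?thesis
  proof
    show "indep_vars (\<lambda>_. borel) coord ((R \<times> {..<p}) <+> R)"
      by (rule indep_vars_subset[OF indep_D sub])
    show "finite R" using assms finite_subset by blast
  qed (use K1 sg mom sub in blast)+
qed

lemma indep_subsamples: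
  assumes "R1 \<subseteq> {..<N}" "R2 \<subseteq> {..<N}" "R1 \<inter> R2 = {}"
  shows "indep_var (sample_space R1 p) (subsample R1 p) (sample_space R2 p) (subsample R2 p)"
proof -
  define J where "J R = (R \<times> {..<p}) <+> (R :: nat set)" for R
  define g where "g R = (\<lambda>f :: nat \<times> nat + nat \<Rightarrow> real. (\<lambda>ij\<in>R \<times> {..<p}. f (Inl ij), \<lambda>i\<in>R. f (Inr i)))" for R
  have gm: "g R \<in> (\<Pi>\<^sub>M k\<in>J R. borel) \<rightarrow>\<^sub>M sample_space R p" for R
    unfolding g_def sample_space_def
    by (intro measurable_Pair measurable_restrict measurable_component_singleton) (auto simp: J_def)
  have "indep_var (\<Pi>\<^sub>M k\<in>J R1. borel) (\<lambda>w. restrict (\<lambda>k. coord k w) (J R1))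
     (\<Pi>\<^sub>M k\<in>J R2. borel) (\<lambda>w. restrict (\<lambda>k. coord k w) (J R2))"
    by (rule indep_var_restrict[OF indep_D]) (use assms in \<open>auto simp: J_def\<close>)
  from indep_var_compose[OF this gm gm]
  have "indep_var (sample_space R1 p) (g R1 \<circ> (\<lambda>w. restrict (\<lambda>k. coord k w) (J R1)))
     (sample_space R2 p) (g R2 \<circ> (\<lambda>w. restrict (\<lambda>k. coord k w) (J R2)))" .
  moreover have "g R \<circ> (\<lambda>w. restrict (\<lambda>k. coord k w) (J R)) = subsample R p" for R
    by (auto simp: g_def J_def subsample_def fun_eq_iff restrict_def)
  ultimately show ?thesis by simp
qed

text \<open>The first-stage vector is frozen here; the conditional Chebyshev inequality puts the
  estimate in its place. Dividing the deviation of the squared residuals by their common mean makes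
  the second bound the same for every such vector.\<close>

lemma second_stage_moments:
  assumes R: "R \<subseteq> {..<N}" "card R = n" "n \<ge> 2" and s: "\<sigma> > 0"
    and close: "(\<Sum>j<p. (\<theta> j - t j)\<^sup>2) \<le> C\<^sup>2 * \<sigma>\<^sup>2"
  defines "b \<equiv> 64 * K ^ 4 * (C\<^sup>2 + 1)"
  shows "(\<integral>\<^sup>+w. ennreal (((\<Sum>j<p. a_stat R p (observe R p \<theta> \<sigma> (subsample R p w)) t j) - (\<Sum>j<p. (\<theta> j)\<^sup>2))\<^sup>2) \<partial>D)
      \<le> ennreal (8 * b * \<sigma>\<^sup>2 * (\<Sum>j<p. (\<theta> j)\<^sup>2) / n + 8 * real p * (b * \<sigma>\<^sup>2)\<^sup>2 / (real n)\<^sup>2)"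
    and "(\<integral>\<^sup>+w. ennreal (((\<Sum>k\<in>R. (residual p t (observe R p \<theta> \<sigma> (subsample R p w)) k)\<^sup>2
            - ((\<Sum>j<p. (\<theta> j - t j)\<^sup>2) + \<sigma>\<^sup>2)) / ((\<Sum>j<p. (\<theta> j - t j)\<^sup>2) + \<sigma>\<^sup>2))\<^sup>2) \<partial>D)
      \<le> ennreal (64 * K ^ 4 * real n)"
proof -
  interpret S: subgauss_sample D coord R p K by (rule subgauss_sample_rows[OF R(1)])
  define \<Delta> where "\<Delta> j = \<theta> j - t j" for j
  define \<rho> where "\<rho> = (\<Sum>j<p. (\<Delta> j)\<^sup>2) + \<sigma>\<^sup>2"
  define \<Theta> where "\<Theta> = (\<Sum>j<p. (\<theta> j)\<^sup>2)"
  have Th0: "\<Theta> \<ge> 0" unfolding \<Theta>_def by (intro sum_nonneg) auto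
  have rho: "\<rho> > 0" unfolding \<rho>_def using s by (intro add_nonneg_pos sum_nonneg) auto
  have K0: "K > 0" using K1 by simp
  define B where "B = S.var_bound \<Delta> \<sigma>"
  have B: "0 \<le> B" "B \<le> b * \<sigma>\<^sup>2"
  proof -
    show "0 \<le> B" unfolding B_def S.var_bound_def using rho K0 by (simp add: \<rho>_def[symmetric])
    have "64 * K ^ 4 * \<rho> \<le> 64 * K ^ 4 * ((C\<^sup>2 + 1) * \<sigma>\<^sup>2)"
      using close K0 by (intro mult_left_mono) (auto simp: \<rho>_def \<Delta>_def algebra_simps)
    then show "B \<le> b * \<sigma>\<^sup>2" by (simp add: B_def S.var_bound_def \<rho>_def b_def algebra_simps)
  qed
  define P where "P = {(k, l) \<in> R \<times> R. k \<noteq> l}"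
  have res: "residual p t (observe R p \<theta> \<sigma> (subsample R p w)) k = S.res \<Delta> \<sigma> k w" if "k \<in> R" for k w
    using that by (simp add: residual_observe S.res_def \<Delta>_def subsample_def split_beta)
  have fx: "fst (observe R p \<theta> \<sigma> (subsample R p w)) (k, j) = coord (Inl (k, j)) w" if "k \<in> R" "j < p" for k j w
    using that by (simp add: fst_observe subsample_def split_beta)
  define L where "L w = (\<Sum>k\<in>R. \<Sum>j<p. \<theta> j * S.eta \<Delta> \<sigma> k j w)" for w
  define Q where "Q w = (\<Sum>kl\<in>P. S.etas \<Delta> \<sigma> kl w)" for w
  have nn: "real n \<ge> 2" using R by simp
  have dec: "(\<Sum>j<p. a_stat R p (observe R p \<theta> \<sigma> (subsample R p w)) t j) - \<Theta>
     = 2 / n * L w + 1 / (real n * (real n - 1)) * Q w" for w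
  proof -
    have "(\<Sum>j<p. a_stat R p (observe R p \<theta> \<sigma> (subsample R p w)) t j)
       = (\<Sum>j<p. (\<theta> j)\<^sup>2 + 2 / real (card R) * (\<theta> j * (\<Sum>k\<in>R. S.eta \<Delta> \<sigma> k j w))
          + 1 / (real (card R) * (real (card R) - 1))
             * (\<Sum>(k, l)\<in>{(k, l) \<in> R \<times> R. k \<noteq> l}. S.eta \<Delta> \<sigma> k j w * S.eta \<Delta> \<sigma> l j w))"
    proof (intro sum.cong refl)
      fix j assume j: "j \<in> {..<p}"
      show "a_stat R p (observe R p \<theta> \<sigma> (subsample R p w)) t j = (\<theta> j)\<^sup>2
          + 2 / real (card R) * (\<theta> j * (\<Sum>k\<in>R. S.eta \<Delta> \<sigma> k j w))
          + 1 / (real (card R) * (real (card R) - 1))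
             * (\<Sum>(k, l)\<in>{(k, l) \<in> R \<times> R. k \<noteq> l}. S.eta \<Delta> \<sigma> k j w * S.eta \<Delta> \<sigma> l j w)"
        using R j S.fin_R res fx
        by (intro a_stat_decomposition[of R _ j "\<lambda>k j. coord (Inl (k, j)) w" p t "\<lambda>k. S.res \<Delta> \<sigma> k w" "\<lambda>k. S.eta \<Delta> \<sigma> k j w"])
           (auto simp: S.eta_def \<Delta>_def)
    qed
    also have "\<dots> = \<Theta> + 2 / n * (\<Sum>j<p. \<theta> j * (\<Sum>k\<in>R. S.eta \<Delta> \<sigma> k j w))
        + 1 / (real n * (real n - 1)) * (\<Sum>j<p. \<Sum>(k, l)\<in>P. S.eta \<Delta> \<sigma> k j w * S.eta \<Delta> \<sigma> l j w)"
      unfolding sum.distrib sum_distrib_left[symmetric] R(2) P_def \<Theta>_def ..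
    also have "(\<Sum>j<p. \<theta> j * (\<Sum>k\<in>R. S.eta \<Delta> \<sigma> k j w)) = L w"
      unfolding L_def sum_distrib_left by (rule sum.swap)
    also have "(\<Sum>j<p. \<Sum>(k, l)\<in>P. S.eta \<Delta> \<sigma> k j w * S.eta \<Delta> \<sigma> l j w) = Q w"
      unfolding Q_def S.etas_def split_beta by (rule sum.swap)
    finally show ?thesis by simp
  qed
  have mL: "all_moments D L"
    unfolding L_def[abs_def]
    by (intro all_moments_sum all_moments_mult all_moments_const finite_measure_axioms S.eta_all_moments) auto
  have mQ: "all_moments D Q"
    unfolding Q_def[abs_def] P_def
    by (intro all_moments_sum finite_measure_axioms) (auto intro: S.etas_all_moments)
  have i2: "integrable D (\<lambda>w. (L w)\<^sup>2)" "integrable D (\<lambda>w. (Q w)\<^sup>2)"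
    using all_moments_integrable[OF all_moments_power[OF finite_measure_axioms]] mL mQ by auto
  have EL: "(\<integral>w. (L w)\<^sup>2 \<partial>D) \<le> real n * (B * \<Theta>)"
    using S.linear_part_second_moment[OF s, of \<theta> \<Delta>] by (simp add: L_def B_def \<Theta>_def R(2))
  have EQ: "(\<integral>w. (Q w)\<^sup>2 \<partial>D) \<le> real n * (real n - 1) * (2 * (real p * B\<^sup>2))"
    using S.quadratic_part_second_moment[OF s, of \<Delta>] R by (simp add: Q_def P_def B_def of_nat_diff)
  have "(\<integral>\<^sup>+w. ennreal ((2 / n * L w + 1 / (real n * (real n - 1)) * Q w)\<^sup>2) \<partial>D)
     \<le> (\<integral>\<^sup>+w. ennreal (8 / (real n)\<^sup>2 * (L w)\<^sup>2 + 2 / (real n * (real n - 1))\<^sup>2 * (Q w)\<^sup>2) \<partial>D)"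
  proof (intro nn_integral_mono ennreal_leI)
    fix w
    define x y where "x = 2 / n * L w" and "y = 1 / (real n * (real n - 1)) * Q w"
    have "(x + y)\<^sup>2 \<le> 2 * x\<^sup>2 + 2 * y\<^sup>2"
      using sum_squares_bound[of x y] by (simp add: power2_sum)
    then show "(2 / n * L w + 1 / (real n * (real n - 1)) * Q w)\<^sup>2
       \<le> 8 / (real n)\<^sup>2 * (L w)\<^sup>2 + 2 / (real n * (real n - 1))\<^sup>2 * (Q w)\<^sup>2"
      by (simp add: x_def y_def power_mult_distrib power_divide)
  qed
  also have "\<dots> = ennreal (\<integral>w. 8 / (real n)\<^sup>2 * (L w)\<^sup>2 + 2 / (real n * (real n - 1))\<^sup>2 * (Q w)\<^sup>2 \<partial>D)"
    using i2 by (intro nn_integral_eq_integral) auto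
  also have "\<dots> = ennreal (8 / (real n)\<^sup>2 * (\<integral>w. (L w)\<^sup>2 \<partial>D) + 2 / (real n * (real n - 1))\<^sup>2 * (\<integral>w. (Q w)\<^sup>2 \<partial>D))"
    using i2 by simp
  also have "\<dots> \<le> ennreal (8 / (real n)\<^sup>2 * (real n * (B * \<Theta>))
       + 2 / (real n * (real n - 1))\<^sup>2 * (real n * (real n - 1) * (2 * (real p * B\<^sup>2))))"
    by (intro ennreal_leI add_mono mult_left_mono EL EQ) auto
  also have "8 / (real n)\<^sup>2 * (real n * (B * \<Theta>)) = 8 * B * \<Theta> / n"
    using nn by (simp add: power2_eq_square)
  also have "2 / (real n * (real n - 1))\<^sup>2 * (real n * (real n - 1) * (2 * (real p * B\<^sup>2)))
      = 4 * real p * B\<^sup>2 / (real n * (real n - 1))"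
    using nn by (simp add: power2_eq_square)
  also have "ennreal (8 * B * \<Theta> / n + 4 * real p * B\<^sup>2 / (real n * (real n - 1)))
     \<le> ennreal (8 * b * \<sigma>\<^sup>2 * \<Theta> / n + 8 * real p * (b * \<sigma>\<^sup>2)\<^sup>2 / (real n)\<^sup>2)"
  proof (intro ennreal_leI add_mono)
    show "8 * B * \<Theta> / n \<le> 8 * b * \<sigma>\<^sup>2 * \<Theta> / n"
      using B Th0 by (intro divide_right_mono mult_right_mono) auto
    \<comment> \<open>For n >= 2, n (n - 1) is at least n^2 / 2; both variance terms then become
      multiples of the squares of the two parts of the rate.\<close>
    have "4 * real p * B\<^sup>2 / (real n * (real n - 1)) \<le> 4 * real p * (b * \<sigma>\<^sup>2)\<^sup>2 / ((real n)\<^sup>2 / 2)"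
    proof (rule frac_le)
      show "(real n)\<^sup>2 / 2 \<le> real n * (real n - 1)"
      proof -
        have "real n * 2 \<le> real n * real n" using nn by (intro mult_left_mono) auto
        then show ?thesis unfolding power2_eq_square right_diff_distrib by linarith
      qed
      show "4 * real p * B\<^sup>2 \<le> 4 * real p * (b * \<sigma>\<^sup>2)\<^sup>2"
        using B by (intro mult_left_mono power_mono) auto
    qed (use nn in auto)
    then show "4 * real p * B\<^sup>2 / (real n * (real n - 1)) \<le> 8 * real p * (b * \<sigma>\<^sup>2)\<^sup>2 / (real n)\<^sup>2"
      by simp
  qed
  finally show "(\<integral>\<^sup>+w. ennreal (((\<Sum>j<p. a_stat R p (observe R p \<theta> \<sigma> (subsample R p w)) t j) - (\<Sum>j<p. (\<theta> j)\<^sup>2))\<^sup>2) \<partial>D)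
      \<le> ennreal (8 * b * \<sigma>\<^sup>2 * (\<Sum>j<p. (\<theta> j)\<^sup>2) / n + 8 * real p * (b * \<sigma>\<^sup>2)\<^sup>2 / (real n)\<^sup>2)"
    unfolding \<Theta>_def[symmetric] dec .
  define T where "T w = (\<Sum>k\<in>R. (S.res \<Delta> \<sigma> k w)\<^sup>2 - \<rho>)" for w
  have mT: "all_moments D T"
    unfolding T_def[abs_def]
    by (intro all_moments_sum all_moments_diff all_moments_power all_moments_const finite_measure_axioms S.res_all_moments)
  have iT: "integrable D (\<lambda>w. (T w)\<^sup>2)"
    using all_moments_integrable[OF all_moments_power[OF finite_measure_axioms mT]] .
  have "(\<integral>\<^sup>+w. ennreal ((T w / \<rho>)\<^sup>2) \<partial>D) = ennreal (\<integral>w. (T w)\<^sup>2 / \<rho>\<^sup>2 \<partial>D)"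
    unfolding power_divide using iT by (intro nn_integral_eq_integral) auto
  also have "(\<integral>w. (T w)\<^sup>2 / \<rho>\<^sup>2 \<partial>D) \<le> 64 * K ^ 4 * real n"
    using S.res_square_variance[of \<Delta> \<sigma>] rho
    by (simp add: T_def \<rho>_def[symmetric] R(2) pos_divide_le_eq mult_ac)
  finally have "(\<integral>\<^sup>+w. ennreal ((T w / \<rho>)\<^sup>2) \<partial>D) \<le> ennreal (64 * K ^ 4 * real n)" by (simp add: ennreal_leI)
  moreover have "(\<Sum>k\<in>R. (residual p t (observe R p \<theta> \<sigma> (subsample R p w)) k)\<^sup>2 - \<rho>) = T w" for w
    unfolding T_def using res by (intro sum.cong) auto
  ultimately show "(\<integral>\<^sup>+w. ennreal (((\<Sum>k\<in>R. (residual p t (observe R p \<theta> \<sigma> (subsample R p w)) k)\<^sup>2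
            - ((\<Sum>j<p. (\<theta> j - t j)\<^sup>2) + \<sigma>\<^sup>2)) / ((\<Sum>j<p. (\<theta> j - t j)\<^sup>2) + \<sigma>\<^sup>2))\<^sup>2) \<partial>D)
      \<le> ennreal (64 * K ^ 4 * real n)"
    by (simp add: \<rho>_def \<Delta>_def)
qed

end

text \<open>The constant \<open>c1\<close> of \<open>restricted_lower_bound_event\<close>: the
  fraction of the sample size that sparsity times its logarithm may occupy.\<close>

definition rip_scale :: "real \<Rightarrow> real" where
  "rip_scale K = 1 / (512 * K ^ 4 * ((112 * K)\<^sup>2 + 2))"

definition slope_base :: "real \<Rightarrow> real" where
  "slope_base K = 16 * K / sqrt (rip_scale K)"

lemma rip_scale_pos: "K \<ge> 1 \<Longrightarrow> rip_scale K > 0"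
  unfolding rip_scale_def by (intro divide_pos_pos mult_pos_pos add_nonneg_pos) auto

lemma slope_base_pos: "K \<ge> 1 \<Longrightarrow> slope_base K > 0"
  unfolding slope_base_def using rip_scale_pos[of K] by simp

lemmas slope_base_nonneg = less_imp_le[OF slope_base_pos]

context subgauss_law
begin

lemma subgauss_design_rows:
  assumes "R \<subseteq> {..<N}" "p \<ge> 1"
  shows "subgauss_design D (\<lambda>ij. coord (Inl ij)) R p K"
proof -
  interpret S: subgauss_sample D coord R p K by (rule subgauss_sample_rows[OF assms(1)])
  \<comment> \<open>The passage from indices \<open>Inl j\<close> to \<open>j\<close> goes through
    the disjoint singletons \<open>{Inl j}\<close>, followed by evaluation.\<close>
  have "indep_vars (\<lambda>j. \<Pi>\<^sub>M k\<in>{Inl j}. borel) (\<lambda>j \<omega>. restrict (\<lambda>k. coord k \<omega>) {Inl j}) (R \<times> {..<p})"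
    by (rule indep_vars_restrict[OF S.indep]) (auto simp: disjoint_family_on_def)
  then have "indep_vars (\<lambda>j. borel) (\<lambda>j \<omega>. (\<lambda>f. f (Inl j)) (restrict (\<lambda>k. coord k \<omega>) {Inl j})) (R \<times> {..<p})"
    by (rule indep_vars_compose2) (rule measurable_component_singleton, simp)
  moreover have eq: "(\<lambda>ij. coord (Inl ij)) = (\<lambda>j \<omega>. (\<lambda>f. f (Inl j)) (restrict (\<lambda>k. coord k \<omega>) {Inl j}))"
    by (auto simp: fun_eq_iff)
  ultimately have ind: "indep_vars (\<lambda>_. borel) (\<lambda>ij. coord (Inl ij)) (R \<times> {..<p})"
    by (simp only: eq)
  show ?thesis
  proof
    show "indep_vars (\<lambda>_. borel) (\<lambda>ij. coord (Inl ij)) (R \<times> {..<p})" by (rule ind)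
  qed (use K1 S.subgauss S.mean_zero S.unit_variance S.fin_R assms(2) in blast)+
qed

text \<open>Two exceptional sets of probability at most \<delta>/4 each: one for the design,
  exponentially small in \<open>n\<close>, and one for the noise, from Markov's inequality at level
  4 n / \<delta>. The latter is why the first-stage constant grows like 1 / sqrt \<delta>.\<close>

lemma first_stage_event:
  assumes R: "R \<subseteq> {..<N}" "card R = n" "n \<ge> 1" and p: "p \<ge> 1" and d: "0 < \<delta>"
    and small: "log_rank p 1 \<le> rip_scale K * real n"
    and n: "2 * exp (- real n / (512 * K ^ 4)) \<le> \<delta> / 4"
  obtains B where "B \<in> events" "prob B \<le> \<delta> / 2"
    "\<And>w u r. w \<in> space D - B \<Longrightarrow> ranking p u r \<Longrightarrow>
       L2_set (\<lambda>i. \<Sum>j<p. fst w (i, j) * u j) R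
        \<ge> sqrt (real n) / 4 * L2_set u {..<p} - 16 * K / sqrt (rip_scale K) * (\<Sum>j<p. sqrt (log_rank p (r j)) * \<bar>u j\<bar>)"
    "\<And>w. w \<in> space D - B \<Longrightarrow> L2_set (snd w) R \<le> 2 * sqrt (real n / \<delta>)"
proof -
  interpret S: subgauss_sample D coord R p K by (rule subgauss_sample_rows[OF R(1)])
  interpret X: subgauss_design D "\<lambda>ij. coord (Inl ij)" R p K by (rule subgauss_design_rows[OF R(1) p])
  define f where "f w = (\<Sum>i\<in>R. (coord (Inr i) w)\<^sup>2)" for w
  have i2: "integrable D (\<lambda>w. (coord (Inr i) w)\<^sup>2)" if "i \<in> R" for i
    using that by (intro all_moments_integrable all_moments_power finite_measure_axioms S.X_all_moments) auto
  have Ef: "(\<integral>w. f w \<partial>D) = real n"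
  proof -
    have u: "(\<integral>w. (coord (Inr i) w)\<^sup>2 \<partial>D) = 1" if "i \<in> R" for i
      using S.unit_variance[of "Inr i"] that by blast
    have "(\<integral>w. f w \<partial>D) = (\<Sum>i\<in>R. \<integral>w. (coord (Inr i) w)\<^sup>2 \<partial>D)"
      unfolding f_def using i2 by (rule Bochner_Integration.integral_sum)
    also have "\<dots> = (\<Sum>i\<in>R. 1)" using u by (rule sum.cong[OF refl])
    finally show ?thesis using R(2) by simp
  qed
  define B2 where "B2 = {w \<in> space D. 4 * real n / \<delta> \<le> f w}"
  have fi: "integrable D f" unfolding f_def[abs_def] using i2 by (intro Bochner_Integration.integrable_sum)
  have B2e: "B2 \<in> events" unfolding B2_def using borel_measurable_integrable[OF fi] by measurable
  have B2p: "prob B2 \<le> \<delta> / 4"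
    unfolding B2_def
  proof (rule markov_inequality[OF fi])
    show "0 \<le> f w" for w unfolding f_def by (intro sum_nonneg) auto
    show "0 < 4 * real n / \<delta>" using R(3) d by simp
    show "(\<integral>w. f w \<partial>D) \<le> \<delta> / 4 * (4 * real n / \<delta>)" using Ef d by simp
  qed
  show ?thesis
  proof (rule X.restricted_lower_bound_event[OF R(2)[symmetric] R(3) rip_scale_def small])
    fix B1 assume B1: "B1 \<in> events" "prob B1 \<le> 2 * exp (- real n / (512 * K ^ 4))"
    "\<And>\<omega> u r. \<omega> \<in> space D - B1 \<Longrightarrow> ranking p u r \<Longrightarrow>
       L2_set (\<lambda>i. \<Sum>j<p. coord (Inl (i, j)) \<omega> * u j) R
        \<ge> sqrt (real n) / 4 * L2_set u {..<p} - 16 * K / sqrt (rip_scale K) * (\<Sum>j<p. sqrt (log_rank p (r j)) * \<bar>u j\<bar>)"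
    show ?thesis
  proof (rule that[of "B1 \<union> B2"])
    show "B1 \<union> B2 \<in> events" using B1(1) B2e by auto
    show "prob (B1 \<union> B2) \<le> \<delta> / 2"
      using measure_Un_le[OF B1(1) B2e] B1(2) B2p n by linarith
    show "L2_set (\<lambda>i. \<Sum>j<p. fst w (i, j) * u j) R
        \<ge> sqrt (real n) / 4 * L2_set u {..<p} - 16 * K / sqrt (rip_scale K) * (\<Sum>j<p. sqrt (log_rank p (r j)) * \<bar>u j\<bar>)"
      if "w \<in> space D - (B1 \<union> B2)" "ranking p u r" for w u r
      using B1(3)[of w u r] that by simp
    show "L2_set (snd w) R \<le> 2 * sqrt (real n / \<delta>)" if "w \<in> space D - (B1 \<union> B2)" for w
    proof -
      have "(\<Sum>i\<in>R. (snd w i)\<^sup>2) \<le> 4 * (real n / \<delta>)" using that by (auto simp: B2_def f_def not_le)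
      then have "L2_set (snd w) R \<le> sqrt (4 * (real n / \<delta>))" unfolding L2_set_def by (rule real_sqrt_le_mono)
      then show ?thesis unfolding real_sqrt_mult by simp
    qed
  qed
  qed
qed

text \<open>Two Chebyshev events of probability at most \<delta>/4 are added to the exceptional set
  of the first stage, one for the statistic and one for the residual variance.\<close>

lemma second_stage_event:
  fixes C c :: real
  assumes R: "R1 \<subseteq> {..<N}" "R2 \<subseteq> {..<N}" "R1 \<inter> R2 = {}" "card R2 = n" "n \<ge> 2" "N = 2 * n"
    and p: "p \<ge> 1" and s: "\<sigma> > 0" and th: "th \<in> sample_space R1 p \<rightarrow>\<^sub>M vec_space p"
    and B: "B \<in> events"
      "\<And>w. w \<in> space D - B \<Longrightarrow> (\<Sum>j<p. (\<theta> j - th (observe R1 p \<theta> \<sigma> (subsample R1 p w)) j)\<^sup>2) \<le> C\<^sup>2 * \<sigma>\<^sup>2"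
    and c: "c > 0" "(32 * (64 * K ^ 4 * (C\<^sup>2 + 1))\<^sup>2 + 16 * (64 * K ^ 4 * (C\<^sup>2 + 1))) / c\<^sup>2 \<le> \<delta> / 4"
    and n: "256 * K ^ 4 / real n \<le> \<delta> / 4"
  obtains A where "A \<in> events" "prob A \<le> prob B + \<delta> / 2"
    "\<And>w. w \<in> space D - A \<Longrightarrow>
      \<bar>Q_HD R1 R2 p th (observe {..<N} p \<theta> \<sigma> w) - (l2_norm p \<theta>)\<^sup>2\<bar>
        \<le> c * (\<sigma>\<^sup>2 * (sqrt (real p) / real N) + \<sigma> * (l2_norm p \<theta> / sqrt (real N)))"
    "\<And>w d. w \<in> space D - A \<Longrightarrow> d = observe {..<N} p \<theta> \<sigma> w \<Longrightarrow>
      1 / 2 * \<sigma>\<^sup>2 \<le> (\<Sum>k\<in>R2. (residual p (th (subsample R1 p d)) (subsample R2 p d) k)\<^sup>2) / n \<and>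
      (\<Sum>k\<in>R2. (residual p (th (subsample R1 p d)) (subsample R2 p d) k)\<^sup>2) / n \<le> 3 / 2 * (C\<^sup>2 + 1) * \<sigma>\<^sup>2"
proof -
  define b where "b = 64 * K ^ 4 * (C\<^sup>2 + 1)"
  define S1 where "S1 = sample_space R1 p"
  define S2 where "S2 = sample_space R2 p"
  define T where "T a = th (observe R1 p \<theta> \<sigma> a)" for a
  have Tm: "T \<in> S1 \<rightarrow>\<^sub>M vec_space p"
    unfolding T_def S1_def using measurable_compose[OF observe_measurable th] .
  have Tc: "(\<lambda>a. T a j) \<in> borel_measurable S1" if "j < p" for j
    using measurable_compose[OF Tm vec_component_measurable[OF that]] .
  define \<rho> where "\<rho> a = (\<Sum>j<p. (\<theta> j - T a j)\<^sup>2) + \<sigma>\<^sup>2" for a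
  have rho: "\<rho> a \<ge> \<sigma>\<^sup>2" "\<rho> a > 0" for a
  proof -
    have "(\<Sum>j<p. (\<theta> j - T a j)\<^sup>2) \<ge> 0" by (intro sum_nonneg) auto
    then show "\<rho> a \<ge> \<sigma>\<^sup>2" by (simp add: \<rho>_def)
    then show "\<rho> a > 0" using s by (smt (verit) zero_less_power)
  qed
  \<comment> \<open>Closeness is expressed on the space of first subsamples, as conditioning
    requires; \<open>B\<close> lives on the full space and only ensures membership in
    \<open>G\<close>.\<close>
  define G where "G = {a \<in> space S1. (\<Sum>j<p. (\<theta> j - T a j)\<^sup>2) \<le> C\<^sup>2 * \<sigma>\<^sup>2}"
  have rm: "(\<lambda>a. \<Sum>j<p. (\<theta> j - T a j)\<^sup>2) \<in> borel_measurable S1"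
    using Tc by (intro borel_measurable_sum borel_measurable_power borel_measurable_diff) auto
  have G: "G \<in> sets S1" unfolding G_def using rm by measurable
  define \<Theta> where "\<Theta> = (\<Sum>j<p. (\<theta> j)\<^sup>2)"
  have Th: "(l2_norm p \<theta>)\<^sup>2 = \<Theta>" "l2_norm p \<theta> \<ge> 0" "\<Theta> \<ge> 0"
    by (auto simp: l2_norm_def L2_set_power2 \<Theta>_def L2_set_nonneg sum_nonneg)
  define F1 where "F1 z = (\<Sum>j<p. a_stat R2 p (observe R2 p \<theta> \<sigma> (snd z)) (T (fst z)) j) - \<Theta>" for z :: "sample \<times> sample"
  define F2 where "F2 z = (\<Sum>k\<in>R2. (residual p (T (fst z)) (observe R2 p \<theta> \<sigma> (snd z)) k)\<^sup>2 - \<rho> (fst z)) / \<rho> (fst z)"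
    for z :: "sample \<times> sample"
  have m1: "(\<lambda>z. T (fst z) j) \<in> borel_measurable (S1 \<Otimes>\<^sub>M S2)" if "j < p" for j
    using measurable_compose[OF measurable_fst Tc[OF that]] .
  have ob: "(\<lambda>z. observe R2 p \<theta> \<sigma> (snd z)) \<in> S1 \<Otimes>\<^sub>M S2 \<rightarrow>\<^sub>M sample_space R2 p"
    using measurable_compose[OF measurable_snd observe_measurable] unfolding S2_def .
  have m2: "(\<lambda>z. fst (observe R2 p \<theta> \<sigma> (snd z)) (k, j)) \<in> borel_measurable (S1 \<Otimes>\<^sub>M S2)" if "k \<in> R2" "j < p" for k j
    using measurable_compose[OF ob sample_fst_measurable[OF that]] .
  have m3: "(\<lambda>z. snd (observe R2 p \<theta> \<sigma> (snd z)) k) \<in> borel_measurable (S1 \<Otimes>\<^sub>M S2)" if "k \<in> R2" for k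
    using measurable_compose[OF ob sample_snd_measurable[OF that]] .
  have F1m: "F1 \<in> borel_measurable (S1 \<Otimes>\<^sub>M S2)"
    unfolding F1_def[abs_def] using m1 m2 m3
    by (intro borel_measurable_diff borel_measurable_sum borel_measurable_const a_stat_measurable) auto
  have rm2: "(\<lambda>z. \<rho> (fst z)) \<in> borel_measurable (S1 \<Otimes>\<^sub>M S2)"
    unfolding \<rho>_def using measurable_compose[OF measurable_fst rm] by (intro borel_measurable_add) auto
  have F2m: "F2 \<in> borel_measurable (S1 \<Otimes>\<^sub>M S2)"
    unfolding F2_def[abs_def] using m1 m2 m3 rm2
    by (intro borel_measurable_divide borel_measurable_sum borel_measurable_diff borel_measurable_power residual_measurable) auto
  define t1 where "t1 = c * (\<sigma>\<^sup>2 * (sqrt (real p) / real N) + \<sigma> * (l2_norm p \<theta> / sqrt (real N)))"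
  have nn: "real n \<ge> 2" and NN: "real N = 2 * real n" using R by auto
  have t1: "t1 > 0"
    unfolding t1_def using c s p NN nn Th by (intro mult_pos_pos add_pos_nonneg) auto
  define V1 where "V1 = 8 * b * \<sigma>\<^sup>2 * \<Theta> / n + 8 * real p * (b * \<sigma>\<^sup>2)\<^sup>2 / (real n)\<^sup>2"
  have b0: "b \<ge> 0" unfolding b_def using K1 by (intro mult_nonneg_nonneg add_nonneg_nonneg) auto
  have V1: "V1 \<ge> 0" unfolding V1_def using b0 Th by (intro add_nonneg_nonneg divide_nonneg_nonneg mult_nonneg_nonneg) auto
  \<comment> \<open>As N = 2 n, the variance bound is a combination of the squares of the two parts
    \<open>x\<close> and \<open>y\<close> of the rate. Its ratio to the squared deviation is thus
    bounded independently of \<sigma>, \<theta>, \<open>p\<close> and \<open>n\<close>.\<close>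
  have ratio1: "V1 / t1\<^sup>2 \<le> \<delta> / 4"
  proof -
    define x where "x = \<sigma>\<^sup>2 * (sqrt (real p) / real N)"
    define y where "y = \<sigma> * (l2_norm p \<theta> / sqrt (real N))"
    have xy: "x \<ge> 0" "y \<ge> 0" using s Th by (auto simp: x_def y_def)
    have x2: "x\<^sup>2 = (\<sigma>\<^sup>2)\<^sup>2 * real p / (4 * (real n)\<^sup>2)"
      by (simp add: x_def power_mult_distrib power_divide NN)
    have y2: "y\<^sup>2 = \<sigma>\<^sup>2 * \<Theta> / (2 * real n)"
      by (simp add: y_def power_mult_distrib power_divide NN Th)
    have "V1 = 16 * b * y\<^sup>2 + 32 * b\<^sup>2 * x\<^sup>2"
      unfolding V1_def x2 y2 by (simp add: power_mult_distrib mult_ac)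
    also have "\<dots> \<le> (32 * b\<^sup>2 + 16 * b) * y\<^sup>2 + (32 * b\<^sup>2 + 16 * b) * x\<^sup>2"
      using b0 by (intro add_mono mult_right_mono) auto
    also have "\<dots> = (32 * b\<^sup>2 + 16 * b) * (x\<^sup>2 + y\<^sup>2)" by (simp add: algebra_simps)
    also have "\<dots> \<le> (32 * b\<^sup>2 + 16 * b) * (x + y)\<^sup>2"
      using b0 xy by (intro mult_left_mono) (auto simp: power2_sum)
    finally have "V1 \<le> (32 * b\<^sup>2 + 16 * b) * (x + y)\<^sup>2" .
    then have "V1 / t1\<^sup>2 \<le> (32 * b\<^sup>2 + 16 * b) * (x + y)\<^sup>2 / t1\<^sup>2" by (rule divide_right_mono) simp
    also have "\<dots> = (32 * b\<^sup>2 + 16 * b) / c\<^sup>2"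
    proof -
      have t1_eq: "t1 = c * (x + y)" by (simp only: t1_def x_def y_def)
      have "x + y \<noteq> 0" using t1 by (auto simp: t1_eq)
      then show ?thesis unfolding t1_eq power_mult_distrib by simp
    qed
    also have "\<dots> \<le> \<delta> / 4" using c(2) by (simp add: b_def)
    finally show ?thesis .
  qed
  note ind = indep_subsamples[OF R(1-3), folded S1_def S2_def]
  define A1 where "A1 = {w \<in> space D. subsample R1 p w \<in> G \<and> t1 \<le> \<bar>F1 (subsample R1 p w, subsample R2 p w)\<bar>}"
  \<comment> \<open>A deviation below n/2 in units of the mean \<rho> confines the residual variance
    to the interval from \<rho>/2 to 3\<rho>/2.\<close>
  define A2 where "A2 = {w \<in> space D. subsample R1 p w \<in> G \<and> real n / 2 \<le> \<bar>F2 (subsample R1 p w, subsample R2 p w)\<bar>}"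
  have A1: "A1 \<in> events" "prob A1 \<le> V1 / t1\<^sup>2"
  proof -
    have bd: "(\<integral>\<^sup>+w. ennreal ((F1 (a, subsample R2 p w))\<^sup>2) \<partial>D) \<le> ennreal V1" if "a \<in> G" for a
    proof -
      have "(\<Sum>j<p. (\<theta> j - T a j)\<^sup>2) \<le> C\<^sup>2 * \<sigma>\<^sup>2" using that by (simp add: G_def)
      from second_stage_moments(1)[OF R(2,4,5) s this] show ?thesis
        by (simp add: F1_def V1_def b_def \<Theta>_def)
    qed
    show "A1 \<in> events" unfolding A1_def by (rule indep_chebyshev(1)[OF ind G F1m t1 V1 bd])
    show "prob A1 \<le> V1 / t1\<^sup>2" unfolding A1_def by (rule indep_chebyshev(2)[OF ind G F1m t1 V1 bd])
  qed
  have A2: "A2 \<in> events" "prob A2 \<le> 64 * K ^ 4 * real n / (real n / 2)\<^sup>2"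
  proof -
    have n2: "real n / 2 > 0" using nn by simp
    have V2: "64 * K ^ 4 * real n \<ge> 0" using K1 by simp
    have bd: "(\<integral>\<^sup>+w. ennreal ((F2 (a, subsample R2 p w))\<^sup>2) \<partial>D) \<le> ennreal (64 * K ^ 4 * real n)" if "a \<in> G" for a
    proof -
      have "(\<Sum>j<p. (\<theta> j - T a j)\<^sup>2) \<le> C\<^sup>2 * \<sigma>\<^sup>2" using that by (simp add: G_def)
      from second_stage_moments(2)[OF R(2,4,5) s this] show ?thesis by (simp add: F2_def \<rho>_def)
    qed
    show "A2 \<in> events" unfolding A2_def by (rule indep_chebyshev(1)[OF ind G F2m n2 V2 bd])
    show "prob A2 \<le> 64 * K ^ 4 * real n / (real n / 2)\<^sup>2"
      unfolding A2_def by (rule indep_chebyshev(2)[OF ind G F2m n2 V2 bd])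
  qed
  have ratio2: "64 * K ^ 4 * real n / (real n / 2)\<^sup>2 \<le> \<delta> / 4"
    using n nn by (simp add: power_divide power2_eq_square)
  show ?thesis
  proof (rule that[of "B \<union> (A1 \<union> A2)"])
    show "B \<union> (A1 \<union> A2) \<in> events" using A1 A2 B by auto
    have "prob (B \<union> (A1 \<union> A2)) \<le> prob B + prob (A1 \<union> A2)" using A1 A2 B by (intro measure_Un_le) auto
    moreover have "prob (A1 \<union> A2) \<le> prob A1 + prob A2" using A1 A2 by (intro measure_Un_le) auto
    ultimately show "prob (B \<union> (A1 \<union> A2)) \<le> prob B + \<delta> / 2" using A1 A2 ratio1 ratio2 by linarith
  next
    fix w assume w: "w \<in> space D - (B \<union> (A1 \<union> A2))"
    have "subsample R1 p w \<in> space S1"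
      using w measurable_space[OF subsample_measurable[OF R(1)]] sets_eq_imp_space_eq[OF sets_D] by (auto simp: S1_def)
    moreover have "(\<Sum>j<p. (\<theta> j - T (subsample R1 p w) j)\<^sup>2) \<le> C\<^sup>2 * \<sigma>\<^sup>2"
      using B(2)[of w] w by (simp add: T_def)
    ultimately have wG: "subsample R1 p w \<in> G" by (simp add: G_def)
    have "\<bar>F1 (subsample R1 p w, subsample R2 p w)\<bar> < t1" using w wG by (auto simp: A1_def not_le)
    then show "\<bar>Q_HD R1 R2 p th (observe {..<N} p \<theta> \<sigma> w) - (l2_norm p \<theta>)\<^sup>2\<bar>
        \<le> c * (\<sigma>\<^sup>2 * (sqrt (real p) / real N) + \<sigma> * (l2_norm p \<theta> / sqrt (real N)))"
      by (simp add: Q_HD_def subsample_observe[OF R(1)] subsample_observe[OF R(2)] F1_def T_def Th t1_def)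
    fix d assume d: "d = observe {..<N} p \<theta> \<sigma> w"
    define a where "a = subsample R1 p w"
    define X where "X = (\<Sum>k\<in>R2. (residual p (th (subsample R1 p d)) (subsample R2 p d) k)\<^sup>2)"
    have "\<bar>F2 (subsample R1 p w, subsample R2 p w)\<bar> < real n / 2" using w wG by (auto simp: A2_def not_le)
    then have "\<bar>(X - real n * \<rho> a) / \<rho> a\<bar> < real n / 2"
      by (simp add: F2_def d X_def subsample_observe[OF R(1)] subsample_observe[OF R(2)] T_def a_def sum_subtractf R(4))
    then have "\<bar>X - real n * \<rho> a\<bar> < real n / 2 * \<rho> a"
      using rho(2)[of a] by (simp add: abs_divide pos_divide_less_eq)
    then have "\<bar>X - real n * \<rho> a\<bar> < 1 / 2 * (real n * \<rho> a)" by simp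
    then have X: "1 / 2 * (real n * \<rho> a) \<le> X" "X \<le> 3 / 2 * (real n * \<rho> a)" by linarith+
    have "\<rho> a \<le> (C\<^sup>2 + 1) * \<sigma>\<^sup>2" using wG by (simp add: G_def \<rho>_def a_def algebra_simps)
    then have r: "3 / 2 * \<rho> a \<le> 3 / 2 * (C\<^sup>2 + 1) * \<sigma>\<^sup>2" unfolding mult.assoc by (intro mult_left_mono) auto
    have "1 / 2 * \<rho> a \<le> X / n" "X / n \<le> 3 / 2 * \<rho> a"
      using X nn by (auto simp: pos_le_divide_eq pos_divide_le_eq mult_ac)
    then show "1 / 2 * \<sigma>\<^sup>2 \<le> (\<Sum>k\<in>R2. (residual p (th (subsample R1 p d)) (subsample R2 p d) k)\<^sup>2) / n \<and>
      (\<Sum>k\<in>R2. (residual p (th (subsample R1 p d)) (subsample R2 p d) k)\<^sup>2) / n \<le> 3 / 2 * (C\<^sup>2 + 1) * \<sigma>\<^sup>2"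
      using rho(1)[of a] r unfolding X_def[symmetric] by linarith
  qed
qed

end

section \<open>First-stage estimators\<close>

lemma sqrt_log_rank_sum_le:
  assumes rk: "ranking p u r" and n: "n \<ge> 1" and b: "b \<ge> 0"
    and sn: "slope_norm (sqrt 2 * b) n p u = (\<Sum>j<p. slope_weight (sqrt 2 * b) n p (r j) * \<bar>u j\<bar>)"
  shows "b * (\<Sum>j<p. sqrt (log_rank p (r j)) * \<bar>u j\<bar>) \<le> sqrt (real n) * slope_norm (sqrt 2 * b) n p u"
proof -
  have "b * (sqrt (log_rank p (r j)) * \<bar>u j\<bar>) \<le> sqrt (real n) * (slope_weight (sqrt 2 * b) n p (r j) * \<bar>u j\<bar>)"
    if "j < p" for j
  proof -
    have rj: "1 \<le> r j" "r j \<le> p" using rk that by (auto simp: ranking_def bij_betw_def)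
    have "sqrt (log_rank p (r j)) \<le> sqrt (2 * ln (2 * real p / real (r j)))"
      using log_rank_le_ln[OF rj] by (rule real_sqrt_le_mono)
    then have "b * sqrt (log_rank p (r j)) \<le> b * (sqrt 2 * sqrt (ln (2 * real p / real (r j))))"
      unfolding real_sqrt_mult using b by (intro mult_left_mono)
    also have "\<dots> = sqrt (real n) * slope_weight (sqrt 2 * b) n p (r j)"
      using n by (simp add: slope_weight_def real_sqrt_divide)
    finally show ?thesis by (simp add: mult_right_mono mult.assoc[symmetric])
  qed
  then show ?thesis unfolding sn sum_distrib_left by (intro sum_mono) auto
qed

lemma slope_norm_add_ge:
  assumes c: "c \<ge> 0" and sp: "card {j \<in> {..<p}. t j \<noteq> 0} \<le> s" and s: "s \<le> p"
  shows "slope_norm c n p (\<lambda>j. t j + u j) \<ge> slope_norm c n p t + slope_norm c n p u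
     - 2 * (L2_set (slope_weight c n p) {1..s} * L2_set u {..<p})"
proof -
  obtain r1 where r1: "ranking p t r1" "\<And>c n. slope_norm c n p t = (\<Sum>j<p. slope_weight c n p (r1 j) * \<bar>t j\<bar>)"
    using slope_norm_ranking_ex[of p t] by metis
  obtain r2 where r2: "ranking p u r2" "\<And>c n. slope_norm c n p u = (\<Sum>j<p. slope_weight c n p (r2 j) * \<bar>u j\<bar>)"
    using slope_norm_ranking_ex[of p u] by metis
  obtain r3 where r3: "ranking p (\<lambda>j. t j + u j) r3"
    "\<And>c n. slope_norm c n p (\<lambda>j. t j + u j) = (\<Sum>j<p. slope_weight c n p (r3 j) * \<bar>t j + u j\<bar>)"
    using slope_norm_ranking_ex[of p "\<lambda>j. t j + u j"] by metis
  show ?thesis unfolding r1(2) r2(2) r3(2)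
    by (rule sorted_penalty_decomposition[OF r1(1) r2(1) r3(1) _ _ sp s])
       (use c slope_weight_antimono slope_weight_nonneg in auto)
qed

text \<open>In the decomposition for \<open>u\<close> plus \<open>- u\<close> the left side is 0 and
  the two Slope norms on the right are equal.\<close>

lemma slope_norm_sparse_le:
  assumes c: "c \<ge> 0" and sp: "card {j \<in> {..<p}. u j \<noteq> 0} \<le> s" and s: "s \<le> p"
  shows "slope_norm c n p u \<le> L2_set (slope_weight c n p) {1..s} * L2_set u {..<p}"
proof -
  have z: "slope_norm c n p (\<lambda>j. u j + - u j) = 0"
  proof -
    obtain r where "\<And>c n. slope_norm c n p (\<lambda>j. u j + - u j) = (\<Sum>j<p. slope_weight c n p (r j) * \<bar>u j + - u j\<bar>)"
      using slope_norm_ranking_ex[of p "\<lambda>j. u j + - u j"] by metis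
    then show ?thesis by simp
  qed
  have m: "slope_norm c n p (\<lambda>j. - u j) = slope_norm c n p u"
    by (simp add: slope_norm_def abs_order_stat_def)
  have "L2_set (\<lambda>j. - u j) {..<p} = L2_set u {..<p}" by (simp add: L2_set_def)
  then show ?thesis using slope_norm_add_ge[OF c sp s, of n "\<lambda>j. - u j"] unfolding z m by simp
qed

text \<open>The squared norm of the weights is at most 8 c^2 \<kappa>, and 2048 = 8 * 256 makes this
  at most 1/256. Sparsity up to 2 s is covered because differences of two s-sparse vectors
  occur.\<close>

lemma L2_slope_weight_small:
  assumes "1 \<le> s" "s \<le> s'" "s' \<le> p" "s' \<le> 2 * s" "n \<ge> 1" and c: "c \<ge> 0"
    and k: "real s * log_rank p s \<le> 2 * \<kappa> * real n" "2048 * c\<^sup>2 * \<kappa> \<le> 1"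
  shows "L2_set (slope_weight c n p) {1..s'} \<le> 1 / 16"
proof -
  have "log_rank p s' \<le> log_rank p s" using assms by (intro log_rank_antimono) auto
  moreover have "log_rank p s' \<ge> 1" using assms by (intro log_rank_ge_1) auto
  ultimately have "real s' * log_rank p s' \<le> (2 * real s) * log_rank p s"
    using assms by (intro mult_mono) auto
  then have "2 * (real s' * log_rank p s') / real n \<le> 2 * (4 * \<kappa> * real n) / real n"
    using k by (intro divide_right_mono) auto
  also have "\<dots> = 8 * \<kappa>" using assms by simp
  finally have "c * sqrt (2 * (real s' * log_rank p s') / real n) \<le> c * sqrt (8 * \<kappa>)"
    using c by (intro mult_left_mono real_sqrt_le_mono)
  also have "\<dots> = sqrt (c\<^sup>2 * (8 * \<kappa>))" using c by (simp add: real_sqrt_mult)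
  also have "\<dots> \<le> sqrt ((1/16)\<^sup>2)" using k(2) by (intro real_sqrt_le_mono) (simp add: power2_eq_square)
  finally show ?thesis using slope_weight_L2_le[OF c, of s' p n] assms by simp
qed

lemma residual_L2_le:
  assumes "\<sigma> \<ge> 0"
  shows "L2_set (\<lambda>i. \<Sum>j<p. fst w (i, j) * (t j - \<theta> j)) R
     \<le> L2_set (residual p t (observe R p \<theta> \<sigma> w)) R + \<sigma> * L2_set (snd w) R"
proof -
  have "L2_set (\<lambda>i. \<Sum>j<p. fst w (i, j) * (t j - \<theta> j)) R
      = L2_set (\<lambda>i. \<sigma> * snd w i - residual p t (observe R p \<theta> \<sigma> w) i) R"
  proof (rule L2_set_cong[OF refl])
    fix i assume "i \<in> R"
    then show "(\<Sum>j<p. fst w (i, j) * (t j - \<theta> j)) = \<sigma> * snd w i - residual p t (observe R p \<theta> \<sigma> w) i"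
      by (simp add: residual_observe right_diff_distrib sum_subtractf)
  qed
  also have "\<dots> \<le> L2_set (\<lambda>i. \<sigma> * snd w i) R + L2_set (residual p t (observe R p \<theta> \<sigma> w)) R"
    by (rule L2_set_diff_le)
  finally show ?thesis using assms by (simp add: L2_set_scale)
qed

lemma residual_L2_true: "\<sigma> \<ge> 0 \<Longrightarrow> L2_set (residual p \<theta> (observe R p \<theta> \<sigma> w)) R = \<sigma> * L2_set (snd w) R"
  using L2_set_scale[of \<sigma> "snd w" R]
  by (subst L2_set_cong[OF refl, of R _ "\<lambda>i. \<sigma> * snd w i"]) (simp_all add: residual_observe)

text \<open>Let U be the norm of the error u, E that of the noise, q = sqrt n and S the Slope norm.
  The design gives q U / 4 - q S(u) <= Res + E, minimality Res / q + S(t) <= E / q + S(\<theta>),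
  and the decomposition S(t) >= S(\<theta>) + S(u) - U / 8. On adding these, everything but U and E
  cancels, leaving U / 8 <= 2 E / q.\<close>

lemma srs_error:
  assumes srs: "srs_estimator c R p th" and n: "card R = n" "n \<ge> 1" and b: "b \<ge> 0" and cb: "c = sqrt 2 * b"
    and th0: "\<theta> \<in> sparse_vecs p s" and s: "1 \<le> s" "s \<le> p"
    and k: "real s * log_rank p s \<le> 2 * \<kappa> * real n" "2048 * c\<^sup>2 * \<kappa> \<le> 1"
    and w: "w \<in> space (sample_space R p)" and sg: "\<sigma> \<ge> 0"
    and low: "\<And>u r. ranking p u r \<Longrightarrow> L2_set (\<lambda>i. \<Sum>j<p. fst w (i, j) * u j) R
        \<ge> sqrt (real n) / 4 * L2_set u {..<p} - b * (\<Sum>j<p. sqrt (log_rank p (r j)) * \<bar>u j\<bar>)"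
  shows "L2_set (\<lambda>j. th (observe R p \<theta> \<sigma> w) j - \<theta> j) {..<p} \<le> 16 * (\<sigma> * L2_set (snd w) R) / sqrt (real n)"
proof -
  define d where "d = observe R p \<theta> \<sigma> w"
  define t where "t = th d"
  define u where "u j = t j - \<theta> j" for j
  define U where "U = L2_set u {..<p}"
  have U0: "U \<ge> 0" by (simp add: U_def)
  define q where "q = sqrt (real n)"
  have q: "q > 0" using n by (simp add: q_def)
  define E where "E = \<sigma> * L2_set (snd w) R"
  define Res where "Res = L2_set (residual p t d) R"
  define Sl where "Sl v = slope_norm c n p v" for v
  have c0: "c \<ge> 0" using b cb by simp
  have ds: "d \<in> space (sample_space R p)" unfolding d_def using measurable_space[OF observe_measurable w] .
  have am: "is_arg_min (srs_objective c R p d) (\<lambda>t. t \<in> space (vec_space p)) t"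
    using srs ds unfolding srs_estimator_def t_def by blast
  have "\<theta> \<in> space (vec_space p)" using th0 by (simp add: sparse_vecs_def)
  then have "srs_objective c R p d t \<le> srs_objective c R p d \<theta>"
    using am unfolding is_arg_min_def by (meson not_le)
  moreover have "L2_set (residual p \<theta> d) R = E" unfolding d_def E_def by (rule residual_L2_true[OF sg])
  ultimately have obj: "Res / q + Sl t \<le> E / q + Sl \<theta>"
    by (simp add: srs_objective_def n Sl_def q_def Res_def)
  have "card {j \<in> {..<p}. \<theta> j \<noteq> 0} \<le> s" using th0 by (simp add: sparse_vecs_def)
  from slope_norm_add_ge[OF c0 this s(2), of n u]
  have "Sl (\<lambda>j. \<theta> j + u j) \<ge> Sl \<theta> + Sl u - 2 * (L2_set (slope_weight c n p) {1..s} * U)"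
    by (simp add: Sl_def U_def)
  moreover have "Sl (\<lambda>j. \<theta> j + u j) = Sl t" by (simp add: u_def)
  moreover have "L2_set (slope_weight c n p) {1..s} * U \<le> 1 / 16 * U"
    using U0 by (intro mult_right_mono L2_slope_weight_small[OF s(1) _ s(2) _ n(2) c0 k]) auto
  ultimately have pen: "Sl t \<ge> Sl \<theta> + Sl u - U / 8" by linarith
  obtain r where r: "ranking p u r" "\<And>c n. slope_norm c n p u = (\<Sum>j<p. slope_weight c n p (r j) * \<bar>u j\<bar>)"
    using slope_norm_ranking_ex[of p u] by metis
  have "b * (\<Sum>j<p. sqrt (log_rank p (r j)) * \<bar>u j\<bar>) \<le> q * Sl u"
    unfolding q_def Sl_def cb by (rule sqrt_log_rank_sum_le[OF r(1) n(2) b r(2)])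
  then have "q / 4 * U - q * Sl u \<le> L2_set (\<lambda>i. \<Sum>j<p. fst w (i, j) * u j) R"
    using low[OF r(1)] by (simp add: q_def U_def)
  also have "\<dots> \<le> Res + E"
    unfolding Res_def E_def d_def u_def by (rule residual_L2_le[OF sg])
  finally have "(q / 4 * U - q * Sl u) / q \<le> (Res + E) / q" using q by (intro divide_right_mono) auto
  then have "U / 4 - Sl u \<le> Res / q + E / q" using q by (simp add: diff_divide_distrib add_divide_distrib)
  then have "U \<le> 16 * (E / q)" using obj pen by linarith
  then show ?thesis by (simp add: U_def u_def[abs_def] t_def d_def E_def q_def)
qed

section \<open>A measurable sparse least squares estimator\<close>

definition rational_sparse_vecs :: "nat \<Rightarrow> nat \<Rightarrow> (nat \<Rightarrow> real) set" where
  "rational_sparse_vecs p s = {t \<in> sparse_vecs p s. \<forall>j<p. t j \<in> \<rat>}"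

definition rational_sparse_seq :: "nat \<Rightarrow> nat \<Rightarrow> nat \<Rightarrow> nat \<Rightarrow> real" where
  "rational_sparse_seq p s = from_nat_into (rational_sparse_vecs p s)"

lemma space_vec_space: "space (vec_space p) = extensional {..<p}"
  by (simp add: vec_space_def space_PiM PiE_UNIV_domain PiE_def)

lemma range_rational_sparse_seq: "range (rational_sparse_seq p s) = rational_sparse_vecs p s"
proof -
  have "rational_sparse_vecs p s \<subseteq> PiE {..<p} (\<lambda>_. \<rat>)"
    by (auto simp: rational_sparse_vecs_def sparse_vecs_def space_vec_space PiE_def)
  moreover have "countable (PiE {..<p} (\<lambda>_. \<rat> :: real set))"
    by (intro countable_PiE) (auto simp: countable_rat)
  ultimately have "countable (rational_sparse_vecs p s)" by (rule countable_subset)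
  moreover have "restrict (\<lambda>_. 0) {..<p} \<in> rational_sparse_vecs p s"
    by (auto simp: rational_sparse_vecs_def sparse_vecs_def space_vec_space)
  ultimately show ?thesis unfolding rational_sparse_seq_def by (intro range_from_nat_into) auto
qed

lemma rational_sparse_seq_sparse: "card {j \<in> {..<p}. rational_sparse_seq p s k j \<noteq> 0} \<le> s"
proof -
  have "rational_sparse_seq p s k \<in> rational_sparse_vecs p s"
    using range_rational_sparse_seq[of p s] by auto
  then show ?thesis by (simp add: rational_sparse_vecs_def sparse_vecs_def)
qed

text \<open>Only countably many vectors compete, so the infimum is measurable in the sample; by
  density it does not exceed the residual norm at any real sparse vector.\<close>

definition min_residual :: "nat \<Rightarrow> nat \<Rightarrow> nat set \<Rightarrow> sample \<Rightarrow> real" where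
  "min_residual p s R d = (INF k. L2_set (residual p (rational_sparse_seq p s k) d) R)"

text \<open>When the infimum I is positive, some competitor stays below 2 I, and the index becomes
  eventually constant. The vanishing slack keeps the index meaningful when the infimum is 0 and not
  attained.\<close>

definition near_min_index :: "nat \<Rightarrow> nat \<Rightarrow> nat set \<Rightarrow> nat \<Rightarrow> sample \<Rightarrow> nat" where
  "near_min_index p s R m d = (LEAST k. L2_set (residual p (rational_sparse_seq p s k) d) R
     \<le> 2 * min_residual p s R d + inverse (real (Suc m)))"

text \<open>When the infimum of the residual norm over rational vectors is 0, it need not be attained;
  hence the limit.\<close>

definition sparse_lsq :: "nat \<Rightarrow> nat \<Rightarrow> nat set \<Rightarrow> sample \<Rightarrow> nat \<Rightarrow> real" where
  "sparse_lsq p s R d = (\<lambda>j\<in>{..<p}. lim (\<lambda>m. rational_sparse_seq p s (near_min_index p s R m d) j))"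

lemma sparse_lsq_measurable: "sparse_lsq p s R \<in> sample_space R p \<rightarrow>\<^sub>M vec_space p"
proof -
  have r [measurable]: "(\<lambda>d. L2_set (residual p t d) R) \<in> borel_measurable (sample_space R p)" for t
  proof -
    have "(\<lambda>d. residual p t d i) \<in> borel_measurable (sample_space R p)" if "i \<in> R" for i
      using that by (intro residual_measurable[of p "\<lambda>d. d" i _ "\<lambda>_. t"] sample_fst_measurable sample_snd_measurable) auto
    then have [measurable]: "(\<lambda>d. \<Sum>i\<in>R. (residual p t d i)\<^sup>2) \<in> borel_measurable (sample_space R p)"
      by (intro borel_measurable_sum borel_measurable_power) auto
    show ?thesis unfolding L2_set_def by measurable
  qed
  have m [measurable]: "min_residual p s R \<in> borel_measurable (sample_space R p)"
    unfolding min_residual_def[abs_def] by (rule borel_measurable_cINF_real) auto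
  have i: "near_min_index p s R m \<in> sample_space R p \<rightarrow>\<^sub>M count_space UNIV" for m
    unfolding near_min_index_def[abs_def] by measurable
  have "(\<lambda>d. rational_sparse_seq p s (near_min_index p s R m d) j) \<in> borel_measurable (sample_space R p)" for m j
    by (rule measurable_compose_countable[OF _ i]) simp
  then show ?thesis unfolding sparse_lsq_def[abs_def] vec_space_def
    by (intro measurable_restrict borel_measurable_lim_metric)
qed

lemma L2_design_diff_le:
  "L2_set (\<lambda>i. \<Sum>j<p. fst d (i, j) * (t j - t' j)) R \<le> L2_set (residual p t d) R + L2_set (residual p t' d) R"
proof -
  have "(\<Sum>j<p. fst d (i, j) * (t j - t' j)) = residual p t' d i - residual p t d i" for i
    by (simp add: residual_eq right_diff_distrib sum_subtractf)
  then show ?thesis using L2_set_diff_le[of "residual p t' d" "residual p t d" R] by (simp add: add.commute)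
qed

lemma bdd_below_residuals: "bdd_below (range (\<lambda>k. L2_set (residual p (rational_sparse_seq p s k) d) R))"
  by (intro bdd_belowI[of _ 0]) auto

lemma min_residual_nonneg: "min_residual p s R d \<ge> 0"
  unfolding min_residual_def by (intro cINF_greatest) auto

lemma min_residual_le:
  assumes th: "\<theta> \<in> sparse_vecs p s"
  shows "min_residual p s R d \<le> L2_set (residual p \<theta> d) R"
proof (rule field_le_epsilon)
  fix e :: real assume e: "e > 0"
  define C where "C = L2_set (\<lambda>i. \<Sum>j<p. \<bar>fst d (i, j)\<bar>) R"
  have C: "C \<ge> 0" by (simp add: C_def)
  define \<eta> where "\<eta> = e / (C + 1)"
  have eta: "\<eta> > 0" using e C by (simp add: \<eta>_def)
  \<comment> \<open>Zero is approximated by zero, so that the rational vector inherits the sparsity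
    of \<theta>.\<close>
  have "\<exists>r\<in>\<rat>. \<bar>r - \<theta> j\<bar> \<le> \<eta> \<and> (\<theta> j = 0 \<longrightarrow> r = 0)" for j
  proof (cases "\<theta> j = 0")
    case True then show ?thesis using eta by (intro bexI[of _ 0]) auto
  next
    case False
    obtain r where "r \<in> \<rat>" "\<theta> j < r" "r < \<theta> j + \<eta>"
      using Rats_dense_in_real[of "\<theta> j" "\<theta> j + \<eta>"] eta by auto
    then show ?thesis using False by (intro bexI[of _ r]) auto
  qed
  then obtain f where f: "\<And>j. f j \<in> \<rat>" "\<And>j. \<bar>f j - \<theta> j\<bar> \<le> \<eta>" "\<And>j. \<theta> j = 0 \<Longrightarrow> f j = 0" by metis
  define t where "t = restrict f {..<p}"
  have "card {j \<in> {..<p}. t j \<noteq> 0} \<le> card {j \<in> {..<p}. \<theta> j \<noteq> 0}"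
    by (intro card_mono) (auto simp: t_def f(3))
  then have "t \<in> rational_sparse_vecs p s"
    using th f(1) by (auto simp: rational_sparse_vecs_def sparse_vecs_def space_vec_space t_def)
  then obtain k where k: "rational_sparse_seq p s k = t" using range_rational_sparse_seq[of p s] by (metis imageE)
  have "min_residual p s R d \<le> L2_set (residual p (rational_sparse_seq p s k) d) R"
    unfolding min_residual_def by (rule cINF_lower[OF bdd_below_residuals]) simp
  also have "\<dots> = L2_set (residual p t d) R" unfolding k ..
  also have "\<dots> = L2_set (\<lambda>i. residual p \<theta> d i - (\<Sum>j<p. fst d (i, j) * (t j - \<theta> j))) R"
    by (rule L2_set_cong) (simp_all add: residual_eq right_diff_distrib sum_subtractf)
  also have "\<dots> \<le> L2_set (residual p \<theta> d) R + L2_set (\<lambda>i. \<Sum>j<p. fst d (i, j) * (t j - \<theta> j)) R"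
    by (rule L2_set_diff_le)
  also have "L2_set (\<lambda>i. \<Sum>j<p. fst d (i, j) * (t j - \<theta> j)) R \<le> L2_set (\<lambda>i. \<eta> * (\<Sum>j<p. \<bar>fst d (i, j)\<bar>)) R"
  proof (rule L2_set_abs_mono)
    fix i
    have "\<bar>\<Sum>j<p. fst d (i, j) * (t j - \<theta> j)\<bar> \<le> (\<Sum>j<p. \<bar>fst d (i, j)\<bar> * \<bar>t j - \<theta> j\<bar>)"
      unfolding abs_mult[symmetric] by (rule sum_abs)
    also have "\<dots> \<le> (\<Sum>j<p. \<bar>fst d (i, j)\<bar> * \<eta>)"
      by (intro sum_mono mult_left_mono) (auto simp: t_def f(2))
    also have "\<dots> = \<bar>\<eta> * (\<Sum>j<p. \<bar>fst d (i, j)\<bar>)\<bar>"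
      unfolding sum_distrib_right[symmetric] using eta by (simp add: abs_mult sum_nonneg mult.commute)
    finally show "\<bar>\<Sum>j<p. fst d (i, j) * (t j - \<theta> j)\<bar> \<le> \<bar>\<eta> * (\<Sum>j<p. \<bar>fst d (i, j)\<bar>)\<bar>" .
  qed
  also have "\<dots> = \<eta> * C" using eta by (simp add: L2_set_scale C_def)
  also have "\<eta> * C \<le> e" using e C by (simp add: \<eta>_def pos_divide_le_eq)
  finally show "min_residual p s R d \<le> L2_set (residual p \<theta> d) R + e" by simp
qed

lemma near_min_index_residual:
  "L2_set (residual p (rational_sparse_seq p s (near_min_index p s R m d)) d) R
     \<le> 2 * min_residual p s R d + inverse (real (Suc m))"
proof -
  have "min_residual p s R d < 2 * min_residual p s R d + inverse (real (Suc m))"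
    using min_residual_nonneg[of p s R d] by (simp add: add_nonneg_pos)
  then obtain k where "L2_set (residual p (rational_sparse_seq p s k) d) R < 2 * min_residual p s R d + inverse (real (Suc m))"
    unfolding min_residual_def[of p s R d] using cINF_less_iff[OF _ bdd_below_residuals] by blast
  then have "\<exists>k. L2_set (residual p (rational_sparse_seq p s k) d) R \<le> 2 * min_residual p s R d + inverse (real (Suc m))"
    by (auto intro: less_imp_le)
  then show ?thesis unfolding near_min_index_def by (rule LeastI_ex)
qed

text \<open>If the infimum is positive, each of the finitely many indices before the limiting one
  has a residual strictly above twice the infimum and is ruled out once the slack is small. If it is
  0, the residuals tend to 0, and the lower bound on differences, which are 2s-sparse, makes the
  vectors Cauchy.\<close>

lemma near_min_sequence_converges:
  assumes a: "a > 0"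
    and low: "\<And>u. card {j \<in> {..<p}. u j \<noteq> 0} \<le> 2 * s \<Longrightarrow>
        a * L2_set u {..<p} \<le> L2_set (\<lambda>i. \<Sum>j<p. fst d (i, j) * u j) R"
  shows "\<exists>x. \<forall>j<p. (\<lambda>m. rational_sparse_seq p s (near_min_index p s R m d) j) \<longlonglongrightarrow> x j"
proof -
  define q where "q = rational_sparse_seq p s"
  define I where "I = min_residual p s R d"
  define f where "f k = L2_set (residual p (q k) d) R" for k
  define i where "i m = near_min_index p s R m d" for m
  have inv0: "(\<lambda>m. inverse (real (Suc m))) \<longlonglongrightarrow> 0" by (rule LIMSEQ_inverse_real_of_nat)
  show ?thesis
  proof (cases "I = 0")
    case False
    then have I: "I > 0" using min_residual_nonneg[of p s R d] by (simp add: I_def)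
    then have "I < 2 * I" by simp
    then obtain k where "f k < 2 * I"
      unfolding I_def min_residual_def[of p s R d] f_def q_def
      using cINF_less_iff[OF _ bdd_below_residuals] by blast
    then have ex: "\<exists>k. f k \<le> 2 * I" by (auto intro: less_imp_le)
    define k0 where "k0 = (LEAST k. f k \<le> 2 * I)"
    have k0: "f k0 \<le> 2 * I" unfolding k0_def using ex by (rule LeastI_ex)
    have "\<forall>\<^sub>F m in sequentially. \<forall>k\<in>{..<k0}. 2 * I + inverse (real (Suc m)) < f k"
    proof (rule eventually_ball_finite)
      show "\<forall>k\<in>{..<k0}. \<forall>\<^sub>F m in sequentially. 2 * I + inverse (real (Suc m)) < f k"
      proof
        fix k assume "k \<in> {..<k0}"
        then have "f k - 2 * I > 0" using not_less_Least[of k "\<lambda>k. f k \<le> 2 * I"] by (auto simp: k0_def not_le)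
        then have "\<forall>\<^sub>F m in sequentially. inverse (real (Suc m)) < f k - 2 * I"
          by (rule order_tendstoD(2)[OF inv0])
        then show "\<forall>\<^sub>F m in sequentially. 2 * I + inverse (real (Suc m)) < f k"
          by eventually_elim simp
      qed
    qed simp
    then have ev: "\<forall>\<^sub>F m in sequentially. i m = k0"
    proof eventually_elim
      case (elim m)
      have "(LEAST k. f k \<le> 2 * I + inverse (real (Suc m))) = k0"
      proof (rule Least_equality)
        show "f k0 \<le> 2 * I + inverse (real (Suc m))"
          using k0 by (simp add: add_increasing2)
        show "k0 \<le> k" if "f k \<le> 2 * I + inverse (real (Suc m))" for k
          using elim that by (meson leD lessThan_iff not_le)
      qed
      then show ?case by (simp add: i_def near_min_index_def f_def I_def q_def)
    qed
    have "(\<lambda>m. q (i m) j) \<longlonglongrightarrow> q k0 j" for j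
      by (rule tendsto_eventually) (use ev in eventually_elim, simp)
    then show ?thesis unfolding q_def i_def by blast
  next
    case True
    have "Cauchy (\<lambda>m. q (i m) j)" if j: "j < p" for j
    proof (rule metric_CauchyI)
      fix e :: real assume e: "e > 0"
      then have "a * e / 2 > 0" using a by simp
      from reals_Archimedean[OF this] obtain m0 where m0: "inverse (real (Suc m0)) < a * e / 2" by auto
      have "dist (q (i m) j) (q (i l) j) < e" if ml: "m \<ge> m0" "l \<ge> m0" for m l
      proof -
        define u where "u j = q (i m) j - q (i l) j" for j
        have small: "f (i k) \<le> inverse (real (Suc m0))" if "k \<ge> m0" for k
        proof -
          have "f (i k) \<le> inverse (real (Suc k))"
            using near_min_index_residual[of p s R k d] True by (simp add: f_def i_def I_def q_def)
          also have "\<dots> \<le> inverse (real (Suc m0))" using that by (intro le_imp_inverse_le) auto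
          finally show ?thesis .
        qed
        have "card {j \<in> {..<p}. u j \<noteq> 0} \<le> card ({j \<in> {..<p}. q (i m) j \<noteq> 0} \<union> {j \<in> {..<p}. q (i l) j \<noteq> 0})"
          by (intro card_mono) (auto simp: u_def)
        also have "\<dots> \<le> s + s"
          unfolding q_def by (intro order_trans[OF card_Un_le add_mono] rational_sparse_seq_sparse)
        finally have "a * L2_set u {..<p} \<le> L2_set (\<lambda>i. \<Sum>j<p. fst d (i, j) * u j) R" by (intro low) simp
        also have "\<dots> \<le> f (i m) + f (i l)" unfolding u_def f_def by (rule L2_design_diff_le)
        also have "\<dots> \<le> 2 * inverse (real (Suc m0))" using small[OF ml(1)] small[OF ml(2)] by simp
        also have "\<dots> < a * e" using m0 by simp
        finally have "L2_set u {..<p} < e" using a by simp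
        moreover have "\<bar>u j\<bar> \<le> L2_set u {..<p}"
          using member_le_L2_set[of "{..<p}" j "\<lambda>j. \<bar>u j\<bar>"] j by (simp add: L2_set_def)
        ultimately show ?thesis by (simp add: u_def dist_real_def)
      qed
      then show "\<exists>M. \<forall>m\<ge>M. \<forall>l\<ge>M. dist (q (i m) j) (q (i l) j) < e" by blast
    qed
    then have "\<forall>j. \<exists>x. j < p \<longrightarrow> (\<lambda>m. q (i m) j) \<longlonglongrightarrow> x"
      using Cauchy_convergent_iff convergent_def by blast
    then have "\<exists>x. \<forall>j. j < p \<longrightarrow> (\<lambda>m. q (i m) j) \<longlonglongrightarrow> x j" by (rule choice)
    then show ?thesis unfolding q_def i_def .
  qed
qed

text \<open>Of the factor 3, two come from near-minimality and one from the residual at \<theta>.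
  The bound is derived along the rational sequence, whose members are sparse, and the slack
  disappears in the limit.\<close>

lemma sparse_lsq_error:
  assumes th: "\<theta> \<in> sparse_vecs p s" and a: "a > 0"
    and low: "\<And>u. card {j \<in> {..<p}. u j \<noteq> 0} \<le> 2 * s \<Longrightarrow>
        a * L2_set u {..<p} \<le> L2_set (\<lambda>i. \<Sum>j<p. fst d (i, j) * u j) R"
  shows "L2_set (\<lambda>j. sparse_lsq p s R d j - \<theta> j) {..<p} \<le> 3 * L2_set (residual p \<theta> d) R / a"
proof -
  define E where "E = L2_set (residual p \<theta> d) R"
  define t where "t m = rational_sparse_seq p s (near_min_index p s R m d)" for m
  obtain x where x: "\<And>j. j < p \<Longrightarrow> (\<lambda>m. t m j) \<longlonglongrightarrow> x j"
    using near_min_sequence_converges[OF a low] unfolding t_def by blast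
  have sx: "sparse_lsq p s R d j = x j" if "j < p" for j
    using limI[OF x[OF that]] that by (simp add: sparse_lsq_def t_def)
  have bound: "L2_set (\<lambda>j. t m j - \<theta> j) {..<p} \<le> (3 * E + inverse (real (Suc m))) / a" for m
  proof -
    have "card {j \<in> {..<p}. t m j - \<theta> j \<noteq> 0} \<le> card ({j \<in> {..<p}. t m j \<noteq> 0} \<union> {j \<in> {..<p}. \<theta> j \<noteq> 0})"
      by (intro card_mono) auto
    also have "\<dots> \<le> s + s"
      unfolding t_def using th
      by (intro order_trans[OF card_Un_le add_mono] rational_sparse_seq_sparse) (simp add: sparse_vecs_def)
    finally have "a * L2_set (\<lambda>j. t m j - \<theta> j) {..<p} \<le> L2_set (\<lambda>i. \<Sum>j<p. fst d (i, j) * (t m j - \<theta> j)) R"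
      by (intro low) simp
    also have "\<dots> \<le> L2_set (residual p (t m) d) R + E" unfolding E_def by (rule L2_design_diff_le)
    also have "\<dots> \<le> 3 * E + inverse (real (Suc m))"
      using near_min_index_residual[of p s R m d] min_residual_le[OF th, of R d] by (simp add: t_def E_def)
    finally show ?thesis using a by (simp add: pos_le_divide_eq mult.commute)
  qed
  have "(\<lambda>m. L2_set (\<lambda>j. t m j - \<theta> j) {..<p}) \<longlonglongrightarrow> L2_set (\<lambda>j. x j - \<theta> j) {..<p}"
    unfolding L2_set_def by (intro tendsto_intros x) auto
  moreover have "(\<lambda>m. (3 * E + inverse (real (Suc m))) / a) \<longlonglongrightarrow> (3 * E + 0) / a"
    by (intro tendsto_intros LIMSEQ_inverse_real_of_nat) (use a in auto)
  ultimately have "L2_set (\<lambda>j. x j - \<theta> j) {..<p} \<le> (3 * E + 0) / a"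
    by (rule LIMSEQ_le) (use bound in blast)
  moreover have "L2_set (\<lambda>j. sparse_lsq p s R d j - \<theta> j) {..<p} = L2_set (\<lambda>j. x j - \<theta> j) {..<p}"
    by (rule L2_set_cong) (auto simp: sx)
  ultimately show ?thesis by (simp add: E_def)
qed

section \<open>Risk bounds\<close>

text \<open>An estimate of 0 has error exactly \<rho>^2, so below the threshold only an upper bound
  on \<rho>^2 is at stake. Above it, the error bound C0 (V + g) has to be at most \<rho>^2.
  Otherwise \<rho> < (C0 + 1) sqrt V, hence g <= (C0 + 1) V and Q < 2 C0 (V + g) <= H V / 2, which
  is not above the threshold; this fixes \<open>H\<close>.\<close>

lemma threshold_error:
  fixes V g \<rho> Q C0 H S2 thr :: real
  assumes V: "V > 0" and g: "0 \<le> g" "g \<le> sqrt V * \<rho>" and \<rho>: "\<rho> \<ge> 0" and C0: "C0 \<ge> 0" and S2: "S2 \<ge> 0"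
    and H: "H = 4 * C0 * (C0 + 2)" and thr: "H / 2 * V \<le> thr" "thr \<le> H * S2 * V"
    and Q: "\<bar>Q - \<rho>\<^sup>2\<bar> \<le> C0 * (V + g)"
  shows "\<bar>(if thr < Q then Q else 0) - \<rho>\<^sup>2\<bar> \<le> min ((H * S2 + C0) * (V + g)) (\<rho>\<^sup>2)"
proof -
  have H0: "H * S2 \<ge> 0" using H C0 S2 by simp
  have exp1: "(H * S2 + C0) * (V + g) = H * S2 * V + H * S2 * g + C0 * (V + g)" by (simp add: algebra_simps)
  have g0: "H * S2 * g \<ge> 0" "H * S2 * V \<ge> 0" using H0 g V by auto
  show ?thesis
  proof (cases "thr < Q")
    case False
    then have "\<rho>\<^sup>2 \<le> (H * S2 + C0) * (V + g)" using Q thr(2) g0 unfolding exp1 by linarith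
    then show ?thesis using False by simp
  next
    case True
    have "C0 * (V + g) \<le> \<rho>\<^sup>2"
    proof (rule ccontr)
      assume "\<not> ?thesis"
      then have lt: "\<rho>\<^sup>2 < C0 * (V + g)" by simp
      define v where "v = sqrt V"
      have v: "v > 0" "v * v = V" using V by (auto simp: v_def)
      have r: "\<rho> < (C0 + 1) * v"
      proof (rule ccontr)
        assume "\<not> ?thesis"
        then have ge: "(C0 + 1) * v \<le> \<rho>" by simp
        have "C0 * (V + g) \<le> C0 * (v * v + v * \<rho>)" using C0 g v by (intro mult_left_mono) (auto simp: v_def)
        also have "\<dots> \<le> v * ((C0 + 1) * v) + C0 * (v * \<rho>)" using v V by (simp add: algebra_simps)
        also have "\<dots> \<le> v * \<rho> + C0 * (v * \<rho>)" using ge v by (intro add_right_mono mult_left_mono) auto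
        also have "\<dots> = (C0 + 1) * v * \<rho>" by (simp add: algebra_simps)
        also have "\<dots> \<le> \<rho> * \<rho>" using ge \<rho> by (intro mult_right_mono)
        finally show False using lt by (simp add: power2_eq_square)
      qed
      have "g \<le> v * ((C0 + 1) * v)"
      proof -
        have "v * \<rho> \<le> v * ((C0 + 1) * v)" using r v by (intro mult_left_mono) auto
        then show ?thesis using g(2) unfolding v_def by (rule order_trans[rotated])
      qed
      also have "\<dots> = (C0 + 1) * V" by (simp add: v(2)[symmetric])
      finally have "2 * C0 * (V + g) \<le> 2 * C0 * (V + (C0 + 1) * V)" using C0 by (intro mult_left_mono) auto
      also have "\<dots> = H / 2 * V" by (simp add: H algebra_simps)
      finally have "2 * (C0 * (V + g)) \<le> thr" using thr(1) by (simp only: mult.assoc)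
      moreover have "Q < 2 * (C0 * (V + g))" using Q lt by linarith
      ultimately show False using True by linarith
    qed
    moreover have "C0 * (V + g) \<le> (H * S2 + C0) * (V + g)" using g0 unfolding exp1 by linarith
    ultimately show ?thesis using True Q by simp
  qed
qed

text \<open>For \<rho> >= v, dividing the difference of squares by \<rho> turns the quadratic error
  into a linear one. For \<rho> < v, the estimate and \<rho> are both at most (1 + 2 C0) v, and so
  is their distance. The absolute value under the root moves \<open>Q\<close> no farther from
  \<rho>^2.\<close>

lemma sqrt_error:
  fixes v g \<rho> Q C0 :: real
  assumes v: "v > 0" and g: "g \<le> v * \<rho>" and \<rho>: "\<rho> \<ge> 0" and C0: "C0 \<ge> 0"
    and Q: "\<bar>Q - \<rho>\<^sup>2\<bar> \<le> C0 * (v\<^sup>2 + g)"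
  shows "\<bar>sqrt \<bar>Q\<bar> - \<rho>\<bar> \<le> (1 + 2 * C0) * v"
proof -
  define l where "l = sqrt \<bar>Q\<bar>"
  have l: "l \<ge> 0" "l\<^sup>2 = \<bar>Q\<bar>" by (auto simp: l_def)
  have "C0 * (v\<^sup>2 + g) \<le> C0 * (v\<^sup>2 + v * \<rho>)" using C0 g by (intro mult_left_mono) auto
  moreover have "\<bar>l\<^sup>2 - \<rho>\<^sup>2\<bar> \<le> \<bar>Q - \<rho>\<^sup>2\<bar>" unfolding l(2) by (smt (verit) zero_le_power2)
  ultimately have B: "\<bar>l\<^sup>2 - \<rho>\<^sup>2\<bar> \<le> C0 * (v\<^sup>2 + v * \<rho>)" using Q by linarith
  show ?thesis
  proof (cases "v \<le> \<rho>")
    case True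
    have "\<bar>l - \<rho>\<bar> * \<rho> \<le> \<bar>l - \<rho>\<bar> * (l + \<rho>)" using l by (intro mult_left_mono) auto
    also have "\<dots> = \<bar>l\<^sup>2 - \<rho>\<^sup>2\<bar>"
    proof -
      have "l\<^sup>2 - \<rho>\<^sup>2 = (l - \<rho>) * (l + \<rho>)" by (simp add: power2_eq_square algebra_simps)
      moreover have "\<bar>l + \<rho>\<bar> = l + \<rho>" using l(1) \<rho> by simp
      ultimately show ?thesis by (simp only: abs_mult)
    qed
    also note B
    also have "C0 * (v\<^sup>2 + v * \<rho>) \<le> C0 * (v * \<rho> + v * \<rho>)"
      unfolding power2_eq_square using C0 True v by (intro mult_left_mono add_mono) auto
    also have "\<dots> = (2 * C0 * v) * \<rho>" by (simp add: algebra_simps)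
    finally have "\<bar>l - \<rho>\<bar> \<le> 2 * C0 * v" using True v by (simp add: mult_le_cancel_right)
    then show ?thesis using v by (simp add: l_def algebra_simps)
  next
    case False
    have "l\<^sup>2 \<le> \<rho>\<^sup>2 + C0 * (v\<^sup>2 + v * \<rho>)" using B by linarith
    also have "\<dots> \<le> v\<^sup>2 + C0 * (v\<^sup>2 + v * v)"
      using False v \<rho> C0 by (intro add_mono mult_left_mono power_mono) auto
    also have "\<dots> = (1 + 2 * C0) * v\<^sup>2" by (simp add: algebra_simps power2_eq_square)
    also have "\<dots> \<le> (1 + 2 * C0)\<^sup>2 * v\<^sup>2"
      using C0 by (intro mult_right_mono) (auto simp: power2_eq_square algebra_simps)
    finally have "l\<^sup>2 \<le> ((1 + 2 * C0) * v)\<^sup>2" by (simp add: power_mult_distrib)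
    then have "l \<le> (1 + 2 * C0) * v" by (rule power2_le_imp_le) (use C0 v in simp)
    moreover have "\<rho> \<le> (1 + 2 * C0) * v" using False C0 v by (simp add: algebra_simps) (smt (verit) mult_nonneg_nonneg)
    ultimately show ?thesis using l(1) \<rho> unfolding l_def[symmetric] by linarith
  qed
qed

lemma Q_HD_measurable:
  assumes R: "R1 \<subseteq> {..<N}" "R2 \<subseteq> {..<N}" and th: "th \<in> sample_space R1 p \<rightarrow>\<^sub>M vec_space p"
  shows "Q_HD R1 R2 p th \<in> borel_measurable (sample_space {..<N} p)"
    and "(\<lambda>d. \<Sum>k\<in>R2. (residual p (th (subsample R1 p d)) (subsample R2 p d) k)\<^sup>2) \<in> borel_measurable (sample_space {..<N} p)"
proof -
  have t: "(\<lambda>d. th (subsample R1 p d) j) \<in> borel_measurable (sample_space {..<N} p)" if "j < p" for j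
    using measurable_compose[OF measurable_compose[OF subsample_measurable[OF R(1)] th] vec_component_measurable[OF that]] .
  have f: "(\<lambda>d. fst (subsample R2 p d) (k, j)) \<in> borel_measurable (sample_space {..<N} p)" if "k \<in> R2" "j < p" for k j
    using measurable_compose[OF subsample_measurable[OF R(2)] sample_fst_measurable[OF that]] .
  have g: "(\<lambda>d. snd (subsample R2 p d) k) \<in> borel_measurable (sample_space {..<N} p)" if "k \<in> R2" for k
    using measurable_compose[OF subsample_measurable[OF R(2)] sample_snd_measurable[OF that]] .
  show "Q_HD R1 R2 p th \<in> borel_measurable (sample_space {..<N} p)"
    unfolding Q_HD_def[abs_def] using t f g by (intro borel_measurable_sum a_stat_measurable) auto
  show "(\<lambda>d. \<Sum>k\<in>R2. (residual p (th (subsample R1 p d)) (subsample R2 p d) k)\<^sup>2) \<in> borel_measurable (sample_space {..<N} p)"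
    using t f g by (intro borel_measurable_sum borel_measurable_power residual_measurable) auto
qed

context subgauss_law
begin

definition design_good :: "nat set \<Rightarrow> nat \<Rightarrow> sample \<Rightarrow> bool" where
  "design_good R n w \<longleftrightarrow> (\<forall>u r. ranking p u r \<longrightarrow>
       L2_set (\<lambda>i. \<Sum>j<p. fst w (i, j) * u j) R
        \<ge> sqrt (real n) / 4 * L2_set u {..<p} - slope_base K * (\<Sum>j<p. sqrt (log_rank p (r j)) * \<bar>u j\<bar>))"

lemma design_good_subsample: "design_good R n w \<Longrightarrow> design_good R n (subsample R p w)"
proof -
  have "L2_set (\<lambda>i. \<Sum>j<p. fst (subsample R p w) (i, j) * u j) R = L2_set (\<lambda>i. \<Sum>j<p. fst w (i, j) * u j) R" for u
    by (rule L2_set_cong) (auto simp: subsample_def split_beta)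
  then show "design_good R n w \<Longrightarrow> design_good R n (subsample R p w)" by (simp add: design_good_def)
qed

text \<open>Stated for any first-stage map with error at most 24 noise norms over
  \<open>sqrt n\<close> on good designs, so that it covers square-root Slope, with constant 16, and
  sparse least squares, with constant 3 * 8. The noise bound 2 sqrt (n / \<delta>) then gives 48 /
  sqrt \<delta>.\<close>

lemma estimator_event:
  fixes c :: real
  assumes R: "R1 \<subseteq> {..<N}" "R2 \<subseteq> {..<N}" "R1 \<inter> R2 = {}" "card R1 = n" "card R2 = n" "n \<ge> 2" "N = 2 * n"
    and p: "p \<ge> 1" and s: "\<sigma> > 0" and d: "\<delta> > 0"
    and th: "th \<in> sample_space R1 p \<rightarrow>\<^sub>M vec_space p"
    and small: "log_rank p 1 \<le> rip_scale K * real n"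
    and n: "2 * exp (- real n / (512 * K ^ 4)) \<le> \<delta> / 4" "256 * K ^ 4 / real n \<le> \<delta> / 4"
    and C: "C = 48 / sqrt \<delta>"
    and c: "c > 0" "(32 * (64 * K ^ 4 * (C\<^sup>2 + 1))\<^sup>2 + 16 * (64 * K ^ 4 * (C\<^sup>2 + 1))) / c\<^sup>2 \<le> \<delta> / 4"
    and err: "\<And>w. w \<in> space D \<Longrightarrow> design_good R1 n w \<Longrightarrow>
       L2_set (\<lambda>j. th (observe R1 p \<theta> \<sigma> (subsample R1 p w)) j - \<theta> j) {..<p}
         \<le> 24 * (\<sigma> * L2_set (snd w) R1) / sqrt (real n)"
  obtains A where "A \<in> events" "prob A \<le> \<delta>"
    "\<And>w. w \<in> space D - A \<Longrightarrow>
      \<bar>Q_HD R1 R2 p th (observe {..<N} p \<theta> \<sigma> w) - (l2_norm p \<theta>)\<^sup>2\<bar>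
        \<le> c * (\<sigma>\<^sup>2 * (sqrt (real p) / real N) + \<sigma> * (l2_norm p \<theta> / sqrt (real N)))"
    "\<And>w d. w \<in> space D - A \<Longrightarrow> d = observe {..<N} p \<theta> \<sigma> w \<Longrightarrow>
      1 / 2 * \<sigma>\<^sup>2 \<le> (\<Sum>k\<in>R2. (residual p (th (subsample R1 p d)) (subsample R2 p d) k)\<^sup>2) / n \<and>
      (\<Sum>k\<in>R2. (residual p (th (subsample R1 p d)) (subsample R2 p d) k)\<^sup>2) / n \<le> 3 / 2 * (C\<^sup>2 + 1) * \<sigma>\<^sup>2"
proof -
  have n1: "n \<ge> 1" using R by simp
  show ?thesis
  proof (rule first_stage_event[OF R(1,4) n1 p d small n(1)])
    fix B assume B: "B \<in> events" "prob B \<le> \<delta> / 2"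
      "\<And>w u r. w \<in> space D - B \<Longrightarrow> ranking p u r \<Longrightarrow>
       L2_set (\<lambda>i. \<Sum>j<p. fst w (i, j) * u j) R1
        \<ge> sqrt (real n) / 4 * L2_set u {..<p} - 16 * K / sqrt (rip_scale K) * (\<Sum>j<p. sqrt (log_rank p (r j)) * \<bar>u j\<bar>)"
      "\<And>w. w \<in> space D - B \<Longrightarrow> L2_set (snd w) R1 \<le> 2 * sqrt (real n / \<delta>)"
    have close: "(\<Sum>j<p. (\<theta> j - th (observe R1 p \<theta> \<sigma> (subsample R1 p w)) j)\<^sup>2) \<le> C\<^sup>2 * \<sigma>\<^sup>2"
      if w: "w \<in> space D - B" for w
    proof -
      define e where "e j = th (observe R1 p \<theta> \<sigma> (subsample R1 p w)) j - \<theta> j" for j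
      have "design_good R1 n w" unfolding design_good_def slope_base_def using B(3)[OF w] by blast
      then have "L2_set e {..<p} \<le> 24 * (\<sigma> * L2_set (snd w) R1) / sqrt (real n)"
        unfolding e_def using w by (intro err) auto
      also have "\<dots> \<le> 24 * (\<sigma> * (2 * sqrt (real n / \<delta>))) / sqrt (real n)"
        using B(4)[OF w] s by (intro divide_right_mono mult_left_mono) auto
      also have "\<dots> = C * \<sigma>" using n1 by (simp add: C real_sqrt_divide)
      finally have "(L2_set e {..<p})\<^sup>2 \<le> (C * \<sigma>)\<^sup>2" by (intro power_mono) auto
      moreover have "(\<theta> j - th (observe R1 p \<theta> \<sigma> (subsample R1 p w)) j)\<^sup>2 = (e j)\<^sup>2" for j
        by (simp add: e_def power2_commute)
      ultimately show ?thesis by (simp add: L2_set_power2 power_mult_distrib)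
    qed
    show ?thesis
    proof (rule second_stage_event[OF R(1-3,5-7) p s th B(1) close c n(2)])
      fix A assume A: "A \<in> events" "prob A \<le> prob B + \<delta> / 2"
       "\<And>w. w \<in> space D - A \<Longrightarrow>
      \<bar>Q_HD R1 R2 p th (observe {..<N} p \<theta> \<sigma> w) - (l2_norm p \<theta>)\<^sup>2\<bar>
        \<le> c * (\<sigma>\<^sup>2 * (sqrt (real p) / real N) + \<sigma> * (l2_norm p \<theta> / sqrt (real N)))"
    "\<And>w d. w \<in> space D - A \<Longrightarrow> d = observe {..<N} p \<theta> \<sigma> w \<Longrightarrow>
      1 / 2 * \<sigma>\<^sup>2 \<le> (\<Sum>k\<in>R2. (residual p (th (subsample R1 p d)) (subsample R2 p d) k)\<^sup>2) / n \<and>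
      (\<Sum>k\<in>R2. (residual p (th (subsample R1 p d)) (subsample R2 p d) k)\<^sup>2) / n \<le> 3 / 2 * (C\<^sup>2 + 1) * \<sigma>\<^sup>2"
      have "prob A \<le> \<delta>" using A(2) B(2) by linarith
      from that[OF A(1) this A(3,4)] show ?thesis .
    qed
  qed
qed

lemma subsample_space:
  assumes "R \<subseteq> {..<N}" "w \<in> space D"
  shows "subsample R p w \<in> space (sample_space R p)"
  using measurable_space[OF subsample_measurable[OF assms(1)]] assms(2) sets_eq_imp_space_eq[OF sets_D] by auto

lemma snd_subsample_L2: "L2_set (snd (subsample R p w)) R = L2_set (snd w) R"
  by (rule L2_set_cong) (auto simp: subsample_def split_beta)

lemma srs_error_good:
  assumes R: "R \<subseteq> {..<N}" "card R = n" "n \<ge> 1" and srs: "srs_estimator (sqrt 2 * slope_base K) R p th"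
    and th0: "\<theta> \<in> sparse_vecs p s" and s: "1 \<le> s" "s \<le> p"
    and k: "real s * log_rank p s \<le> 2 * \<kappa> * real n" "2048 * (sqrt 2 * slope_base K)\<^sup>2 * \<kappa> \<le> 1" and sg: "\<sigma> > 0"
    and w: "w \<in> space D" "design_good R n w"
  shows "L2_set (\<lambda>j. th (observe R p \<theta> \<sigma> (subsample R p w)) j - \<theta> j) {..<p}
     \<le> 24 * (\<sigma> * L2_set (snd w) R) / sqrt (real n)"
proof -
  have "L2_set (\<lambda>j. th (observe R p \<theta> \<sigma> (subsample R p w)) j - \<theta> j) {..<p}
     \<le> 16 * (\<sigma> * L2_set (snd (subsample R p w)) R) / sqrt (real n)"
    by (rule srs_error[OF srs R(2,3) slope_base_nonneg[OF K1] refl th0 s k subsample_space[OF R(1) w(1)]])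
       (use sg design_good_subsample[OF w(2)] in \<open>auto simp: design_good_def\<close>)
  also have "\<dots> \<le> 24 * (\<sigma> * L2_set (snd w) R) / sqrt (real n)"
    unfolding snd_subsample_L2 using sg by (intro divide_right_mono mult_right_mono) auto
  finally show ?thesis .
qed

lemma sparse_lsq_error_good:
  assumes n: "n \<ge> 1" and th0: "\<theta> \<in> sparse_vecs p s" and s: "1 \<le> s" "s \<le> p"
    and k: "real s * log_rank p s \<le> 2 * \<kappa> * real n" "2048 * (sqrt 2 * slope_base K)\<^sup>2 * \<kappa> \<le> 1" and sg: "\<sigma> > 0"
    and w: "design_good R n w"
  shows "L2_set (\<lambda>j. sparse_lsq p s R (observe R p \<theta> \<sigma> (subsample R p w)) j - \<theta> j) {..<p}
     \<le> 24 * (\<sigma> * L2_set (snd w) R) / sqrt (real n)"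
proof -
  define d where "d = observe R p \<theta> \<sigma> (subsample R p w)"
  define c where "c = sqrt 2 * slope_base K"
  have c0: "c \<ge> 0" using slope_base_nonneg[OF K1] by (simp add: c_def)
  define q where "q = sqrt (real n)"
  have q: "q > 0" using n by (simp add: q_def)
  \<comment> \<open>On 2s-sparse vectors the Slope term uses up at most 1/16 of the 1/4 in the
    design bound, so q / 8 is an admissible constant.\<close>
  have "L2_set (\<lambda>j. sparse_lsq p s R d j - \<theta> j) {..<p} \<le> 3 * L2_set (residual p \<theta> d) R / (q / 8)"
  proof (rule sparse_lsq_error[OF th0])
    show "q / 8 > 0" using q by simp
    fix u :: "nat \<Rightarrow> real" assume u: "card {j \<in> {..<p}. u j \<noteq> 0} \<le> 2 * s"
    \<comment> \<open>The Slope weights have only \<open>p\<close> indices, hence the cap.\<close>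
    define s' where "s' = min (2 * s) p"
    have "card {j \<in> {..<p}. u j \<noteq> 0} \<le> card {..<p}" by (intro card_mono) auto
    then have u': "card {j \<in> {..<p}. u j \<noteq> 0} \<le> s'" using u by (simp add: s'_def)
    have s': "s \<le> s'" "s' \<le> p" "s' \<le> 2 * s" using s by (auto simp: s'_def)
    have "slope_norm c n p u \<le> L2_set (slope_weight c n p) {1..s'} * L2_set u {..<p}"
      by (rule slope_norm_sparse_le[OF c0 u' s'(2)])
    also have "\<dots> \<le> 1 / 16 * L2_set u {..<p}"
      by (intro mult_right_mono L2_slope_weight_small[OF s(1) s' n c0 k[folded c_def]]) auto
    finally have sl: "q * slope_norm c n p u \<le> q * (1 / 16 * L2_set u {..<p})" using q by (intro mult_left_mono) auto
    obtain r where r: "ranking p u r" "\<And>c n. slope_norm c n p u = (\<Sum>j<p. slope_weight c n p (r j) * \<bar>u j\<bar>)"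
      using slope_norm_ranking_ex[of p u] by metis
    have "slope_base K * (\<Sum>j<p. sqrt (log_rank p (r j)) * \<bar>u j\<bar>) \<le> q * slope_norm c n p u"
      unfolding q_def c_def by (rule sqrt_log_rank_sum_le[OF r(1) n slope_base_nonneg[OF K1] r(2)])
    moreover have "L2_set (\<lambda>i. \<Sum>j<p. fst d (i, j) * u j) R
        \<ge> q / 4 * L2_set u {..<p} - slope_base K * (\<Sum>j<p. sqrt (log_rank p (r j)) * \<bar>u j\<bar>)"
      using design_good_subsample[OF w] r(1) by (simp add: design_good_def d_def fst_observe q_def)
    moreover have "q * L2_set u {..<p} \<ge> 0" using q by simp
    ultimately show "q / 8 * L2_set u {..<p} \<le> L2_set (\<lambda>i. \<Sum>j<p. fst d (i, j) * u j) R"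
      using sl by linarith
  qed
  also have "L2_set (residual p \<theta> d) R = \<sigma> * L2_set (snd w) R"
    unfolding d_def using residual_L2_true[of \<sigma> p \<theta> R "subsample R p w"] sg by (simp add: snd_subsample_L2)
  finally show ?thesis by (simp add: d_def q_def)
qed

end

context subgauss_law
begin

text \<open>Settles the probabilistic part for all four claims: what remains for each is a
  deterministic implication from the accuracy of the statistic and the two-sided bound on the
  residual variance.\<close>

lemma estimator_obs_prob:
  fixes c :: real
  assumes R: "R1 \<subseteq> {..<N}" "R2 \<subseteq> {..<N}" "R1 \<inter> R2 = {}" "card R1 = n" "card R2 = n" "n \<ge> 2" "N = 2 * n"
    and p: "p \<ge> 1" and s: "\<sigma> > 0" and d: "\<delta> > 0"
    and th: "th \<in> sample_space R1 p \<rightarrow>\<^sub>M vec_space p"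
    and small: "log_rank p 1 \<le> rip_scale K * real n"
    and n: "2 * exp (- real n / (512 * K ^ 4)) \<le> \<delta> / 4" "256 * K ^ 4 / real n \<le> \<delta> / 4"
    and C: "C = 48 / sqrt \<delta>"
    and c: "c > 0" "(32 * (64 * K ^ 4 * (C\<^sup>2 + 1))\<^sup>2 + 16 * (64 * K ^ 4 * (C\<^sup>2 + 1))) / c\<^sup>2 \<le> \<delta> / 4"
    and err: "\<And>w. w \<in> space D \<Longrightarrow> design_good R1 n w \<Longrightarrow>
       L2_set (\<lambda>j. th (observe R1 p \<theta> \<sigma> (subsample R1 p w)) j - \<theta> j) {..<p}
         \<le> 24 * (\<sigma> * L2_set (snd w) R1) / sqrt (real n)"
    and good: "\<And>d. \<bar>Q_HD R1 R2 p th d - (l2_norm p \<theta>)\<^sup>2\<bar>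
          \<le> c * (\<sigma>\<^sup>2 * (sqrt (real p) / real N) + \<sigma> * (l2_norm p \<theta> / sqrt (real N))) \<Longrightarrow>
        1 / 2 * \<sigma>\<^sup>2 \<le> (\<Sum>k\<in>R2. (residual p (th (subsample R1 p d)) (subsample R2 p d) k)\<^sup>2) / n \<Longrightarrow>
        (\<Sum>k\<in>R2. (residual p (th (subsample R1 p d)) (subsample R2 p d) k)\<^sup>2) / n \<le> 3 / 2 * (C\<^sup>2 + 1) * \<sigma>\<^sup>2 \<Longrightarrow>
        \<not> E d"
  shows "obs_prob N p D \<theta> \<sigma> E \<le> ennreal \<delta>"
proof (rule estimator_event[OF R p s d th small n C c err])
  fix A assume A: "A \<in> events" "prob A \<le> \<delta>"
    "\<And>w. w \<in> space D - A \<Longrightarrow>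
      \<bar>Q_HD R1 R2 p th (observe {..<N} p \<theta> \<sigma> w) - (l2_norm p \<theta>)\<^sup>2\<bar>
        \<le> c * (\<sigma>\<^sup>2 * (sqrt (real p) / real N) + \<sigma> * (l2_norm p \<theta> / sqrt (real N)))"
    "\<And>w d. w \<in> space D - A \<Longrightarrow> d = observe {..<N} p \<theta> \<sigma> w \<Longrightarrow>
      1 / 2 * \<sigma>\<^sup>2 \<le> (\<Sum>k\<in>R2. (residual p (th (subsample R1 p d)) (subsample R2 p d) k)\<^sup>2) / n \<and>
      (\<Sum>k\<in>R2. (residual p (th (subsample R1 p d)) (subsample R2 p d) k)\<^sup>2) / n \<le> 3 / 2 * (C\<^sup>2 + 1) * \<sigma>\<^sup>2"
  have "obs_prob N p D \<theta> \<sigma> E \<le> emeasure D A"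
  proof (rule obs_prob_le[OF A(1) sets_D])
    fix w assume w: "w \<in> space D" "w \<notin> A"
    then have "w \<in> space D - A" by simp
    from A(3)[OF this] A(4)[OF this refl] show "\<not> E (observe {..<N} p \<theta> \<sigma> w)" by (intro good) auto
  qed
  also have "\<dots> \<le> ennreal \<delta>" unfolding emeasure_eq_measure using A(2) by (rule ennreal_leI)
  finally show ?thesis .
qed

end

section \<open>Choice of constants and conclusion\<close>

lemma ln_exp_mult_eq_log_rank:
  "1 \<le> s \<Longrightarrow> s \<le> p \<Longrightarrow> ln (exp 1 * real p / real s) = log_rank p s"
  using ln_mult_pos[of "exp 1" "real p / real s"] by (simp add: log_rank_def)

text \<open>With x = n / (512 K^4), the sample size gives x \<delta> >= 8, and x exp (-x) <= 1 turns
  this into 8 exp (-x) <= \<delta>.\<close>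

lemma sample_size_conditions:
  fixes K \<delta> :: real
  assumes K: "K \<ge> 1" and d: "\<delta> > 0" and n: "n \<ge> nat \<lceil>4096 * K ^ 4 / \<delta>\<rceil> + 2"
  shows "n \<ge> 2" "2 * exp (- real n / (512 * K ^ 4)) \<le> \<delta> / 4" "256 * K ^ 4 / real n \<le> \<delta> / 4"
proof -
  show n2: "n \<ge> 2" using n by simp
  have K4: "K ^ 4 > 0" using K by simp
  have "nat \<lceil>4096 * K ^ 4 / \<delta>\<rceil> \<le> n" using n by linarith
  then have "4096 * K ^ 4 / \<delta> \<le> real n"
    by (rule order_trans[OF real_nat_ceiling_ge of_nat_mono])
  then have big: "4096 * K ^ 4 \<le> real n * \<delta>" using d by (simp add: pos_divide_le_eq)
  define x where "x = real n / (512 * K ^ 4)"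
  have x: "x > 0" using n2 K4 by (simp add: x_def)
  have x8: "8 \<le> x * \<delta>" using big K4 by (simp add: x_def pos_le_divide_eq mult.commute)
  have "x \<le> exp x" using exp_ge_add_one_self[of x] by linarith
  then have "x * exp (- x) \<le> exp x * exp (- x)" by (intro mult_right_mono) auto
  then have "x * exp (- x) \<le> 1" by (simp add: mult_exp_exp)
  then have le1: "\<delta> * (x * exp (- x)) \<le> \<delta> * 1" using d by (intro mult_left_mono) auto
  have "8 * exp (- x) \<le> x * \<delta> * exp (- x)" using x8 by (intro mult_right_mono) auto
  also have "\<dots> = \<delta> * (x * exp (- x))" by (simp only: mult_ac)
  also note le1
  finally have "8 * exp (- x) \<le> \<delta>" by simp
  then show "2 * exp (- real n / (512 * K ^ 4)) \<le> \<delta> / 4" by (simp add: x_def)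
  have "1024 * K ^ 4 \<le> real n * \<delta>" using big K4 by linarith
  then show "256 * K ^ 4 / real n \<le> \<delta> / 4" using n2 by (simp add: pos_divide_le_eq mult.commute)
qed

theorem corollary4:
  fixes L M :: real
  assumes "L > 0" and "M > 0"
  shows
    "\<exists>\<kappa>bar::real. \<kappa>bar > 0 \<and> (\<forall>\<kappa>\<^sub>0 \<in> {0<..\<kappa>bar}. \<exists>c::real. c > 0 \<and>
      (\<forall>\<gamma>::real. \<forall>\<delta>::real. \<gamma> > 0 \<longrightarrow> 0 < \<delta> \<longrightarrow> \<delta> < 1 \<longrightarrow>
      (\<exists>C::real. \<exists>N\<^sub>0::nat. C > 0 \<and>
      (\<forall>N n p s :: nat. \<forall>D :: sample measure.
        N = 2 * n \<longrightarrow> N \<ge> N\<^sub>0 \<longrightarrow> p \<ge> 2 \<longrightarrow> real p \<ge> \<gamma> * real n \<longrightarrow> 1 \<le> s \<longrightarrow> s \<le> p \<longrightarrow>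
        real s * ln (exp 1 * real p / real s) / real N \<le> \<kappa>\<^sub>0 \<longrightarrow>
        design_noise_law N p D \<longrightarrow>
        (\<forall>i<N. subgaussian D L (\<lambda>(x, \<xi>). \<xi> i)) \<longrightarrow>
        (\<forall>i<N. \<forall>j<p. subgaussian D M (\<lambda>(x, \<xi>). x (i, j))) \<longrightarrow>
        (\<forall>R\<^sub>1 R\<^sub>2 th. R\<^sub>1 \<union> R\<^sub>2 = {..<N} \<longrightarrow> R\<^sub>1 \<inter> R\<^sub>2 = {} \<longrightarrow> card R\<^sub>1 = n \<longrightarrow> card R\<^sub>2 = n \<longrightarrow>
           srs_estimator c R\<^sub>1 p th \<longrightarrow>
           (SUP \<sigma>\<in>{0<..}. SUP \<theta>\<in>sparse_vecs p s. obs_prob N p D \<theta> \<sigma>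
              (\<lambda>d. \<bar>Lambda_HD R\<^sub>1 R\<^sub>2 p th d - l2_norm p \<theta>\<bar>
                 > C * \<sigma> * (real p powr (1/4) / sqrt (real N)))) \<le> ennreal \<delta> \<and>
           (SUP \<sigma>\<in>{0<..}. SUP \<theta>\<in>sparse_vecs p s. obs_prob N p D \<theta> \<sigma>
              (\<lambda>d. \<bar>Q_HD R\<^sub>1 R\<^sub>2 p th d - (l2_norm p \<theta>)\<^sup>2\<bar>
                 > C * (\<sigma>\<^sup>2 * (sqrt (real p) / real N) + \<sigma> * (l2_norm p \<theta> / sqrt (real N)))))
             \<le> ennreal \<delta>) \<and>
        (INF T\<in>estimators N p. SUP \<sigma>\<in>{0<..}. SUP \<theta>\<in>sparse_vecs p s. obs_prob N p D \<theta> \<sigma>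
           (\<lambda>d. \<bar>T d - (l2_norm p \<theta>)\<^sup>2\<bar>
              > min (C * (\<sigma>\<^sup>2 * (sqrt (real p) / real N) + \<sigma> * (l2_norm p \<theta> / sqrt (real N))))
                    ((l2_norm p \<theta>)\<^sup>2)))
          \<le> ennreal \<delta> \<and>
        (\<forall>\<kappa>::real. \<kappa> > 0 \<longrightarrow>
          (INF T\<in>estimators N p. SUP \<sigma>\<in>{0<..}.
             SUP \<theta>\<in>{\<theta> \<in> sparse_vecs p s. l2_norm p \<theta> \<le> \<kappa>}. obs_prob N p D \<theta> \<sigma>
             (\<lambda>d. \<bar>T d - (l2_norm p \<theta>)\<^sup>2\<bar>
                > min (C * (\<sigma>\<^sup>2 * (sqrt (real p) / real N) + \<sigma> * (\<kappa> / sqrt (real N))))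
                      (\<kappa>\<^sup>2)))
            \<le> ennreal \<delta>)))))"
proof -
  \<comment> \<open>A single scale for design and noise; being at least 1, it lets additive
    constants be absorbed into its powers.\<close>
  define K where "K = max 1 (max L M)"
  have K: "K \<ge> 1" "L \<le> K" "M \<le> K" by (auto simp: K_def)
  define c where "c = sqrt 2 * slope_base K"
  have c: "c > 0" using slope_base_pos[OF K(1)] by (simp add: c_def)
  \<comment> \<open>The first bound makes sparsity 1 affordable, with the half accounting for N = 2
    n; the second gives the first 2 s Slope weights (at most \<open>p\<close> of them) a norm of at
    most 1/16.\<close>
  define kb where "kb = min (rip_scale K / 2) (1 / (2048 * c\<^sup>2))"
  have kb: "kb > 0" using rip_scale_pos[OF K(1)] c by (simp add: kb_def)
  show ?thesis
    apply (rule exI[of _ kb], rule conjI[OF kb], rule ballI, rule exI[of _ c], rule conjI[OF c], intro allI impI)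
    subgoal premises asm for \<kappa>\<^sub>0 \<gamma> \<delta>
      proof -
        note k0 = asm(1) and d = asm(3,4)
        have k1: "\<kappa>\<^sub>0 \<le> rip_scale K / 2" and k2: "\<kappa>\<^sub>0 \<le> 1 / (2048 * c\<^sup>2)" using k0 by (auto simp: kb_def)
        have k3: "2048 * c\<^sup>2 * \<kappa>\<^sub>0 \<le> 1" using k2 c by (simp add: pos_le_divide_eq mult.commute)
        define C1 where "C1 = 48 / sqrt \<delta>"
        define X where "X = 32 * (64 * K ^ 4 * (C1\<^sup>2 + 1))\<^sup>2 + 16 * (64 * K ^ 4 * (C1\<^sup>2 + 1))"
        have X: "X > 0" unfolding X_def using K(1)
          by (intro add_nonneg_pos mult_pos_pos) (auto intro!: add_nonneg_pos)
        \<comment> \<open>The solution of \<open>X / C0^2 = \<delta> / 4\<close>, the probability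
          allotted to the Chebyshev event of the statistic.\<close>
        define C0 where "C0 = sqrt (4 * X / \<delta>)"
        have C0: "C0 > 0" "X / C0\<^sup>2 \<le> \<delta> / 4" using X d by (auto simp: C0_def)
        define S2 where "S2 = 3 / 2 * (C1\<^sup>2 + 1)"
        have S2: "S2 \<ge> 0" by (simp add: S2_def)
        define H where "H = 4 * C0 * (C0 + 2)"
        have H: "H \<ge> 0" using C0 by (simp add: H_def)
        \<comment> \<open>One constant for all claims: \<open>C0\<close> serves the statistic,
          \<open>1 + 2 * C0\<close> its square root, and \<open>H * S2 + C0\<close> the thresholded
          estimator.\<close>
        define C where "C = H * S2 + C0 + (1 + 2 * C0)"
        have Cge: "C0 \<le> C" "1 + 2 * C0 \<le> C" "H * S2 + C0 \<le> C" "C > 0"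
          using C0(1) mult_nonneg_nonneg[OF H S2] by (auto simp: C_def)
        define N0 where "N0 = 2 * (nat \<lceil>4096 * K ^ 4 / \<delta>\<rceil> + 2)"
        show ?thesis
          apply (rule exI[of _ C], rule exI[of _ N0], rule conjI[OF Cge(4)], intro allI impI)
          subgoal premises asm for N n p s D
            proof -
              note N = asm(1,2) and p = asm(3) and s = asm(5,6) and sp = asm(7) and law = asm(8)
                and sgL = asm(9) and sgM = asm(10)
              have "n \<ge> nat \<lceil>4096 * K ^ 4 / \<delta>\<rceil> + 2" using N by (simp add: N0_def)
              note n = sample_size_conditions[OF K(1) d(1) this]
              interpret S: subgauss_law N p D K
              proof
                show "design_noise_law N p D" by (rule law)
                show "K \<ge> 1" by (rule K(1))
                fix k assume k: "k \<in> ({..<N} \<times> {..<p}) <+> {..<N}"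
                have e1: "coord (Inl ij) = (\<lambda>(x, \<xi>). x ij)" and e2: "coord (Inr i) = (\<lambda>(x, \<xi>). \<xi> i)" for ij i
                  by (auto simp: fun_eq_iff)
                show "subgaussian D K (coord k)"
                proof (cases k)
                  case (Inl ij)
                  then have "subgaussian D M (coord k)" using k sgM by (cases ij) (auto simp: e1)
                  then show ?thesis by (rule subgaussian_mono) (use assms K in auto)
                next
                  case (Inr i)
                  then have "subgaussian D L (coord k)" using k sgL by (auto simp: e2)
                  then show ?thesis by (rule subgaussian_mono) (use assms K in auto)
                qed
              qed
              have p1: "p \<ge> 1" using p by simp
              have n1: "n \<ge> 1" using n(1) by simp
              have Np: "real N > 0" using N n1 by simp
              have k: "real s * log_rank p s \<le> 2 * \<kappa>\<^sub>0 * real n"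
              proof -
                have "real s * log_rank p s \<le> \<kappa>\<^sub>0 * real N"
                  using sp unfolding ln_exp_mult_eq_log_rank[OF s] pos_divide_le_eq[OF Np] .
                then show ?thesis by (simp add: N mult_ac)
              qed
              have "real 1 * log_rank p 1 \<le> real s * log_rank p s" using s by (intro mult_log_rank_mono) auto
              also have "\<dots> \<le> 2 * \<kappa>\<^sub>0 * real n" by (rule k)
              also have "\<dots> \<le> rip_scale K * real n" using k1 by (intro mult_right_mono) auto
              finally have small: "log_rank p 1 \<le> rip_scale K * real n" by simp
              define rate where "rate \<sigma> \<rho> = \<sigma>\<^sup>2 * (sqrt (real p) / real N) + \<sigma> * (\<rho> / sqrt (real N))" for \<sigma> \<rho> :: real
              \<comment> \<open>The square root of the first term of the rate. As
                \<open>p powr (1/4)\<close> is at least 1, the second term is at most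
                \<open>v \<sigma> * \<rho>\<close>, which is what \<open>threshold_error\<close> and
                \<open>sqrt_error\<close> ask for.\<close>
              define v where "v \<sigma> = \<sigma> * (real p powr (1/4) / sqrt (real N))" for \<sigma> :: real
              have p4: "real p powr (1/4) \<ge> 1" using p1 by (intro ge_one_powr_ge_zero) auto
              have p42: "(real p powr (1/4))\<^sup>2 = sqrt (real p)"
                using p1 by (simp add: power2_eq_square powr_add[symmetric] powr_half_sqrt)
              have v: "v \<sigma> > 0" "(v \<sigma>)\<^sup>2 = \<sigma>\<^sup>2 * (sqrt (real p) / real N)" "\<rho> \<ge> 0 \<Longrightarrow> \<sigma> * (\<rho> / sqrt (real N)) \<le> v \<sigma> * \<rho>"
                if "\<sigma> > 0" for \<sigma> \<rho>
              proof -
                show "v \<sigma> > 0" unfolding v_def using that p Np by (intro mult_pos_pos divide_pos_pos) auto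
                show "(v \<sigma>)\<^sup>2 = \<sigma>\<^sup>2 * (sqrt (real p) / real N)"
                  by (simp add: v_def power_mult_distrib power_divide p42)
                assume r: "\<rho> \<ge> 0"
                have "\<sigma> * (\<rho> / sqrt (real N)) * 1 \<le> \<sigma> * (\<rho> / sqrt (real N)) * real p powr (1/4)"
                  using r that p4 by (intro mult_left_mono) auto
                then show "\<sigma> * (\<rho> / sqrt (real N)) \<le> v \<sigma> * \<rho>" by (simp add: v_def mult_ac)
              qed
              have rate0: "rate \<sigma> \<rho> \<ge> 0" if "\<sigma> > 0" "\<rho> \<ge> 0" for \<sigma> \<rho>
                using that by (simp add: rate_def)
              have rho0: "l2_norm p \<theta> \<ge> 0" for \<theta> by (simp add: l2_norm_def)
              have obs: "obs_prob N p D \<theta> \<sigma> E \<le> ennreal \<delta>"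
                if R: "R1 \<union> R2 = {..<N}" "R1 \<inter> R2 = {}" "card R1 = n" "card R2 = n" and srs: "srs_estimator c R1 p th"
                  and th: "\<theta> \<in> sparse_vecs p s" and sg: "\<sigma> > 0"
                  and good: "\<And>d. \<bar>Q_HD R1 R2 p th d - (l2_norm p \<theta>)\<^sup>2\<bar> \<le> C0 * rate \<sigma> (l2_norm p \<theta>) \<Longrightarrow> \<not> E d"
                for R1 R2 th \<theta> \<sigma> E
              proof -
                have R1s: "R1 \<subseteq> {..<N}" and R2s: "R2 \<subseteq> {..<N}" using R(1) by auto
                have th_meas: "th \<in> sample_space R1 p \<rightarrow>\<^sub>M vec_space p" using srs unfolding srs_estimator_def by blast
                show ?thesis
                proof (rule S.estimator_obs_prob[OF R1s R2s R(2-4) n(1) N(1) p1 sg d(1) th_meas small n(2,3) C1_def C0(1)])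
                  show "(32 * (64 * K ^ 4 * (C1\<^sup>2 + 1))\<^sup>2 + 16 * (64 * K ^ 4 * (C1\<^sup>2 + 1))) / C0\<^sup>2 \<le> \<delta> / 4"
                    using C0(2) by (simp add: X_def)
                  fix w assume w: "w \<in> space D" "S.design_good R1 n w"
                  show "L2_set (\<lambda>j. th (observe R1 p \<theta> \<sigma> (subsample R1 p w)) j - \<theta> j) {..<p}
                      \<le> 24 * (\<sigma> * L2_set (snd w) R1) / sqrt (real n)"
                    by (rule S.srs_error_good[OF R1s R(3) n1 srs[unfolded c_def] th s k k3[unfolded c_def] sg w])
                qed (use good in \<open>simp add: rate_def\<close>)
              qed
              \<comment> \<open>The estimator for (c) and (d) may use a fixed split, whereas (a) and
                (b) range over all splits into halves.\<close>
              define R1 where "R1 = {..<n}"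
              define R2 where "R2 = {n..<N}"
              have R: "R1 \<subseteq> {..<N}" "R2 \<subseteq> {..<N}" "R1 \<inter> R2 = {}" "card R1 = n" "card R2 = n"
                by (auto simp: R1_def R2_def N)
              define th where "th = sparse_lsq p s R1"
              have th_meas: "th \<in> sample_space R1 p \<rightarrow>\<^sub>M vec_space p" unfolding th_def by (rule sparse_lsq_measurable)
              define Y where "Y d = (\<Sum>k\<in>R2. (residual p (th (subsample R1 p d)) (subsample R2 p d) k)\<^sup>2) / real n" for d
              \<comment> \<open>Off the exceptional set \<open>Y d\<close> lies between constant
                multiples of \<sigma>^2, so the threshold is of the order of the first term of the
                rate without knowledge of \<sigma>.\<close>
              define T where "T d = (if H * Y d * (sqrt (real p) / real N) < Q_HD R1 R2 p th d then Q_HD R1 R2 p th d else 0)" for d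
              have T: "T \<in> estimators N p"
              proof -
                have [measurable]: "Q_HD R1 R2 p th \<in> borel_measurable (sample_space {..<N} p)"
                  by (rule Q_HD_measurable(1)[OF R(1,2) th_meas])
                have [measurable]: "Y \<in> borel_measurable (sample_space {..<N} p)"
                  unfolding Y_def[abs_def] by (intro borel_measurable_divide Q_HD_measurable(2)[OF R(1,2) th_meas]) auto
                show ?thesis unfolding estimators_def T_def[abs_def] by measurable
              qed
              \<comment> \<open>With \<open>r\<close> the norm of \<theta> this yields (c), and with
                \<open>r\<close> = \<kappa> it yields (d), the bound being increasing in
                \<open>r\<close>.\<close>
              have obsT: "obs_prob N p D \<theta> \<sigma> (\<lambda>d. \<bar>T d - (l2_norm p \<theta>)\<^sup>2\<bar> > min (C * rate \<sigma> r) (r\<^sup>2)) \<le> ennreal \<delta>"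
                if \<theta>: "\<theta> \<in> sparse_vecs p s" and sg: "\<sigma> > 0" and r: "l2_norm p \<theta> \<le> r" for \<theta> \<sigma> r
              proof (rule S.estimator_obs_prob[OF R n(1) N(1) p1 sg d(1) th_meas small n(2,3) C1_def C0(1)])
                show "(32 * (64 * K ^ 4 * (C1\<^sup>2 + 1))\<^sup>2 + 16 * (64 * K ^ 4 * (C1\<^sup>2 + 1))) / C0\<^sup>2 \<le> \<delta> / 4"
                  using C0(2) by (simp add: X_def)
                show "L2_set (\<lambda>j. th (observe R1 p \<theta> \<sigma> (subsample R1 p w)) j - \<theta> j) {..<p}
                    \<le> 24 * (\<sigma> * L2_set (snd w) R1) / sqrt (real n)" if "w \<in> space D" "S.design_good R1 n w" for w
                  unfolding th_def by (rule S.sparse_lsq_error_good[OF n1 \<theta> s k k3[unfolded c_def] sg that(2)])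
                fix d
                define \<rho> where "\<rho> = l2_norm p \<theta>"
                define V where "V = \<sigma>\<^sup>2 * (sqrt (real p) / real N)"
                have V1: "V = (v \<sigma>)\<^sup>2" unfolding V_def by (rule v(2)[OF sg, symmetric])
                have V: "V > 0" "sqrt V = v \<sigma>" unfolding V1 using v(1)[OF sg] by auto
                assume Q: "\<bar>Q_HD R1 R2 p th d - (l2_norm p \<theta>)\<^sup>2\<bar>
                    \<le> C0 * (\<sigma>\<^sup>2 * (sqrt (real p) / real N) + \<sigma> * (l2_norm p \<theta> / sqrt (real N)))"
                  and Y1: "1 / 2 * \<sigma>\<^sup>2 \<le> (\<Sum>k\<in>R2. (residual p (th (subsample R1 p d)) (subsample R2 p d) k)\<^sup>2) / n"
                  and Y2: "(\<Sum>k\<in>R2. (residual p (th (subsample R1 p d)) (subsample R2 p d) k)\<^sup>2) / n \<le> 3 / 2 * (C1\<^sup>2 + 1) * \<sigma>\<^sup>2"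
                have q0: "sqrt (real p) / real N \<ge> 0" by simp
                have t1: "H / 2 * V \<le> H * Y d * (sqrt (real p) / real N)"
                  using mult_right_mono[OF mult_left_mono[OF Y1 H] q0] by (simp add: V_def Y_def mult_ac)
                have t2: "H * Y d * (sqrt (real p) / real N) \<le> H * S2 * V"
                  using mult_right_mono[OF mult_left_mono[OF Y2 H] q0] by (simp add: V_def Y_def S2_def mult_ac)
                have "\<bar>T d - \<rho>\<^sup>2\<bar> \<le> min ((H * S2 + C0) * (V + \<sigma> * (\<rho> / sqrt (real N)))) (\<rho>\<^sup>2)"
                  unfolding T_def
                proof (rule threshold_error[OF V(1) _ _ _ _ S2 H_def t1 t2])
                  show "\<sigma> * (\<rho> / sqrt (real N)) \<le> sqrt V * \<rho>" unfolding V(2) by (rule v(3)[OF sg]) (simp add: \<rho>_def rho0)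
                  show "\<bar>Q_HD R1 R2 p th d - \<rho>\<^sup>2\<bar> \<le> C0 * (V + \<sigma> * (\<rho> / sqrt (real N)))" using Q by (simp add: V_def \<rho>_def)
                qed (use C0 sg rho0 in \<open>auto simp: \<rho>_def\<close>)
                also have "\<dots> \<le> min (C * rate \<sigma> r) (r\<^sup>2)"
                proof (rule min.mono)
                  have "V + \<sigma> * (\<rho> / sqrt (real N)) \<le> rate \<sigma> r"
                    using r sg by (auto simp: rate_def V_def \<rho>_def intro!: mult_left_mono divide_right_mono)
                  moreover have "V + \<sigma> * (\<rho> / sqrt (real N)) \<ge> 0" using V sg rho0[of \<theta>] by (simp add: \<rho>_def)
                  ultimately show "(H * S2 + C0) * (V + \<sigma> * (\<rho> / sqrt (real N))) \<le> C * rate \<sigma> r"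
                    using Cge by (intro mult_mono) auto
                  show "\<rho>\<^sup>2 \<le> r\<^sup>2" using r rho0[of \<theta>] by (auto simp: \<rho>_def intro: power_mono)
                qed
                finally show "\<not> min (C * rate \<sigma> r) (r\<^sup>2) < \<bar>T d - (l2_norm p \<theta>)\<^sup>2\<bar>"
                  unfolding \<rho>_def by (simp only: not_less)
              qed
              show ?thesis
              proof (intro conjI allI impI)
                fix R1 R2 th
                assume R: "R1 \<union> R2 = {..<N}" "R1 \<inter> R2 = {}" "card R1 = n" "card R2 = n" and srs: "srs_estimator c R1 p th"
                show "(SUP \<sigma>\<in>{0<..}. SUP \<theta>\<in>sparse_vecs p s. obs_prob N p D \<theta> \<sigma>
                      (\<lambda>d. \<bar>Lambda_HD R1 R2 p th d - l2_norm p \<theta>\<bar>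
                         > C * \<sigma> * (real p powr (1/4) / sqrt (real N)))) \<le> ennreal \<delta>"
                proof (intro SUP_least obs[OF R srs])
                  fix \<sigma> :: real and \<theta> d
                  assume "\<sigma> \<in> {0<..}" and Q: "\<bar>Q_HD R1 R2 p th d - (l2_norm p \<theta>)\<^sup>2\<bar> \<le> C0 * rate \<sigma> (l2_norm p \<theta>)"
                  then have sg: "\<sigma> > 0" by simp
                  have "\<bar>sqrt \<bar>Q_HD R1 R2 p th d\<bar> - l2_norm p \<theta>\<bar> \<le> (1 + 2 * C0) * v \<sigma>"
                    by (rule sqrt_error[OF v(1)[OF sg] v(3)[OF sg rho0] rho0])
                       (use C0 Q v(2)[OF sg] in \<open>auto simp: rate_def\<close>)
                  also have "\<dots> \<le> C * v \<sigma>" using Cge v(1)[OF sg] by (intro mult_right_mono) auto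
                  finally show "\<not> C * \<sigma> * (real p powr (1/4) / sqrt (real N)) < \<bar>Lambda_HD R1 R2 p th d - l2_norm p \<theta>\<bar>"
                    by (simp add: Lambda_HD_def v_def mult.assoc)
                qed auto
                show "(SUP \<sigma>\<in>{0<..}. SUP \<theta>\<in>sparse_vecs p s. obs_prob N p D \<theta> \<sigma>
                      (\<lambda>d. \<bar>Q_HD R1 R2 p th d - (l2_norm p \<theta>)\<^sup>2\<bar>
                         > C * (\<sigma>\<^sup>2 * (sqrt (real p) / real N) + \<sigma> * (l2_norm p \<theta> / sqrt (real N)))))
                     \<le> ennreal \<delta>"
                proof (intro SUP_least obs[OF R srs])
                  fix \<sigma> :: real and \<theta> d
                  assume "\<sigma> \<in> {0<..}" and Q: "\<bar>Q_HD R1 R2 p th d - (l2_norm p \<theta>)\<^sup>2\<bar> \<le> C0 * rate \<sigma> (l2_norm p \<theta>)"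
                  then have "C0 * rate \<sigma> (l2_norm p \<theta>) \<le> C * rate \<sigma> (l2_norm p \<theta>)"
                    using Cge rate0[of \<sigma> "l2_norm p \<theta>"] rho0 by (intro mult_right_mono) auto
                  then show "\<not> C * (\<sigma>\<^sup>2 * (sqrt (real p) / real N) + \<sigma> * (l2_norm p \<theta> / sqrt (real N)))
                      < \<bar>Q_HD R1 R2 p th d - (l2_norm p \<theta>)\<^sup>2\<bar>"
                    using Q unfolding rate_def by linarith
                qed auto
              next
                show "(INF T\<in>estimators N p. SUP \<sigma>\<in>{0<..}. SUP \<theta>\<in>sparse_vecs p s. obs_prob N p D \<theta> \<sigma>
                   (\<lambda>d. \<bar>T d - (l2_norm p \<theta>)\<^sup>2\<bar>
                      > min (C * (\<sigma>\<^sup>2 * (sqrt (real p) / real N) + \<sigma> * (l2_norm p \<theta> / sqrt (real N))))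
                            ((l2_norm p \<theta>)\<^sup>2))) \<le> ennreal \<delta>"
                  using obsT by (intro INF_lower2[OF T] SUP_least) (auto simp: rate_def)
                fix \<kappa> :: real assume "\<kappa> > 0"
                show "(INF T\<in>estimators N p. SUP \<sigma>\<in>{0<..}.
                     SUP \<theta>\<in>{\<theta> \<in> sparse_vecs p s. l2_norm p \<theta> \<le> \<kappa>}. obs_prob N p D \<theta> \<sigma>
                     (\<lambda>d. \<bar>T d - (l2_norm p \<theta>)\<^sup>2\<bar>
                        > min (C * (\<sigma>\<^sup>2 * (sqrt (real p) / real N) + \<sigma> * (\<kappa> / sqrt (real N))))
                              (\<kappa>\<^sup>2))) \<le> ennreal \<delta>"
                  using obsT by (intro INF_lower2[OF T] SUP_least) (auto simp: rate_def)
              qed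
            qed
          done
      qed
    done
qed

end
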